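(* Let $\mu\in\mathbb{C}^*$. Then: 1. The characteristic variety of $\mathcal{M}_\mu=D_N/\mathcal{I}_\mu$ is the reduced and irreducible subspace $Z\subset T^*_N$ defined by the vanishing of the symbols of the operators $A_{p,q}$ ($p\in[1,k-1]$, $q\in[2,k]$) and $\mathcal{T}^m_\mu$ ($m\in[2,k]$). 2. For each $h\in[1,k]$, right multiplication by $\partial_h$ sends $\mathcal{I}_{\mu+1}$ into $\mathcal{I}_\mu$. 3. Right multiplication by each of $U_{-1}$, $U_0$ and $U_1+\mu\sigma_1$ sends $\mathcal{I}_\mu$ into itself. 4. Right multiplication by $E+\mu$ sends $\mathcal{I}_{\mu+1}$ into $\mathcal{I}_\mu$.
   Context: Let $k\ge 2$ be an integer and $N=\mathbb{C}^k$ with coordinates $\sigma_1,\dots,\sigma_k$, $\partial_h=\partial/\partial\sigma_h$; $D_N$ is the sheaf of holomorphic differential operators on $N$. $T^*_N\simeq N\times\mathbb{C}^k$ is the cotangent bundle with fiber coordinates $\eta_1,\dots,\eta_k$ (symbols of $\partial_1,\dots,\partial_k$). Intervals $[p,q]$ are intervals of integers; $\sigma_0:=1$, $\sigma_{k+1}:=0$. Put $$E=\sum_{h=1}^k\sigma_h\partial_h,\quad U_{-1}=\sum_{h=0}^{k-1}(k-h)\sigma_h\partial_{h+1},\quad U_0=\sum_{h=1}^k h\sigma_h\partial_h,\quad U_1=\sum_{h=1}^k(\sigma_1\sigma_h-(h+1)\sigma_{h+1})\partial_h .$$ For $\mu\in\mathbb{C}$, $\mathcal{I}_\mu$ is the left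 ideal of $D_N$ generated by $A_{p,q}=\partial_p\partial_q-\partial_{p+1}\partial_{q-1}$ ($p\in[1,k-1]$, $q\in[2,k]$) and $\mathcal{T}^m_\mu=\partial_1\partial_{m-1}+\partial_m(E+\mu)$ ($m\in[2,k]$). Thus $Z$ is defined by $\eta_p\eta_q-\eta_{p+1}\eta_{q-1}=0$ and $\eta_1\eta_{m-1}+\eta_m\sum_{h=1}^k\sigma_h\eta_h=0$. *)

theory Defs
  imports "HOL-Analysis.Analysis"
begin

text \<open>
  \<open>N\<close> is \<open>complex ^ 'k\<close> with \<open>k = CARD('k)\<close>.  The index type is linearly ordered only in order to
  number the coordinates \<open>1, \<dots>, k\<close>.
\<close>

type_synonym 'k base = "(complex, 'k) vec"

section \<open>Holomorphic functions and partial derivatives\<close>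

definition holo_on :: "(complex ^ 'n::finite) set \<Rightarrow> (complex ^ 'n::finite \<Rightarrow> complex) \<Rightarrow> bool" where
  "holo_on U f \<longleftrightarrow>
     (\<forall>x\<in>U. \<exists>f'. (f has_derivative f') (at x) \<and> (\<forall>c v. f' (c *s v) = c * f' v))"

definition pd :: "'n::finite \<Rightarrow> (complex ^ 'n \<Rightarrow> complex) \<Rightarrow> (complex ^ 'n \<Rightarrow> complex)" where
  "pd i f = (\<lambda>x. deriv (\<lambda>t. f (x + axis i t)) 0)"

definition mpd ::
  "('k::{finite,linorder} \<Rightarrow> nat) \<Rightarrow> ('k base \<Rightarrow> complex) \<Rightarrow> ('k base \<Rightarrow> complex)" where
  "mpd \<alpha> = foldr (\<lambda>i. pd i ^^ \<alpha> i) (sorted_list_of_set UNIV)"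

definition mi_deg :: "('k::finite \<Rightarrow> nat) \<Rightarrow> nat" where
  "mi_deg \<alpha> = (\<Sum>i\<in>UNIV. \<alpha> i)"

section \<open>Holomorphic differential operators\<close>

text \<open>
  A section of \<open>D\<^sub>N\<close> over an open set \<open>U\<close> is given by its action on the holomorphic functions on the
  open subsets of \<open>U\<close>.  The type below consists of operators on all functions; what an operator does
  to a function outside its domain of holomorphy is irrelevant, and two operators represent the same
  section over \<open>U\<close> if they agree, on every open \<open>V \<subseteq> U\<close>, on the functions holomorphic on \<open>V\<close>.
  The product in \<open>D\<^sub>N\<close> is composition; right multiplication by \<open>Q\<close> is \<open>\<lambda>P. P \<circ> Q\<close>.
\<close>

type_synonym 'k diffop = "('k base \<Rightarrow> complex) \<Rightarrow> ('k base \<Rightarrow> complex)"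

definition has_expansion ::
  "('k::{finite,linorder} base) set \<Rightarrow> nat \<Rightarrow> (('k \<Rightarrow> nat) \<Rightarrow> 'k base \<Rightarrow> complex)
     \<Rightarrow> 'k diffop \<Rightarrow> bool" where
  "has_expansion U m a P \<longleftrightarrow>
     (\<forall>\<alpha>. mi_deg \<alpha> \<le> m \<longrightarrow> holo_on U (a \<alpha>)) \<and>
     (\<forall>V f. open V \<and> V \<subseteq> U \<and> holo_on V f \<longrightarrow>
        (\<forall>x\<in>V. P f x = (\<Sum>\<alpha> | mi_deg \<alpha> \<le> m. a \<alpha> x * mpd \<alpha> f x)))"

text \<open>Sections of \<open>D\<^sub>N\<close> over an open set have locally finite order.\<close>

definition D_sections :: "('k::{finite,linorder} base) set \<Rightarrow> 'k diffop set" where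
  "D_sections U =
     {P. \<forall>x\<in>U. \<exists>V m a. open V \<and> x \<in> V \<and> V \<subseteq> U \<and> has_expansion V m a P}"

text \<open>Sections over \<open>U\<close> of the left ideal sheaf of \<open>D\<^sub>N\<close> generated by a set \<open>S\<close> of global operators.\<close>

definition left_ideal ::
  "'k::{finite,linorder} diffop set \<Rightarrow> ('k base) set \<Rightarrow> 'k diffop set" where
  "left_ideal S U =
     {P \<in> D_sections U. \<forall>x\<in>U. \<exists>V F Q. open V \<and> x \<in> V \<and> V \<subseteq> U \<and>
        finite F \<and> F \<subseteq> S \<and> (\<forall>G\<in>F. Q G \<in> D_sections V) \<and>
        (\<forall>W f. open W \<and> W \<subseteq> V \<and> holo_on W f \<longrightarrow>
           (\<forall>y\<in>W. P f y = (\<Sum>G\<in>F. Q G (G f) y)))}"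

section \<open>The cotangent bundle and the characteristic variety\<close>

text \<open>
  \<open>T\<^sup>*N\<close> is \<open>complex ^ ('k + 'k)\<close>: the components \<open>Inl i\<close> are those of the base point, the components
  \<open>Inr i\<close> are the fibre coordinates.
\<close>

type_synonym 'k cotangent = "(complex, 'k + 'k) vec"

definition base_pt :: "'k::finite cotangent \<Rightarrow> 'k base" where
  "base_pt z = (\<chi> i. z $ Inl i)"

definition fibre_pt :: "'k::finite cotangent \<Rightarrow> 'k base" where
  "fibre_pt z = (\<chi> i. z $ Inr i)"

definition symbol ::
  "nat \<Rightarrow> (('k::finite \<Rightarrow> nat) \<Rightarrow> 'k base \<Rightarrow> complex) \<Rightarrow> 'k cotangent \<Rightarrow> complex" where
  "symbol m a z =
     (\<Sum>\<alpha> | mi_deg \<alpha> = m. a \<alpha> (base_pt z) * (\<Prod>i\<in>UNIV. (fibre_pt z $ i) ^ \<alpha> i))"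

text \<open>
  The characteristic variety of \<open>D\<^sub>N / I\<close>, for a left ideal sheaf \<open>I\<close>: the support of
  \<open>gr D\<^sub>N / gr I\<close>, where \<open>gr\<close> is taken for the order filtration, that is, the common zero set of the
  symbols of all local sections of \<open>I\<close>.
\<close>

definition char_variety ::
  "(('k::{finite,linorder} base) set \<Rightarrow> 'k diffop set) \<Rightarrow> ('k cotangent) set" where
  "char_variety I =
     {z. \<forall>U m a. \<forall>P\<in>I U. open U \<and> base_pt z \<in> U \<and> has_expansion U m a P \<longrightarrow> symbol m a z = 0}"

section \<open>Complex subspaces\<close>

text \<open>
  A set \<open>S\<close> of entire functions defines the complex subspace with ideal sheaf generated by \<open>S\<close>; its
  underlying set is \<open>zero_locus S\<close>.
\<close>

definition zero_locus :: "(complex ^ 'n::finite \<Rightarrow> complex) set \<Rightarrow> (complex ^ 'n) set" where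
  "zero_locus S = {z. \<forall>s\<in>S. s z = 0}"

definition germ_in_ideal ::
  "(complex ^ 'n::finite \<Rightarrow> complex) set \<Rightarrow> complex ^ 'n \<Rightarrow> (complex ^ 'n \<Rightarrow> complex) \<Rightarrow> bool" where
  "germ_in_ideal S z f \<longleftrightarrow>
     (\<exists>W F g. open W \<and> z \<in> W \<and> finite F \<and> F \<subseteq> S \<and> (\<forall>s\<in>F. holo_on W (g s)) \<and>
        (\<forall>w\<in>W. f w = (\<Sum>s\<in>F. g s w * s w)))"

text \<open>All local rings of the subspace are reduced.\<close>

definition reduced_subspace :: "(complex ^ 'n::finite \<Rightarrow> complex) set \<Rightarrow> bool" where
  "reduced_subspace S \<longleftrightarrow>
     (\<forall>z\<in>zero_locus S. \<forall>W f n. open W \<and> z \<in> W \<and> holo_on W f \<and>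
        germ_in_ideal S z (\<lambda>w. f w ^ n) \<longrightarrow> germ_in_ideal S z f)"

definition analytic_subset :: "(complex ^ 'n::finite) set \<Rightarrow> bool" where
  "analytic_subset A \<longleftrightarrow>
     (\<forall>z. \<exists>W F. open W \<and> z \<in> W \<and> finite F \<and> (\<forall>f\<in>F. holo_on W f) \<and>
        A \<inter> W = {w \<in> W. \<forall>f\<in>F. f w = 0})"

definition irreducible_subset :: "(complex ^ 'n::finite) set \<Rightarrow> bool" where
  "irreducible_subset Z \<longleftrightarrow> Z \<noteq> {} \<and>
     (\<forall>A B. analytic_subset A \<and> analytic_subset B \<and> Z = A \<union> B \<longrightarrow> Z = A \<or> Z = B)"

section \<open>The operators\<close>

definition crd :: "nat \<Rightarrow> 'k::{finite,linorder}" where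
  "crd h = sorted_list_of_set UNIV ! (h - 1)"

definition sig :: "nat \<Rightarrow> 'k::{finite,linorder} base \<Rightarrow> complex" where
  "sig h x = (if h = 0 then 1 else if h \<le> CARD('k) then x $ crd h else 0)"

definition dd :: "nat \<Rightarrow> 'k::{finite,linorder} diffop" where
  "dd h = pd (crd h)"

definition E_op :: "'k::{finite,linorder} diffop" where
  "E_op f = (\<lambda>x. \<Sum>h=1..CARD('k). sig h x * dd h f x)"

definition Um1_op :: "'k::{finite,linorder} diffop" where
  "Um1_op f = (\<lambda>x. \<Sum>h=0..CARD('k) - 1. of_nat (CARD('k) - h) * sig h x * dd (h + 1) f x)"

definition U0_op :: "'k::{finite,linorder} diffop" where
  "U0_op f = (\<lambda>x. \<Sum>h=1..CARD('k). of_nat h * sig h x * dd h f x)"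

definition U1_op :: "'k::{finite,linorder} diffop" where
  "U1_op f =
     (\<lambda>x. \<Sum>h=1..CARD('k). (sig 1 x * sig h x - of_nat (h + 1) * sig (h + 1) x) * dd h f x)"

definition A_op :: "nat \<Rightarrow> nat \<Rightarrow> 'k::{finite,linorder} diffop" where
  "A_op p q f = (\<lambda>x. dd p (dd q f) x - dd (p + 1) (dd (q - 1) f) x)"

definition T_op :: "complex \<Rightarrow> nat \<Rightarrow> 'k::{finite,linorder} diffop" where
  "T_op \<mu> m f = (\<lambda>x. dd 1 (dd (m - 1) f) x + dd m (\<lambda>y. E_op f y + \<mu> * f y) x)"

definition I_sheaf ::
  "complex \<Rightarrow> ('k::{finite,linorder} base) set \<Rightarrow> 'k diffop set" where
  "I_sheaf \<mu> = left_ideal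
     ({A_op p q | p q. p \<in> {1..CARD('k) - 1} \<and> q \<in> {2..CARD('k)}} \<union>
      {T_op \<mu> m | m. m \<in> {2..CARD('k)}})"

section \<open>The symbols of the generators\<close>

definition eta :: "nat \<Rightarrow> 'k::{finite,linorder} cotangent \<Rightarrow> complex" where
  "eta h z = fibre_pt z $ crd h"

definition A_symb :: "nat \<Rightarrow> nat \<Rightarrow> 'k::{finite,linorder} cotangent \<Rightarrow> complex" where
  "A_symb p q z = eta p z * eta q z - eta (p + 1) z * eta (q - 1) z"

definition T_symb :: "nat \<Rightarrow> 'k::{finite,linorder} cotangent \<Rightarrow> complex" where
  "T_symb m z =
     eta 1 z * eta (m - 1) z + eta m z * (\<Sum>h=1..CARD('k). sig h (base_pt z) * eta h z)"

definition Z_eqs :: "('k::{finite,linorder} cotangent \<Rightarrow> complex) set" where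
  "Z_eqs =
     {A_symb p q | p q. p \<in> {1..CARD('k) - 1} \<and> q \<in> {2..CARD('k)}} \<union>
     {T_symb m | m. m \<in> {2..CARD('k)}}"

end

theory Submission
  imports Defs "HOL-Complex_Analysis.Complex_Analysis"
    "HOL-Computational_Algebra.Fundamental_Theorem_Algebra"
begin

unbundle no fps_syntax

text \<open>
  With the convention \<open>\<partial>\<^sub>0 = - (E + \<mu>)\<close> the operator \<open>T_op \<mu> m\<close> is \<open>- A_op 0 m\<close>, and the stability of the
  ideals under right multiplication is a computation in the Weyl algebra.

  The points of \<open>zero_locus Z_eqs\<close> are the pairs \<open>(\<sigma>, \<eta>)\<close> with \<open>\<eta>\<^sub>h = l x\<^bsup>k - h\<^esup>\<close>, where \<open>x\<close> is a root of
  \<open>P\<^sub>\<sigma>(u) = u\<^bsup>k\<^esup> + \<sigma>\<^sub>1 u\<^bsup>k - 1\<^esup> + \<dots> + \<sigma>\<^sub>k\<close>; any two of them lie on a polynomial curve in the variety, which gives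
  irreducibility.  For fixed \<open>x\<close> the function \<open>P\<^sub>\<sigma>(x)\<^bsup>-\<mu>\<^esup>\<close> of \<open>\<sigma>\<close> is annihilated by the generators of the ideal
  and singular along the hyperplane \<open>P\<^sub>\<sigma>(x) = 0\<close>, whose conormal direction is \<open>\<eta>\<close>.  An operator \<open>Q\<close> of order
  \<open>m\<close> in the ideal kills it, and the most singular term of the result is the symbol of \<open>Q\<close> at \<open>(\<sigma>, \<eta>)\<close>, which
  therefore vanishes.  If \<open>-\<mu> = n\<close> is a natural number below \<open>m\<close>, then \<open>P\<^sub>\<sigma>(x)\<^bsup>n\<^esup> ln P\<^sub>\<sigma>(x)\<close> takes its place: the
  generators map it to holomorphic functions.

  For reducedness, a function \<open>f\<close> vanishing on the variety is shown to lie in the ideal.  Off the zero section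
  the equations can be solved for \<open>\<sigma>\<^sub>k\<close> and \<open>\<eta>\<^sub>1, \<dots>, \<eta>\<^sub>k\<^sub>-\<^sub>2\<close>, and Hadamard's lemma applies.  At the zero section
  write \<open>f = \<Sum>\<eta>\<^sub>i F\<^sub>i\<close> and let \<open>S(u)\<close> be the polynomial \<open>l (P(u) - P(x)) / (u - x)\<close>, in which \<open>l x\<^bsup>j\<^esup>\<close> is replaced by
  \<open>\<eta>\<^sub>k\<^sub>-\<^sub>j\<close>.  Then \<open>\<eta>\<^sub>i\<close> is the mean of \<open>u\<^bsup>k - i\<^esup> u S(u) / P(u)\<close> over a large circle; replacing \<open>F\<^sub>i\<close> under this mean by
  its value at \<open>\<eta>\<^sub>h = \<eta>\<^sub>k u\<^bsup>k - h\<^esup>\<close> gives \<open>0\<close>, since \<open>f\<close> vanishes on the variety, and the error is a multiple of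
  \<open>(\<eta>\<^sub>p - \<eta>\<^sub>k u\<^bsup>k - p\<^esup>) S(u)\<close>, which modulo the ideal is divisible by \<open>P(u)\<close>, and so has mean \<open>0\<close> after division.
\<close>

section \<open>Holomorphic functions of several variables\<close>


text \<open>The obstacle is reducedness at the zero section. Where \<eta>_k is nonzero, the root x
  is the function \<eta>_(k-1) / \<eta>_k of the point and the variety is a graph; at \<eta> = 0
  every root of P_\<sigma> is admissible and no retraction onto the variety is at hand. A free
  variable u replaces x, and the mean over a circle around all roots replaces the choice of one. The
  form of S is read off the curve \<eta>_h = l x^(k-h): for a root x it is l P(u) / (u - x) there,
  so that u S(u) / P(u) = l u / (u - x), whose products with powers u^j have the means l x^j. The
  formula so guessed is linear in \<eta> and holds for all \<eta>. In the same way (x^d - u^d) S(u)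
  is a polynomial multiple of P(u) on the curve; for arbitrary \<eta> this becomes a congruence
  modulo the generators, and the congruence, not the statement on the variety, is what yields
  coefficients for the generators. Being integrals over one fixed circle, these coefficients depend
  holomorphically on the point.\<close>

lemma circle_mean_deriv:
  assumes r: "r > 0" and f: "f holomorphic_on U" "open U" "cball 0 r \<subseteq> U"
  shows "((\<lambda>s. f (of_real r * cis (2 * pi * s)) / (of_real r * cis (2 * pi * s)) ^ k) has_integral
           (deriv ^^ k) f 0 / fact k) {0..1}"
proof -
  have "((\<lambda>u. f u / (u - 0) ^ Suc k) has_contour_integral ((2 * pi * \<i>) / (fact k) * (deriv ^^ k) f 0))
     (circlepath 0 r)"
    using f r by (intro Cauchy_has_contour_integral_higher_derivative_circlepath)
      (meson ball_subset_cball dual_order.trans holomorphic_on_imp_continuous_on holomorphic_on_subset centre_in_ball)+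
  then have "((\<lambda>x. f (circlepath 0 r x) / circlepath 0 r x ^ Suc k *
      vector_derivative (circlepath 0 r) (at x within {0..1})) has_integral
       ((2 * pi * \<i>) / (fact k) * (deriv ^^ k) f 0)) {0..1}"
    by (simp add: has_contour_integral_def)
  then have "((\<lambda>x. inverse (2*pi*\<i>) * (f (circlepath 0 r x) / circlepath 0 r x ^ Suc k *
      vector_derivative (circlepath 0 r) (at x within {0..1}))) has_integral
       inverse (2*pi*\<i>) * ((2 * pi * \<i>) / (fact k) * (deriv ^^ k) f 0)) {0..1}"
    by (rule has_integral_mult_right)
  then show ?thesis
  proof (rule has_integral_eq_rhs[OF has_integral_eq, rotated])
    fix s :: real assume s: "s \<in> {0..1}"
    have c: "circlepath 0 r s = of_real r * cis (2 * pi * s)"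
      by (simp add: circlepath cis_conv_exp mult_ac)
    \<comment> \<open>On the circle dz = 2 \<pi> i z ds, so the parametrisation by \<open>s\<close>
      absorbs one factor of the denominator.\<close>
    have v: "vector_derivative (circlepath 0 r) (at s within {0..1}) = 2*pi*\<i> * (of_real r * cis (2 * pi * s))"
      using s by (simp add: vector_derivative_circlepath01 cis_conv_exp mult_ac)
    show "inverse (2*pi*\<i>) * (f (circlepath 0 r s) / circlepath 0 r s ^ Suc k *
      vector_derivative (circlepath 0 r) (at s within {0..1})) =
      f (of_real r * cis (2 * pi * s)) / (of_real r * cis (2 * pi * s)) ^ k"
      unfolding c v using r by (simp add: field_simps)
  qed (simp add: field_simps)
qed

lemma circle_mean_value:
  assumes "r > 0" "f holomorphic_on U" "open U" "cball 0 r \<subseteq> U"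
  shows "((\<lambda>s. f (of_real r * cis (2 * pi * s))) has_integral f 0) {0..1}"
  using circle_mean_deriv[OF assms, of 0] by simp

section \<open>Closure properties and chain rules for \<open>holo_on\<close>\<close>

lemma holo_on_subset: "holo_on U f \<Longrightarrow> V \<subseteq> U \<Longrightarrow> holo_on V f"
  by (auto simp: holo_on_def)

lemma axis_scale: "axis i (c * t) = c *s (axis i t :: complex ^ 'n)"
  by (simp add: vec_eq_iff axis_def)

lemma axis_zero: "axis i 0 = 0"
  by (simp add: vec_eq_iff axis_def)

lemma bounded_linear_axis: "bounded_linear (\<lambda>t. axis i t :: complex ^ 'n::finite)"
  by (intro linear_conv_bounded_linear[THEN iffD1] linearI) (auto simp: vec_eq_iff axis_def)

lemma has_derivative_axis: "((\<lambda>t. x + axis i t :: complex ^ 'n::finite) has_derivative (\<lambda>t. axis i t)) (at t0)"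
  using bounded_linear_imp_has_derivative[OF bounded_linear_axis]
  by (auto intro!: derivative_eq_intros)

text \<open>A complex-linear derivative is determined by its values on the axes, and these are
  one-variable complex derivatives. This trades the existential in \<open>holo_on\<close> for a
  formula in \<open>pd\<close>.\<close>

lemma complex_derivative_eq:
  fixes f :: "complex ^ 'n::finite \<Rightarrow> complex"
  assumes "(f has_derivative f') (at x)" "\<And>c v. f' (c *s v) = c * f' v"
  shows "f' = (\<lambda>v. \<Sum>i\<in>UNIV. v $ i * pd i f x)"
proof -
  have pd: "pd i f x = f' (axis i 1)" for i
  proof -
    have "((\<lambda>t. f (x + axis i t)) has_derivative (\<lambda>t. f' (axis i t))) (at 0)"
      by (rule has_derivative_compose[OF has_derivative_axis]) (use assms(1) in \<open>simp add: axis_zero\<close>)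
    moreover have "(\<lambda>t. f' (axis i t)) = (*) (f' (axis i 1))"
    proof
      fix t show "f' (axis i t) = f' (axis i 1) * t"
        using assms(2)[of t "axis i 1"] by (simp add: axis_scale[symmetric] mult.commute)
    qed
    ultimately have "((\<lambda>t. f (x + axis i t)) has_field_derivative f' (axis i 1)) (at 0)"
      unfolding has_field_derivative_def by simp
    then show ?thesis unfolding pd_def by (rule DERIV_imp_deriv)
  qed
  interpret bounded_linear f' using assms(1) by (rule has_derivative_bounded_linear)
  show ?thesis
  proof
    fix v
    have "f' v = f' (\<Sum>i\<in>UNIV. v $ i *s axis i 1)" by (simp add: basis_expansion)
    also have "\<dots> = (\<Sum>i\<in>UNIV. v $ i * f' (axis i 1))" by (simp add: sum assms(2))
    finally show "f' v = (\<Sum>i\<in>UNIV. v $ i * pd i f x)" by (simp add: pd)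
  qed
qed

lemma holo_on_has_derivative:
  assumes "holo_on U f" "x \<in> U"
  shows "(f has_derivative (\<lambda>v. \<Sum>i\<in>UNIV. v $ i * pd i f x)) (at x)"
  using assms complex_derivative_eq unfolding holo_on_def by blast

lemma holo_onI:
  assumes "\<And>x. x \<in> U \<Longrightarrow> (f has_derivative (\<lambda>v. \<Sum>i\<in>UNIV. v $ i * D i x)) (at x)"
  shows "holo_on U f"
  unfolding holo_on_def
proof
  fix x assume "x \<in> U"
  then show "\<exists>f'. (f has_derivative f') (at x) \<and> (\<forall>c v. f' (c *s v) = c * f' v)"
    using assms by (intro exI[of _ "\<lambda>v. \<Sum>i\<in>UNIV. v $ i * D i x"]) (auto simp: sum_distrib_left mult_ac)
qed

lemma pd_eqI:
  assumes "(f has_derivative (\<lambda>v. \<Sum>i\<in>UNIV. v $ i * D i)) (at x)"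
  shows "pd i f x = D i"
proof -
  have "(\<lambda>v. \<Sum>i\<in>UNIV. v $ i * D i) = (\<lambda>v. \<Sum>i\<in>UNIV. v $ i * pd i f x)"
    using assms by (rule complex_derivative_eq) (auto simp: sum_distrib_left mult_ac)
  from fun_cong[OF this, of "axis i 1"] show ?thesis
    by (simp add: axis_def if_distrib[of "\<lambda>u. u * _"] cong: if_cong)
qed

lemma holo_on_continuous: "holo_on U f \<Longrightarrow> continuous_on U f"
  unfolding holo_on_def
  by (meson continuous_at_imp_continuous_on has_derivative_continuous)

lemma has_derivative_vecI:
  fixes \<phi> :: "'a::real_normed_vector \<Rightarrow> complex ^ 'n::finite"
  assumes "\<And>i. ((\<lambda>x. \<phi> x $ i) has_derivative (\<lambda>v. \<phi>' v $ i)) F"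
  shows "(\<phi> has_derivative \<phi>') F"
proof -
  have "((\<lambda>x. \<Sum>i\<in>UNIV. axis i (\<phi> x $ i)) has_derivative (\<lambda>v. \<Sum>i\<in>UNIV. axis i (\<phi>' v $ i))) F"
    by (intro has_derivative_sum bounded_linear.has_derivative[OF bounded_linear_axis] assms)
  moreover have "(\<Sum>i\<in>UNIV. axis i (x $ i)) = x" for x :: "complex ^ 'n"
    by (simp add: vec_eq_iff axis_def if_distrib cong: if_cong)
  ultimately show ?thesis by simp
qed

lemma holo_on_compose:
  fixes \<phi> :: "complex ^ 'm::finite \<Rightarrow> complex ^ 'n::finite"
  assumes f: "holo_on U f" and \<phi>: "\<And>i. holo_on V (\<lambda>x. \<phi> x $ i)" and "\<And>x. x \<in> V \<Longrightarrow> \<phi> x \<in> U"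
  shows "holo_on V (\<lambda>x. f (\<phi> x))"
proof (rule holo_onI)
  fix x assume x: "x \<in> V"
  have "(\<phi> has_derivative (\<lambda>v. \<chi> i. \<Sum>j\<in>UNIV. v $ j * pd j (\<lambda>x. \<phi> x $ i) x)) (at x)"
    by (rule has_derivative_vecI) (use holo_on_has_derivative[OF \<phi> x] in simp)
  from has_derivative_compose[OF this holo_on_has_derivative[OF f assms(3)[OF x]]]
  show "((\<lambda>x. f (\<phi> x)) has_derivative
    (\<lambda>v. \<Sum>j\<in>UNIV. v $ j * (\<Sum>i\<in>UNIV. pd j (\<lambda>x. \<phi> x $ i) x * pd i f (\<phi> x)))) (at x)"
    apply (rule has_derivative_eq_rhs)
    apply (rule ext)
    apply (simp add: sum_distrib_left sum_distrib_right mult_ac)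
    apply (rule sum.swap)
    done
qed

lemma holo_on_curve:
  fixes \<gamma> :: "complex \<Rightarrow> complex ^ 'n::finite"
  assumes f: "holo_on U f" and \<gamma>: "\<And>i. (\<lambda>t. \<gamma> t $ i) holomorphic_on T" "open T"
    and "\<And>t. t \<in> T \<Longrightarrow> \<gamma> t \<in> U"
  shows "(\<lambda>t. f (\<gamma> t)) holomorphic_on T"
proof (rule holomorphic_onI)
  fix t assume t: "t \<in> T"
  have "(\<gamma> has_derivative (\<lambda>v. \<chi> i. deriv (\<lambda>t. \<gamma> t $ i) t * v)) (at t)"
    apply (rule has_derivative_vecI)
    using holomorphic_derivI[OF \<gamma>(1) \<gamma>(2) t] by (simp add: has_field_derivative_def)
  from has_derivative_compose[OF this holo_on_has_derivative[OF f assms(4)[OF t]]]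
  have "((\<lambda>t. f (\<gamma> t)) has_field_derivative (\<Sum>i\<in>UNIV. deriv (\<lambda>t. \<gamma> t $ i) t * pd i f (\<gamma> t))) (at t)"
    unfolding has_field_derivative_def
    by (rule has_derivative_eq_rhs) (auto simp: sum_distrib_left sum_distrib_right mult_ac)
  then show "(\<lambda>t. f (\<gamma> t)) field_differentiable at t within T"
    by (meson field_differentiable_def has_field_derivative_at_within)
qed

lemma holo_on_holomorphic_compose:
  assumes g: "g holomorphic_on T" "open T" and h: "holo_on U h" "\<And>x. x \<in> U \<Longrightarrow> h x \<in> T"
  shows "holo_on U (\<lambda>x. g (h x))"
proof (rule holo_onI)
  fix x assume x: "x \<in> U"
  have "(g has_derivative (\<lambda>v. deriv g (h x) * v)) (at (h x))"
    using holomorphic_derivI[OF g h(2)[OF x]] by (simp add: has_field_derivative_def)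
  from has_derivative_compose[OF holo_on_has_derivative[OF h(1) x] this]
  show "((\<lambda>x. g (h x)) has_derivative (\<lambda>v. \<Sum>i\<in>UNIV. v $ i * (deriv g (h x) * pd i h x))) (at x)"
    by (rule has_derivative_eq_rhs) (auto simp: sum_distrib_left mult_ac)
qed

lemma holo_on_nth: "holo_on U (\<lambda>x. x $ i)"
  unfolding holo_on_def
  by (intro ballI exI[of _ "\<lambda>v. v $ i"]) (auto intro!: bounded_linear_imp_has_derivative bounded_linear_vec_nth)

lemma holo_on_const: "holo_on U (\<lambda>x. c)"
  unfolding holo_on_def by (intro ballI exI[of _ "\<lambda>v. 0"]) auto

lemma holo_on_add: "holo_on U f \<Longrightarrow> holo_on U g \<Longrightarrow> holo_on U (\<lambda>x. f x + g x)"
proof (rule holo_onI)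
  fix x assume *: "holo_on U f" "holo_on U g" and x: "x \<in> U"
  show "((\<lambda>x. f x + g x) has_derivative (\<lambda>v. \<Sum>i\<in>UNIV. v $ i * (pd i f x + pd i g x))) (at x)"
    using has_derivative_add[OF *[THEN holo_on_has_derivative, OF x]]
    by (rule has_derivative_eq_rhs) (auto simp: sum.distrib algebra_simps)
qed

lemma holo_on_mult:
  assumes "holo_on U f" "holo_on U g" shows "holo_on U (\<lambda>x. f x * g x)"
proof (rule holo_onI)
  fix x assume x: "x \<in> U"
  show "((\<lambda>x. f x * g x) has_derivative (\<lambda>v. \<Sum>i\<in>UNIV. v $ i * (f x * pd i g x + pd i f x * g x))) (at x)"
    using has_derivative_mult[OF holo_on_has_derivative[OF assms(1) x] holo_on_has_derivative[OF assms(2) x]]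
    by (rule has_derivative_eq_rhs) (auto simp: sum_distrib_left sum_distrib_right sum.distrib algebra_simps)
qed

lemma holo_on_uminus: "holo_on U f \<Longrightarrow> holo_on U (\<lambda>x. - f x)"
  using holo_on_mult[OF holo_on_const[of U "-1"], of f] by simp

lemma holo_on_diff: "holo_on U f \<Longrightarrow> holo_on U g \<Longrightarrow> holo_on U (\<lambda>x. f x - g x)"
  using holo_on_add[OF _ holo_on_uminus, of U f g] by simp

lemma holo_on_power: "holo_on U f \<Longrightarrow> holo_on U (\<lambda>x. f x ^ n)"
  by (induction n) (auto intro: holo_on_const holo_on_mult)

lemma holo_on_sum: "(\<And>i. i \<in> I \<Longrightarrow> holo_on U (f i)) \<Longrightarrow> holo_on U (\<lambda>x. \<Sum>i\<in>I. f i x)"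
  by (induction I rule: infinite_finite_induct) (auto intro: holo_on_const holo_on_add)

lemma holo_on_divide:
  assumes "holo_on U f" "holo_on U g" "\<And>x. x \<in> U \<Longrightarrow> g x \<noteq> 0" shows "holo_on U (\<lambda>x. f x / g x)"
proof -
  have "holo_on U (\<lambda>x. inverse (g x))"
    by (rule holo_on_holomorphic_compose[of inverse "-{0}"]) (use assms in \<open>auto intro!: holomorphic_intros\<close>)
  from holo_on_mult[OF assms(1) this] show ?thesis by (simp add: divide_inverse)
qed

named_theorems holo_intros
lemmas [holo_intros] = holo_on_nth holo_on_const holo_on_add holo_on_mult holo_on_uminus holo_on_diff
  holo_on_power holo_on_sum holo_on_divide

lemma holo_on_cong:
  assumes "open U" "\<And>x. x \<in> U \<Longrightarrow> f x = g x" "holo_on U f"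
  shows "holo_on U g"
  unfolding holo_on_def
proof
  fix x assume x: "x \<in> U"
  then obtain f' where f': "(f has_derivative f') (at x)" "\<forall>c v. f' (c *s v) = c * f' v"
    using assms(3) unfolding holo_on_def by blast
  have "(g has_derivative f') (at x)"
    using f'(1) by (rule has_derivative_transform_within_open[OF _ assms(1) x]) (use assms(2) in auto)
  then show "\<exists>f'. (g has_derivative f') (at x) \<and> (\<forall>c v. f' (c *s v) = c * f' v)" using f'(2) by blast
qed

lemma holo_on_local:
  assumes "\<And>x. x \<in> U \<Longrightarrow> \<exists>V. x \<in> V \<and> holo_on V f" shows "holo_on U f"
  using assms unfolding holo_on_def by blast

lemma continuous_on_axis_compose [continuous_intros]:
  "continuous_on S g \<Longrightarrow> continuous_on S (\<lambda>x. axis i (g x) :: complex ^ 'n::finite)"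
  by (rule bounded_linear.continuous_on[OF bounded_linear_axis])


section \<open>Partial derivatives as circle means, and integrals with a parameter\<close>

lemma norm_axis_complex: "norm (axis i t :: complex ^ 'n::finite) = norm t"
  by (simp add: norm_vec_def L2_set_def axis_def if_distrib[where f="\<lambda>u. (norm u)\<^sup>2"] cong: if_cong)

lemma holomorphic_on_axis: "(\<lambda>t. axis i t $ j) holomorphic_on T"
  by (cases "i = j") (auto simp: axis_def)

text \<open>Cauchy's formula along one axis. \<open>holo_on\<close> asks only for differentiability
  at each point; holomorphy, joint continuity and symmetry of the partial derivatives are all drawn
  from this integral over values of \<open>f\<close>.\<close>

lemma pd_has_integral:
  assumes f: "holo_on U f" "open U" and r: "r > 0" and sub: "\<And>t. norm t \<le> r \<Longrightarrow> x + axis i t \<in> U"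
  shows "((\<lambda>s. f (x + axis i (of_real r * cis (2 * pi * s))) / (of_real r * cis (2 * pi * s))) has_integral
          pd i f x) {0..1}"
proof -
  define T where "T = {t. x + axis i t \<in> U}"
  have "open T"
  proof -
    have "open ((\<lambda>t. x + axis i t) -` U)"
      by (intro open_vimage f continuous_intros)
    then show ?thesis by (simp add: T_def vimage_def)
  qed
  have "cball 0 r \<subseteq> T" using sub by (auto simp: T_def)
  have "(\<lambda>t. f (x + axis i t)) holomorphic_on T"
    by (rule holo_on_curve[OF f(1)]) (use \<open>open T\<close> in \<open>auto simp: T_def intro!: holomorphic_intros holomorphic_on_axis\<close>)
  from circle_mean_deriv[OF r this \<open>open T\<close> \<open>cball 0 r \<subseteq> T\<close>, of 1] show ?thesis
    by (simp add: pd_def)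
qed

lemma continuous_on_local_product:
  fixes g :: "'a::metric_space \<times> 'b::metric_space \<Rightarrow> 'c::topological_space"
  assumes "\<And>w. w \<in> W \<Longrightarrow> \<exists>B. open B \<and> w \<in> B \<and> B \<subseteq> W \<and> continuous_on (B \<times> I) g"
  shows "continuous_on (W \<times> I) g"
  unfolding continuous_on_eq_continuous_within
proof
  fix p assume p: "p \<in> W \<times> I"
  then obtain B where B: "open B" "fst p \<in> B" "B \<subseteq> W" "continuous_on (B \<times> I) g"
    using assms[of "fst p"] by auto
  have "at p within W \<times> I = at p within B \<times> I"
    by (rule at_within_nhd[of p "B \<times> UNIV"]) (use B p in \<open>auto simp: open_Times mem_Times_iff\<close>)
  then show "continuous (at p within W \<times> I) g"
    using B(2) p bspec[OF B(4)[unfolded continuous_on_eq_continuous_within], of p]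
    by (simp add: mem_Times_iff)
qed

text \<open>As a circle mean, the partial derivative is itself an integral with a jointly continuous
  integrand. The joint continuity is what the Leibniz rule asks for in the next lemma.\<close>

lemma continuous_on_pd_param:
  fixes h :: "complex ^ 'n::finite \<Rightarrow> real \<Rightarrow> complex"
  assumes W: "open W" and cont: "continuous_on (W \<times> {0..1}) (\<lambda>(w, s). h w s)"
    and holo: "\<And>s. s \<in> {0..1} \<Longrightarrow> holo_on W (\<lambda>w. h w s)"
  shows "continuous_on (W \<times> {0..1}) (\<lambda>(w, s). pd i (\<lambda>w. h w s) w)"
proof (rule continuous_on_local_product)
  fix w0 assume "w0 \<in> W"
  then obtain e where e: "e > 0" "ball w0 e \<subseteq> W" using W open_contains_ball by blast
  define r where "r = e / 2"
  have r: "r > 0" using e by (simp add: r_def)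
  have inW: "w + axis i t \<in> W" if "w \<in> ball w0 r" "norm t \<le> r" for w t
  proof -
    have "dist w0 (w + axis i t) \<le> dist w0 w + norm (axis i t)"
      by norm
    then have "dist w0 (w + axis i t) < e"
      using that by (simp add: norm_axis_complex r_def)
    then show ?thesis using e by auto
  qed
  have "continuous_on ((ball w0 r \<times> {0..1}) \<times> cbox 0 1)
     (\<lambda>(p, s). h (fst p + axis i (of_real r * cis (2 * pi * s))) (snd p) / (of_real r * cis (2 * pi * s)))"
    unfolding split_beta
  proof (intro continuous_on_divide)
    have "continuous_on ((ball w0 r \<times> {0..1}) \<times> cbox 0 (1::real))
      (\<lambda>x. (\<lambda>(w, s). h w s) (fst (fst x) + axis i (of_real r * cis (2 * pi * snd x)), snd (fst x)))"
      by (rule continuous_on_compose2[OF cont]) (auto intro!: continuous_intros inW simp: norm_mult r less_imp_le)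
    then show "continuous_on ((ball w0 r \<times> {0..1}) \<times> cbox 0 1)
      (\<lambda>x. h (fst (fst x) + axis i (of_real r * cis (2 * pi * snd x))) (snd (fst x)))" by simp
  qed (use r in \<open>auto intro!: continuous_intros\<close>)
  then have "continuous_on (ball w0 r \<times> {0..1}) (\<lambda>p. integral (cbox 0 1)
    (\<lambda>s. h (fst p + axis i (of_real r * cis (2 * pi * s))) (snd p) / (of_real r * cis (2 * pi * s))))"
    by (rule integral_continuous_on_param)
  moreover have "integral (cbox 0 1)
    (\<lambda>s. h (fst p + axis i (of_real r * cis (2 * pi * s))) (snd p) / (of_real r * cis (2 * pi * s))) =
    pd i (\<lambda>w. h w (snd p)) (fst p)" if "p \<in> ball w0 r \<times> {0..1}" for p
    unfolding box_real
    by (rule integral_unique, rule pd_has_integral[OF _ W r])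
      (use that in \<open>simp_all add: holo inW mem_Times_iff\<close>)
  ultimately have "continuous_on (ball w0 r \<times> {0..1}) (\<lambda>p. pd i (\<lambda>w. h w (snd p)) (fst p))"
    by (rule continuous_on_eq)
  then show "\<exists>B. open B \<and> w0 \<in> B \<and> B \<subseteq> W \<and> continuous_on (B \<times> {0..1}) (\<lambda>(w, s). pd i (\<lambda>w. h w s) w)"
    using r e by (intro exI[of _ "ball w0 r"]) (auto simp: split_beta r_def)
qed

lemma param_integral_has_derivative:
  fixes h :: "complex ^ 'n::finite \<Rightarrow> real \<Rightarrow> complex"
  assumes W: "open W" and cont: "continuous_on (W \<times> {0..1}) (\<lambda>(w, s). h w s)"
    and holo: "\<And>s. s \<in> {0..1} \<Longrightarrow> holo_on W (\<lambda>w. h w s)" and w0: "w0 \<in> W"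
  shows "((\<lambda>w. integral {0..1} (h w)) has_derivative
    (\<lambda>v. \<Sum>i\<in>UNIV. v $ i * integral {0..1} (\<lambda>s. pd i (\<lambda>w. h w s) w0))) (at w0)"
proof -
  obtain e where e: "e > 0" "ball w0 e \<subseteq> W" using W w0 open_contains_ball by blast
  define B where "B = ball w0 e"
  have B: "open B" "convex B" "B \<subseteq> W" "w0 \<in> B" using e by (auto simp: B_def)
  \<comment> \<open>The Leibniz rule wants the derivative as a continuous family of bounded linear
    maps; its continuity is checked one vector at a time.\<close>
  define D where "D w s = Blinfun (\<lambda>v. \<Sum>i\<in>UNIV. v $ i * pd i (\<lambda>w. h w s) w)" for w s
  have D: "blinfun_apply (D w s) = (\<lambda>v. \<Sum>i\<in>UNIV. v $ i * pd i (\<lambda>w. h w s) w)" for w s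
    unfolding D_def
    by (rule bounded_linear_Blinfun_apply)
      (intro bounded_linear_sum bounded_linear_mult_const bounded_linear_vec_nth)
  have cD: "continuous_on (W \<times> {0..1}) (\<lambda>(w, s). pd i (\<lambda>w. h w s) w)" for i
    by (rule continuous_on_pd_param[OF W cont holo])
  have contD: "continuous_on (B \<times> cbox 0 1) (\<lambda>(w, s). D w s)"
  proof (rule continuous_on_blinfun_componentwise)
    fix v :: "complex ^ 'n"
    have "continuous_on (B \<times> cbox 0 1) (\<lambda>p. \<Sum>i\<in>UNIV. v $ i * (\<lambda>(w, s). pd i (\<lambda>w. h w s) w) p)"
      by (intro continuous_intros continuous_on_subset[OF cD]) (use B in auto)
    then show "continuous_on (B \<times> cbox 0 1) (\<lambda>x. blinfun_apply (case x of (w, s) \<Rightarrow> D w s) v)"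
      by (simp add: split_beta D)
  qed
  have int_h: "h w integrable_on cbox 0 1" if "w \<in> B" for w
  proof (rule integrable_continuous)
    have "continuous_on (cbox 0 1) (\<lambda>s. (\<lambda>(w, s). h w s) (w, s))"
      by (rule continuous_on_compose2[OF cont]) (use that B in \<open>auto intro!: continuous_intros\<close>)
    then show "continuous_on (cbox 0 1) (h w)" by simp
  qed
  have int_D: "D w0 integrable_on cbox 0 1"
  proof (rule integrable_continuous)
    have "continuous_on (cbox 0 1) (\<lambda>s. (\<lambda>(w, s). D w s) (w0, s))"
      by (rule continuous_on_compose2[OF contD]) (use B in \<open>auto intro!: continuous_intros\<close>)
    then show "continuous_on (cbox 0 1) (D w0)" by simp
  qed
  have int_pd: "(\<lambda>s. pd i (\<lambda>w. h w s) w0) integrable_on {0..1}" for i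
  proof (rule integrable_continuous_real)
    have "continuous_on {0..1} (\<lambda>s. (\<lambda>(w, s). pd i (\<lambda>w. h w s) w) (w0, s))"
      by (rule continuous_on_compose2[OF cD[of i]]) (use w0 in \<open>auto intro!: continuous_intros\<close>)
    then show "continuous_on {0..1} (\<lambda>s. pd i (\<lambda>w. h w s) w0)" by simp
  qed
  have "((\<lambda>w. integral (cbox 0 1) (h w)) has_derivative integral (cbox 0 1) (D w0)) (at w0 within B)"
  proof (rule leibniz_rule[OF _ int_h contD B(4) B(2)])
    fix w s assume "w \<in> B" "s \<in> cbox (0::real) 1"
    then show "((\<lambda>w. h w s) has_derivative blinfun_apply (D w s)) (at w within B)"
      unfolding D using B(3)
      by - (rule has_derivative_at_withinI, rule holo_on_has_derivative[OF holo], auto)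
  qed
  then have "((\<lambda>w. integral {0..1} (h w)) has_derivative integral (cbox 0 1) (D w0)) (at w0)"
    unfolding at_within_open[OF B(4,1)] box_real .
  moreover have "blinfun_apply (integral (cbox 0 1) (D w0)) =
    (\<lambda>v. \<Sum>i\<in>UNIV. v $ i * integral {0..1} (\<lambda>s. pd i (\<lambda>w. h w s) w0))"
  proof
    fix v
    have "blinfun_apply (integral (cbox 0 1) (D w0)) v = integral (cbox 0 1) (\<lambda>s. blinfun_apply (D w0 s) v)"
      by (rule blinfun_apply_integral[OF int_D])
    moreover have "((\<lambda>s. \<Sum>i\<in>UNIV. v $ i * pd i (\<lambda>w. h w s) w0) has_integral
       (\<Sum>i\<in>UNIV. v $ i * integral {0..1} (\<lambda>s. pd i (\<lambda>w. h w s) w0))) {0..1}"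
      by (intro has_integral_sum has_integral_mult_right integrable_integral int_pd) auto
    ultimately show "blinfun_apply (integral (cbox 0 1) (D w0)) v =
       (\<Sum>i\<in>UNIV. v $ i * integral {0..1} (\<lambda>s. pd i (\<lambda>w. h w s) w0))"
      unfolding D box_real by (simp only: integral_unique)
  qed
  ultimately show ?thesis by (rule has_derivative_eq_rhs)
qed

lemmas holo_on_param_integral = holo_onI[OF param_integral_has_derivative]

lemmas pd_param_integral = pd_eqI[OF param_integral_has_derivative]

lemma pd_cong:
  assumes "open W" "x \<in> W" "\<And>y. y \<in> W \<Longrightarrow> f y = g y"
  shows "pd i f x = pd i g x"
  unfolding pd_def
proof (rule deriv_cong_ev)
  have "((\<lambda>t. x + axis i t) \<longlongrightarrow> x + axis i 0) (nhds 0)"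
    by (rule tendsto_intros bounded_linear.tendsto[OF bounded_linear_axis] filterlim_ident)+
  then have "((\<lambda>t. x + axis i t) \<longlongrightarrow> x) (nhds 0)" by (simp add: axis_zero)
  from topological_tendstoD[OF this assms(1,2)] show "\<forall>\<^sub>F t in nhds 0. f (x + axis i t) = g (x + axis i t)"
    by eventually_elim (rule assms(3))
qed auto

lemma pd_shift: "pd i (\<lambda>w. f (w + c)) x = pd i f (x + c)"
  by (simp add: pd_def add_ac)

lemma pd_divide_const:
  assumes "holo_on U f" "x \<in> U" shows "pd i (\<lambda>w. f w / c) x = pd i f x / c"
proof (rule pd_eqI)
  show "((\<lambda>w. f w / c) has_derivative (\<lambda>v. \<Sum>i\<in>UNIV. v $ i * (pd i f x / c))) (at x)"
    using bounded_linear.has_derivative[OF bounded_linear_divide holo_on_has_derivative[OF assms]]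
    by (rule has_derivative_eq_rhs) (simp add: sum_divide_distrib)
qed

lemma
  assumes f: "holo_on U f" and U: "open U"
  shows holo_on_pd: "holo_on U (pd i f)"
    and pd_commute: "\<And>x. x \<in> U \<Longrightarrow> pd j (pd i f) x = pd i (pd j f) x"
proof -
  \<comment> \<open>The commutation is conditional on the holomorphy of \<open>pd j f\<close>, so
    that one local argument serves both claims: its first half, for all indices, discharges the
    condition in the second.\<close>
  have main: "\<exists>B. open B \<and> x0 \<in> B \<and> holo_on B (pd i f) \<and>
      (holo_on U (pd j f) \<longrightarrow> pd j (pd i f) x0 = pd i (pd j f) x0)"
    if x0: "x0 \<in> U" for x0 i j
  proof -
    obtain e where e: "e > 0" "ball x0 e \<subseteq> U" using U x0 open_contains_ball by blast
    define r where "r = e / 2"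
    have r: "r > 0" using e by (simp add: r_def)
    define B where "B = ball x0 r"
    have inU: "w + axis i t \<in> U" if "w \<in> B" "norm t \<le> r" for w t
    proof -
      have "dist x0 (w + axis i t) \<le> dist x0 w + norm (axis i t)" by norm
      then have "dist x0 (w + axis i t) < e"
        using that by (simp add: norm_axis_complex r_def B_def)
      then show ?thesis using e by auto
    qed
    have B: "open B" "x0 \<in> B" using r by (auto simp: B_def)
    define c where "c s = of_real r * cis (2 * pi * s)" for s
    have c: "norm (c s) = r" "c s \<noteq> 0" for s using r by (auto simp: c_def norm_mult)
    have contc: "continuous_on S c" for S unfolding c_def by (intro continuous_intros)
    define h where "h = (\<lambda>w s. f (w + axis i (c s)) / c s)"
    have pdh: "pd i f w = integral {0..1} (h w)" if "w \<in> B" for w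
      using integral_unique[OF pd_has_integral[OF f U r inU[OF that]]] by (simp add: h_def c_def)
    have holo: "holo_on B (\<lambda>w. h w s)" for s
      unfolding h_def
      by (intro holo_intros holo_on_compose[OF f]) (auto simp: inU c intro!: holo_intros)
    have cont: "continuous_on (B \<times> {0..1}) (\<lambda>(w, s). h w s)"
      unfolding h_def split_beta
      by (intro continuous_on_divide continuous_on_compose2[OF holo_on_continuous[OF f]] continuous_intros
            continuous_on_compose2[OF contc[of UNIV]]) (auto simp: inU c)
    have "holo_on B (\<lambda>w. integral {0..1} (h w))"
      by (rule holo_on_param_integral[OF B(1) cont holo])
    then have "holo_on B (pd i f)" by (rule holo_on_cong[OF B(1), rotated]) (simp add: pdh)
    moreover have "pd j (pd i f) x0 = pd i (pd j f) x0" if "holo_on U (pd j f)"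
    proof -
      have "pd j (pd i f) x0 = pd j (\<lambda>w. integral {0..1} (h w)) x0"
        by (rule pd_cong[OF B pdh])
      also have "\<dots> = integral {0..1} (\<lambda>s. pd j (\<lambda>w. h w s) x0)"
        by (rule pd_param_integral[OF B(1) cont holo B(2)])
      also have "\<dots> = integral {0..1} (\<lambda>s. pd j f (x0 + axis i (c s)) / c s)"
        unfolding h_def
        by (intro integral_cong)
          (simp add: pd_shift pd_divide_const[OF holo_on_compose[OF f, of B] B(2)] inU c holo_intros)
      also have "\<dots> = pd i (pd j f) x0"
        using integral_unique[OF pd_has_integral[OF that U r inU[OF B(2)]]] by (simp add: c_def)
      finally show ?thesis .
    qed
    ultimately show ?thesis using B by blast
  qed
  show holo: "holo_on U (pd i f)" for i
    by (rule holo_on_local) (use main in blast)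
  show "pd j (pd i f) x = pd i (pd j f) x" if "x \<in> U" for x
    using main[OF that] holo by blast
qed

section \<open>Differential operators\<close>


lemma pd_add:
  assumes "holo_on U f" "holo_on U g" "x \<in> U"
  shows "pd i (\<lambda>x. f x + g x) x = pd i f x + pd i g x"
proof (rule pd_eqI)
  show "((\<lambda>x. f x + g x) has_derivative (\<lambda>v. \<Sum>i\<in>UNIV. v $ i * (pd i f x + pd i g x))) (at x)"
    using has_derivative_add[OF assms(1,2)[THEN holo_on_has_derivative, OF assms(3)]]
    by (rule has_derivative_eq_rhs) (auto simp: sum.distrib algebra_simps)
qed

lemma pd_mult:
  assumes "holo_on U f" "holo_on U g" "x \<in> U"
  shows "pd i (\<lambda>x. f x * g x) x = pd i f x * g x + f x * pd i g x"
proof (rule pd_eqI)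
  show "((\<lambda>x. f x * g x) has_derivative (\<lambda>v. \<Sum>i\<in>UNIV. v $ i * (pd i f x * g x + f x * pd i g x))) (at x)"
    using has_derivative_mult[OF assms(1,2)[THEN holo_on_has_derivative, OF assms(3)]]
    by (rule has_derivative_eq_rhs) (auto simp: sum_distrib_left sum_distrib_right sum.distrib algebra_simps)
qed

lemma pd_const: "pd i (\<lambda>x. c) x = 0"
  by (simp add: pd_def)

lemma pd_cmult:
  assumes "holo_on U f" "x \<in> U"
  shows "pd i (\<lambda>x. c * f x) x = c * pd i f x"
  using pd_mult[OF holo_on_const assms] by (simp add: pd_const)

lemma pd_diff:
  assumes "holo_on U f" "holo_on U g" "x \<in> U"
  shows "pd i (\<lambda>x. f x - g x) x = pd i f x - pd i g x"
  using pd_add[OF assms(1) _ assms(3), of "\<lambda>x. - 1 * g x"] pd_cmult[OF assms(2,3), of i "-1"]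
  by (simp add: assms holo_on_uminus)

lemma pd_sum:
  assumes "\<And>j. j \<in> I \<Longrightarrow> holo_on U (f j)" "x \<in> U"
  shows "pd i (\<lambda>x. \<Sum>j\<in>I. f j x) x = (\<Sum>j\<in>I. pd i (f j) x)"
  using assms(1)
proof (induction I rule: infinite_finite_induct)
  case (insert j I)
  then show ?case
    by (simp add: pd_add[OF _ _ assms(2), where f="f j" and g="\<lambda>x. \<Sum>j\<in>I. f j x"] holo_on_sum)
qed (auto simp: pd_const)

lemma pd_nth: "pd i (\<lambda>x. x $ j) x = (if i = j then 1 else 0)"
proof (rule pd_eqI)
  show "((\<lambda>x. x $ j) has_derivative (\<lambda>v. \<Sum>i\<in>UNIV. v $ i * (if i = j then 1 else 0))) (at x)"
    by (rule has_derivative_eq_rhs[OF bounded_linear_imp_has_derivative[OF bounded_linear_vec_nth]])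
      (auto simp: if_distrib cong: if_cong)
qed

subsection \<open>Iterated partial derivatives\<close>

lemma holo_on_pd_iterate: "holo_on U f \<Longrightarrow> open U \<Longrightarrow> holo_on U ((pd i ^^ n) f)"
  by (induction n) (auto intro: holo_on_pd)

lemma pd_iterate_cong:
  assumes "open U" "\<And>x. x \<in> U \<Longrightarrow> f x = g x" "x \<in> U"
  shows "(pd i ^^ n) f x = (pd i ^^ n) g x"
  using assms(3)
proof (induction n arbitrary: x)
  case (Suc n)
  show ?case unfolding funpow.simps comp_apply by (rule pd_cong[OF assms(1) Suc.prems Suc.IH])
qed (use assms in auto)

lemma pd_iterate_commute:
  assumes "holo_on U f" "open U" "x \<in> U"
  shows "pd j ((pd i ^^ n) f) x = (pd i ^^ n) (pd j f) x"
  using assms(3)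
proof (induction n arbitrary: x)
  case (Suc n)
  have "pd j ((pd i ^^ Suc n) f) x = pd i (pd j ((pd i ^^ n) f)) x"
    by (simp add: pd_commute[OF holo_on_pd_iterate[OF assms(1,2)] assms(2) Suc.prems])
  also have "\<dots> = pd i ((pd i ^^ n) (pd j f)) x"
    by (rule pd_cong[OF assms(2) Suc.prems Suc.IH])
  finally show ?case by simp
qed auto

lemma holo_on_pd_foldr:
  "holo_on U f \<Longrightarrow> open U \<Longrightarrow> holo_on U (foldr (\<lambda>i. pd i ^^ \<alpha> i) xs f)"
  by (induction xs) (auto intro: holo_on_pd_iterate)

lemma pd_foldr_cong:
  assumes "open U" "\<And>x. x \<in> U \<Longrightarrow> f x = g x" "x \<in> U"
  shows "foldr (\<lambda>i. pd i ^^ \<alpha> i) xs f x = foldr (\<lambda>i. pd i ^^ \<alpha> i) xs g x"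
  using assms(3)
proof (induction xs arbitrary: x)
  case (Cons i xs)
  show ?case unfolding foldr.simps comp_apply by (rule pd_iterate_cong[OF assms(1) Cons.IH Cons.prems])
qed (use assms in auto)

text \<open>\<open>mpd\<close> applies the derivatives in a fixed order, so raising one exponent
  inserts a derivative in the middle of the fold; commutation moves it to the front. Distinctness
  ensures that it is inserted only once.\<close>

lemma pd_foldr_Suc:
  assumes f: "holo_on U f" "open U"
  shows "x \<in> U \<Longrightarrow> distinct xs \<Longrightarrow>
    foldr (\<lambda>j. pd j ^^ (\<alpha>(i := Suc (\<alpha> i))) j) xs f x =
    (if i \<in> set xs then pd i (foldr (\<lambda>j. pd j ^^ \<alpha> j) xs f) x else foldr (\<lambda>j. pd j ^^ \<alpha> j) xs f x)"
proof (induction xs arbitrary: x)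
  case (Cons y xs)
  let ?F = "foldr (\<lambda>j. pd j ^^ \<alpha> j) xs f" and ?G = "foldr (\<lambda>j. pd j ^^ (\<alpha>(i := Suc (\<alpha> i))) j) xs f"
  have hF: "holo_on U ?F" by (rule holo_on_pd_foldr[OF f])
  show ?case
  proof (cases "y = i")
    case True
    then have G: "?G = ?F" using Cons.prems by (auto intro!: foldr_cong)
    show ?thesis by (simp only: G foldr.simps o_def) (simp add: True)
  next
    case False
    have "(pd y ^^ \<alpha> y) ?G x = (pd y ^^ \<alpha> y) (if i \<in> set xs then pd i ?F else ?F) x"
      by (rule pd_iterate_cong[OF f(2) _ Cons.prems(1)]) (use Cons in auto)
    then show ?thesis
      using False pd_iterate_commute[OF hF f(2) Cons.prems(1)] by (auto simp del: fun_upd_apply) (auto simp: fun_upd_def)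
  qed
qed auto

lemma holo_on_mpd: "holo_on U f \<Longrightarrow> open U \<Longrightarrow> holo_on U (mpd \<alpha> f)"
  unfolding mpd_def by (rule holo_on_pd_foldr)

lemma mpd_cong:
  assumes "open U" "x \<in> U" "\<And>x. x \<in> U \<Longrightarrow> f x = g x"
  shows "mpd \<alpha> f x = mpd \<alpha> g x"
  unfolding mpd_def by (rule pd_foldr_cong[OF assms(1,3,2)])

lemma mpd_Suc:
  assumes "holo_on U f" "open U" "x \<in> U"
  shows "mpd (\<alpha>(i := Suc (\<alpha> i))) f x = pd i (mpd \<alpha> f) x"
  unfolding mpd_def using pd_foldr_Suc[OF assms, of "sorted_list_of_set UNIV" \<alpha> i] by simp

lemma mpd_zero: "mpd (\<lambda>_. 0) f = f"
proof -
  have "foldr (\<lambda>i. pd i ^^ 0) xs f = f" for xs :: "'a list" by (induction xs) auto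
  then show ?thesis by (simp add: mpd_def)
qed

lemma mi_deg_Suc: "mi_deg (\<alpha>(i := Suc (\<alpha> i))) = Suc (mi_deg \<alpha>)"
  by (simp add: mi_deg_def sum.remove[of UNIV i])

lemma mi_deg_zero: "mi_deg \<alpha> = 0 \<longleftrightarrow> \<alpha> = (\<lambda>_. 0)"
  by (auto simp: mi_deg_def)

text \<open>Any nonzero multi-index is a successor in some coordinate, so facts about
  \<open>mpd\<close> reduce to a single further \<open>pd\<close>.\<close>

lemma multi_index_induct [case_names zero Suc]:
  fixes \<alpha> :: "'k::finite \<Rightarrow> nat"
  assumes "P (\<lambda>_. 0)" "\<And>\<alpha> i. P \<alpha> \<Longrightarrow> P (\<alpha>(i := Suc (\<alpha> i)))"
  shows "P \<alpha>"
proof (induction "mi_deg \<alpha>" arbitrary: \<alpha>)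
  case 0 then show ?case using assms(1) mi_deg_zero[of \<alpha>] by simp
next
  case (Suc n)
  then obtain i where i: "\<alpha> i \<noteq> 0" by (metis mi_deg_zero nat.distinct(1))
  define \<beta> where "\<beta> = \<alpha>(i := \<alpha> i - 1)"
  have \<alpha>: "\<alpha> = \<beta>(i := Suc (\<beta> i))" using i by (auto simp: \<beta>_def)
  then have "mi_deg \<beta> = n" using Suc.hyps(2) mi_deg_Suc[of \<beta> i] by simp
  then show ?case using Suc.hyps(1) assms(2) \<alpha> by metis
qed

lemma mpd_sum:
  assumes "\<And>j. j \<in> I \<Longrightarrow> holo_on U (f j)" "open U"
  shows "x \<in> U \<Longrightarrow> mpd \<alpha> (\<lambda>x. \<Sum>j\<in>I. f j x) x = (\<Sum>j\<in>I. mpd \<alpha> (f j) x)"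
proof (induction \<alpha> arbitrary: x rule: multi_index_induct)
  case zero then show ?case by (simp add: mpd_zero)
next
  case (Suc \<alpha> i)
  have "mpd (\<alpha>(i := Suc (\<alpha> i))) (\<lambda>x. \<Sum>j\<in>I. f j x) x = pd i (mpd \<alpha> (\<lambda>x. \<Sum>j\<in>I. f j x)) x"
    by (intro mpd_Suc[OF _ assms(2) Suc.prems] holo_on_sum assms(1))
  also have "\<dots> = pd i (\<lambda>x. \<Sum>j\<in>I. mpd \<alpha> (f j) x) x"
    by (rule pd_cong[OF assms(2) Suc.prems Suc.IH])
  also have "\<dots> = (\<Sum>j\<in>I. pd i (mpd \<alpha> (f j)) x)"
    by (intro pd_sum[OF _ Suc.prems] holo_on_mpd assms)
  also have "\<dots> = (\<Sum>j\<in>I. mpd (\<alpha>(i := Suc (\<alpha> i))) (f j) x)"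
    by (intro sum.cong refl mpd_Suc[symmetric, OF _ assms(2) Suc.prems] assms(1))
  finally show ?case .
qed

lemma finite_mi_deg: "finite {\<alpha> :: 'k::finite \<Rightarrow> nat. mi_deg \<alpha> \<le> m}"
proof (rule finite_subset)
  show "{\<alpha> :: 'k \<Rightarrow> nat. mi_deg \<alpha> \<le> m} \<subseteq> PiE UNIV (\<lambda>_. {..m})"
  proof
    fix \<alpha> :: "'k \<Rightarrow> nat" assume "\<alpha> \<in> {\<alpha>. mi_deg \<alpha> \<le> m}"
    then have "\<alpha> i \<le> m" for i using member_le_sum[of i UNIV \<alpha>] by (simp add: mi_deg_def)
    then show "\<alpha> \<in> PiE UNIV (\<lambda>_. {..m})" by auto
  qed
qed (auto intro: finite_PiE)

lemma finite_mi_deg_eq: "finite {\<alpha> :: 'k::finite \<Rightarrow> nat. mi_deg \<alpha> = m}"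
  by (rule finite_subset[OF _ finite_mi_deg[of m]]) auto

subsection \<open>Expansions of differential operators\<close>

lemma has_expansionD:
  assumes "has_expansion U m a P" "open V" "V \<subseteq> U" "holo_on V f" "x \<in> V"
  shows "P f x = (\<Sum>\<alpha> | mi_deg \<alpha> \<le> m. a \<alpha> x * mpd \<alpha> f x)"
  using assms unfolding has_expansion_def by blast

lemma has_expansion_holo: "has_expansion U m a P \<Longrightarrow> mi_deg \<alpha> \<le> m \<Longrightarrow> holo_on U (a \<alpha>)"
  unfolding has_expansion_def by blast

lemma has_expansion_subset: "has_expansion U m a P \<Longrightarrow> V \<subseteq> U \<Longrightarrow> has_expansion V m a P"
  unfolding has_expansion_def by (meson holo_on_subset order_trans)

text \<open>An operator is a map on total functions and could depend on values far away; only its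
  expansion forces it to see germs.\<close>

lemma has_expansion_local:
  assumes "has_expansion U m a P" "open V" "V \<subseteq> U" "holo_on V f" "x \<in> V" "\<And>x. x \<in> V \<Longrightarrow> f x = g x"
  shows "P f x = P g x"
proof -
  have "holo_on V g" by (rule holo_on_cong[OF assms(2,6,4)])
  then show ?thesis
    using assms by (simp add: has_expansionD[OF assms(1-3)] mpd_cong[OF assms(2,5,6)])
qed

lemma has_expansion_result_holo:
  assumes "has_expansion U m a P" "open V" "V \<subseteq> U" "holo_on V f"
  shows "holo_on V (P f)"
proof (rule holo_on_cong[OF assms(2)])
  show "holo_on V (\<lambda>x. \<Sum>\<alpha> | mi_deg \<alpha> \<le> m. a \<alpha> x * mpd \<alpha> f x)"
    using assms by (auto intro!: holo_on_sum holo_on_mult holo_on_mpd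
        intro: holo_on_subset[OF has_expansion_holo])
qed (simp add: has_expansionD[OF assms])

lemma has_expansion_cong:
  assumes "has_expansion U m a P"
    and "\<And>V f x. open V \<Longrightarrow> V \<subseteq> U \<Longrightarrow> holo_on V f \<Longrightarrow> x \<in> V \<Longrightarrow> P f x = Q f x"
  shows "has_expansion U m a Q"
  using assms unfolding has_expansion_def by (metis (no_types, lifting))

text \<open>Beyond degree \<open>m\<close> the family \<open>a\<close> is unconstrained, possibly
  not even holomorphic, so the padding has to be an explicit zero.\<close>

lemma has_expansion_raise:
  assumes "has_expansion U m a P" "m \<le> n"
  shows "has_expansion U n (\<lambda>\<alpha>. if mi_deg \<alpha> \<le> m then a \<alpha> else (\<lambda>_. 0)) P"
  unfolding has_expansion_def
proof (intro conjI allI impI ballI)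
  fix V f x assume V: "open V \<and> V \<subseteq> U \<and> holo_on V f" "x \<in> V"
  have "P f x = (\<Sum>\<alpha> | mi_deg \<alpha> \<le> m. a \<alpha> x * mpd \<alpha> f x)"
    using has_expansionD[OF assms(1)] V by blast
  also have "\<dots> = (\<Sum>\<alpha> | mi_deg \<alpha> \<le> n. (if mi_deg \<alpha> \<le> m then a \<alpha> else (\<lambda>_. 0)) x * mpd \<alpha> f x)"
    using assms(2) by (intro sum.mono_neutral_cong_left finite_mi_deg) auto
  finally show "P f x = \<dots>" .
qed (use assms in \<open>auto simp: holo_on_const intro: has_expansion_holo\<close>)

lemma symbol_raise:
  assumes "m < n"
  shows "symbol n (\<lambda>\<alpha>. if mi_deg \<alpha> \<le> m then a \<alpha> else (\<lambda>_. 0)) z = 0"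
  using assms unfolding symbol_def by (intro sum.neutral) auto

lemma has_expansion_add:
  assumes "has_expansion U m a P" "has_expansion U m b Q"
  shows "has_expansion U m (\<lambda>\<alpha> x. a \<alpha> x + b \<alpha> x) (\<lambda>f x. P f x + Q f x)"
  using assms unfolding has_expansion_def by (auto simp: sum.distrib ring_distribs intro: holo_on_add)

lemma symbol_add: "symbol m (\<lambda>\<alpha> x. a \<alpha> x + b \<alpha> x) z = symbol m a z + symbol m b z"
  by (simp add: symbol_def sum.distrib ring_distribs)

lemma has_expansion_mult:
  assumes "has_expansion U m a P" "holo_on U c"
  shows "has_expansion U m (\<lambda>\<alpha> x. c x * a \<alpha> x) (\<lambda>f x. c x * P f x)"
  using assms unfolding has_expansion_def by (auto simp: sum_distrib_left mult_ac intro: holo_on_mult)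

lemma symbol_mult: "symbol m (\<lambda>\<alpha> x. c x * a \<alpha> x) z = c (base_pt z) * symbol m a z"
  by (simp add: symbol_def sum_distrib_left mult_ac)

lemma has_expansion_id: "has_expansion U 0 (\<lambda>\<alpha> x. 1) (\<lambda>f. f)"
  by (simp add: has_expansion_def holo_on_const mi_deg_zero mpd_zero)

lemma symbol_id: "symbol 0 (\<lambda>\<alpha> x. 1) z = 1"
  by (simp add: symbol_def mi_deg_zero)

text \<open>The predicate \<open>R\<close> is left open because the same shift of the summation
  index occurs with \<open>d \<le> n\<close> for the expansion and with \<open>d = n\<close> for the
  symbol.\<close>

lemma bij_betw_multi_index_Suc:
  "bij_betw (\<lambda>\<beta>. \<beta>(i := Suc (\<beta> i))) {\<beta>. R (mi_deg \<beta>)} {\<gamma>. \<gamma> i > 0 \<and> mi_deg \<gamma> \<noteq> 0 \<and> R (mi_deg \<gamma> - 1)}"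
proof (rule bij_betw_byWitness[where f'="\<lambda>\<gamma>. \<gamma>(i := \<gamma> i - 1)"])
  show "(\<lambda>\<gamma>. \<gamma>(i := \<gamma> i - 1)) ` {\<gamma>. \<gamma> i > 0 \<and> mi_deg \<gamma> \<noteq> 0 \<and> R (mi_deg \<gamma> - 1)} \<subseteq> {\<beta>. R (mi_deg \<beta>)}"
  proof safe
    fix \<gamma> :: "'a \<Rightarrow> nat" assume *: "\<gamma> i > 0" "R (mi_deg \<gamma> - 1)"
    define \<beta> where "\<beta> = \<gamma>(i := \<gamma> i - 1)"
    have "\<gamma> = \<beta>(i := Suc (\<beta> i))" using * by (auto simp: \<beta>_def)
    then have "mi_deg \<gamma> = Suc (mi_deg \<beta>)" by (metis mi_deg_Suc)
    then show "R (mi_deg (\<gamma>(i := \<gamma> i - 1)))" using * by (simp add: \<beta>_def)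
  qed
qed (auto simp: mi_deg_Suc)

text \<open>Leibniz rule for a partial derivative after an operator of order \<open>n\<close>: the
  first summand differentiates the coefficient, the second raises the multi-index. The cut-off at
  \<open>n\<close> discards the arbitrary coefficients above it.\<close>

definition pd_coeff ::
  "'k::finite \<Rightarrow> nat \<Rightarrow> (('k \<Rightarrow> nat) \<Rightarrow> 'k base \<Rightarrow> complex) \<Rightarrow> ('k \<Rightarrow> nat) \<Rightarrow> 'k base \<Rightarrow> complex" where
  "pd_coeff i n b \<gamma> x = (if mi_deg \<gamma> \<le> n then pd i (b \<gamma>) x else 0) +
     (if \<gamma> i > 0 then b (\<gamma>(i := \<gamma> i - 1)) x else 0)"

lemma has_expansion_pd:
  assumes B: "has_expansion U n b B" and U: "open U"
  shows "has_expansion U (Suc n) (pd_coeff i n b) (\<lambda>f. pd i (B f))"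
  unfolding has_expansion_def
proof (intro conjI allI impI ballI)
  fix \<gamma> :: "'a \<Rightarrow> nat" assume \<gamma>: "mi_deg \<gamma> \<le> Suc n"
  have "mi_deg (\<gamma>(i := \<gamma> i - 1)) \<le> n" if "\<gamma> i > 0"
    using mi_deg_Suc[of "\<gamma>(i := \<gamma> i - 1)" i] that \<gamma> by simp
  then show "holo_on U (pd_coeff i n b \<gamma>)"
    unfolding pd_coeff_def
    by (cases "mi_deg \<gamma> \<le> n"; cases "\<gamma> i > 0")
      (auto intro!: holo_on_add holo_on_pd has_expansion_holo[OF B] U holo_on_const)
next
  fix V f x assume V: "open V \<and> V \<subseteq> U \<and> holo_on V f" and x: "x \<in> V"
  have hb: "holo_on V (b \<alpha>)" if "mi_deg \<alpha> \<le> n" for \<alpha>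
    using has_expansion_holo[OF B that] V holo_on_subset by blast
  have hm: "holo_on V (mpd \<alpha> f)" for \<alpha> using V by (auto intro: holo_on_mpd)
  have "pd i (B f) x = pd i (\<lambda>x. \<Sum>\<alpha> | mi_deg \<alpha> \<le> n. b \<alpha> x * mpd \<alpha> f x) x"
    using V x has_expansionD[OF B] by (intro pd_cong[of V]) auto
  also have "\<dots> = (\<Sum>\<alpha> | mi_deg \<alpha> \<le> n. pd i (\<lambda>x. b \<alpha> x * mpd \<alpha> f x) x)"
    using x by (intro pd_sum[of _ V] holo_on_mult hb hm) auto
  also have "\<dots> = (\<Sum>\<alpha> | mi_deg \<alpha> \<le> n. pd i (b \<alpha>) x * mpd \<alpha> f x + b \<alpha> x * mpd (\<alpha>(i := Suc (\<alpha> i))) f x)"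
    using V x by (intro sum.cong refl) (simp add: pd_mult[OF hb hm x] mpd_Suc[of V])
  also have "\<dots> = (\<Sum>\<alpha> | mi_deg \<alpha> \<le> n. pd i (b \<alpha>) x * mpd \<alpha> f x) +
      (\<Sum>\<alpha> | mi_deg \<alpha> \<le> n. b \<alpha> x * mpd (\<alpha>(i := Suc (\<alpha> i))) f x)"
    by (rule sum.distrib)
  also have "(\<Sum>\<alpha> | mi_deg \<alpha> \<le> n. pd i (b \<alpha>) x * mpd \<alpha> f x) =
      (\<Sum>\<gamma> | mi_deg \<gamma> \<le> Suc n. (if mi_deg \<gamma> \<le> n then pd i (b \<gamma>) x else 0) * mpd \<gamma> f x)"
    by (intro sum.mono_neutral_cong_left finite_mi_deg) auto
  also have "(\<Sum>\<alpha> | mi_deg \<alpha> \<le> n. b \<alpha> x * mpd (\<alpha>(i := Suc (\<alpha> i))) f x) =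
      (\<Sum>\<gamma> | \<gamma> i > 0 \<and> mi_deg \<gamma> \<noteq> 0 \<and> mi_deg \<gamma> - 1 \<le> n. b (\<gamma>(i := \<gamma> i - 1)) x * mpd \<gamma> f x)"
    by (rule sum.reindex_bij_betw[OF bij_betw_multi_index_Suc[of i "\<lambda>d. d \<le> n"],
         where g="\<lambda>\<gamma>. b (\<gamma>(i := \<gamma> i - 1)) x * mpd \<gamma> f x",
         unfolded fun_upd_upd fun_upd_same diff_Suc_1 fun_upd_triv])
  also have "\<dots> = (\<Sum>\<gamma> | mi_deg \<gamma> \<le> Suc n. (if \<gamma> i > 0 then b (\<gamma>(i := \<gamma> i - 1)) x else 0) * mpd \<gamma> f x)"
    by (intro sum.mono_neutral_cong_left finite_mi_deg) (auto simp: mi_deg_zero)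
  finally show "pd i (B f) x = (\<Sum>\<gamma> | mi_deg \<gamma> \<le> Suc n. pd_coeff i n b \<gamma> x * mpd \<gamma> f x)"
    by (simp add: pd_coeff_def sum.distrib ring_distribs)
qed

text \<open>The differentiated coefficients stop at degree \<open>n\<close>, so in degree
  \<open>Suc n\<close> only the raised multi-indices are left, and each contributes one more factor
  of the fibre coordinate.\<close>

lemma symbol_pd: "symbol (Suc n) (pd_coeff i n b) z = fibre_pt z $ i * symbol n b z"
proof -
  have "symbol (Suc n) (pd_coeff i n b) z = (\<Sum>\<gamma> | mi_deg \<gamma> = Suc n.
      (if \<gamma> i > 0 then b (\<gamma>(i := \<gamma> i - 1)) (base_pt z) else 0) * (\<Prod>j\<in>UNIV. (fibre_pt z $ j) ^ \<gamma> j))"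
    unfolding symbol_def pd_coeff_def by (intro sum.cong) auto
  also have "\<dots> = (\<Sum>\<gamma> | \<gamma> i > 0 \<and> mi_deg \<gamma> \<noteq> 0 \<and> mi_deg \<gamma> - 1 = n.
      b (\<gamma>(i := \<gamma> i - 1)) (base_pt z) * (\<Prod>j\<in>UNIV. (fibre_pt z $ j) ^ \<gamma> j))"
    by (intro sum.mono_neutral_cong_right finite_mi_deg_eq) auto
  also have "\<dots> = (\<Sum>\<beta> | mi_deg \<beta> = n. b \<beta> (base_pt z) * (\<Prod>j\<in>UNIV. (fibre_pt z $ j) ^ (\<beta>(i := Suc (\<beta> i))) j))"
    by (rule sum.reindex_bij_betw[OF bij_betw_multi_index_Suc[of i "\<lambda>d. d = n"], symmetric,
         where g="\<lambda>\<gamma>. b (\<gamma>(i := \<gamma> i - 1)) (base_pt z) * (\<Prod>j\<in>UNIV. (fibre_pt z $ j) ^ \<gamma> j)",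
         unfolded fun_upd_upd fun_upd_same diff_Suc_1 fun_upd_triv])
  also have "\<dots> = fibre_pt z $ i * symbol n b z"
    unfolding symbol_def sum_distrib_left
    by (intro sum.cong refl) (simp add: prod.remove[of UNIV i] mult_ac)
  finally show ?thesis .
qed


subsection \<open>Composition of differential operators\<close>

lemma has_expansion_sum:
  assumes "finite I" "\<And>j. j \<in> I \<Longrightarrow> \<exists>a. has_expansion U m a (P j)"
  shows "\<exists>a. has_expansion U m a (\<lambda>f x. \<Sum>j\<in>I. P j f x)"
  using assms
proof (induction I rule: finite_induct)
  case empty
  show ?case by (intro exI[of _ "\<lambda>\<alpha> x. 0"]) (simp add: has_expansion_def holo_on_const)
next
  case (insert j I)
  then obtain a b where "has_expansion U m a (P j)" "has_expansion U m b (\<lambda>f x. \<Sum>j\<in>I. P j f x)" by blast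
  from has_expansion_add[OF this] insert.hyps show ?case by auto
qed

lemma has_expansion_mpd_comp:
  assumes B: "has_expansion U n b B" and U: "open U"
  shows "\<exists>a. has_expansion U (n + mi_deg \<alpha>) a (\<lambda>f. mpd \<alpha> (B f))"
proof (induction \<alpha> rule: multi_index_induct)
  case zero then show ?case using B by (auto simp: mpd_zero mi_deg_def)
next
  case (Suc \<alpha> i)
  then obtain a where a: "has_expansion U (n + mi_deg \<alpha>) a (\<lambda>f. mpd \<alpha> (B f))" by blast
  have "has_expansion U (Suc (n + mi_deg \<alpha>)) (pd_coeff i (n + mi_deg \<alpha>) a) (\<lambda>f. mpd (\<alpha>(i := Suc (\<alpha> i))) (B f))"
    by (rule has_expansion_cong[OF has_expansion_pd[OF a U]])
      (rule mpd_Suc[symmetric, OF has_expansion_result_holo[OF B]])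
  then show ?case by (auto simp only: mi_deg_Suc add_Suc_right)
qed

lemma has_expansion_comp:
  assumes Q: "has_expansion U m a Q" and B: "has_expansion U n b B" and U: "open U"
  shows "\<exists>c. has_expansion U (n + m) c (Q \<circ> B)"
proof -
  have "\<exists>c. has_expansion U (n + m) c (\<lambda>f x. a \<alpha> x * mpd \<alpha> (B f) x)" if "mi_deg \<alpha> \<le> m" for \<alpha>
  proof -
    obtain c where "has_expansion U (n + mi_deg \<alpha>) c (\<lambda>f. mpd \<alpha> (B f))"
      using has_expansion_mpd_comp[OF B U] by blast
    moreover have "n + mi_deg \<alpha> \<le> n + m" using that by simp
    ultimately show ?thesis
      by (intro exI) (rule has_expansion_mult[OF has_expansion_raise has_expansion_holo[OF Q that]])
  qed
  then obtain c where "has_expansion U (n + m) c (\<lambda>f x. \<Sum>\<alpha> | mi_deg \<alpha> \<le> m. a \<alpha> x * mpd \<alpha> (B f) x)"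
    using has_expansion_sum[OF finite_mi_deg, of m U "n + m" "\<lambda>\<alpha> f x. a \<alpha> x * mpd \<alpha> (B f) x"] by auto
  then have "has_expansion U (n + m) c (Q \<circ> B)"
    by (rule has_expansion_cong)
      (simp add: has_expansionD[OF Q] has_expansion_result_holo[OF B])
  then show ?thesis by blast
qed

section \<open>Sections of D_N over open sets\<close>

lemma D_sectionsE:
  assumes "P \<in> D_sections U" "x \<in> U"
  obtains V m a where "open V" "x \<in> V" "V \<subseteq> U" "has_expansion V m a P"
  using assms unfolding D_sections_def by blast

lemma D_sectionsI:
  assumes "open U" "has_expansion U m a P" shows "P \<in> D_sections U"
  using assms unfolding D_sections_def by blast

lemma D_sections_subset:
  assumes "P \<in> D_sections U" "V \<subseteq> U" "open V" shows "P \<in> D_sections V"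
  unfolding D_sections_def
proof (intro CollectI ballI)
  fix x assume "x \<in> V"
  then obtain W m a where "open W" "x \<in> W" "W \<subseteq> U" "has_expansion W m a P"
    using D_sectionsE[OF assms(1)] assms(2) by blast
  then show "\<exists>W m a. open W \<and> x \<in> W \<and> W \<subseteq> V \<and> has_expansion W m a P"
    using \<open>x \<in> V\<close> \<open>open V\<close> has_expansion_subset[of W m a P "W \<inter> V"]
    by (intro exI[of _ "W \<inter> V"] exI[of _ m] exI[of _ a]) auto
qed

lemma D_sections_cong:
  assumes "P \<in> D_sections U"
    and "\<And>V f x. open V \<Longrightarrow> V \<subseteq> U \<Longrightarrow> holo_on V f \<Longrightarrow> x \<in> V \<Longrightarrow> P f x = Q f x"
  shows "Q \<in> D_sections U"
  unfolding D_sections_def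
proof (intro CollectI ballI)
  fix x assume "x \<in> U"
  then obtain W m a where W: "open W" "x \<in> W" "W \<subseteq> U" "has_expansion W m a P"
    using D_sectionsE[OF assms(1)] by blast
  have "has_expansion W m a Q"
    by (rule has_expansion_cong[OF W(4)]) (use assms(2) W(3) in auto)
  then show "\<exists>W m a. open W \<and> x \<in> W \<and> W \<subseteq> U \<and> has_expansion W m a Q"
    using W by blast
qed

lemma D_sections_local:
  assumes P: "P \<in> D_sections U" and W: "open W" "W \<subseteq> U" "holo_on W f" "x \<in> W"
    and "\<And>x. x \<in> W \<Longrightarrow> f x = g x"
  shows "P f x = P g x"
proof -
  obtain V m a where V: "open V" "x \<in> V" "V \<subseteq> U" "has_expansion V m a P"
    using D_sectionsE[OF P] W by blast
  show ?thesis
    by (rule has_expansion_local[OF V(4), of "V \<inter> W"])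
      (use assms V in \<open>auto intro: holo_on_subset[OF W(3)]\<close>)
qed

lemma D_sections_result_holo:
  assumes P: "P \<in> D_sections U" and W: "open W" "W \<subseteq> U" "holo_on W f"
  shows "holo_on W (P f)"
proof (rule holo_on_local)
  fix x assume x: "x \<in> W"
  obtain V m a where V: "open V" "x \<in> V" "V \<subseteq> U" "has_expansion V m a P"
    using D_sectionsE[OF P] W x by blast
  have "holo_on (V \<inter> W) (P f)"
    by (rule has_expansion_result_holo[OF V(4)]) (use V W in \<open>auto intro: holo_on_subset[OF W(3)]\<close>)
  then show "\<exists>V. x \<in> V \<and> holo_on V (P f)" using x V by blast
qed

text \<open>Operators are not linear on all functions by definition; additivity on holomorphic
  functions comes from the local expansion. The empty sum is included and says that the zero
  function goes to zero.\<close>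

lemma D_sections_sum_arg:
  assumes P: "P \<in> D_sections U" and W: "open W" "W \<subseteq> U" "\<And>j. j \<in> I \<Longrightarrow> holo_on W (f j)" and x: "x \<in> W"
  shows "P (\<lambda>x. \<Sum>j\<in>I. f j x) x = (\<Sum>j\<in>I. P (f j) x)"
proof -
  obtain V m a where V: "open V" "x \<in> V" "V \<subseteq> U" "has_expansion V m a P"
    using D_sectionsE[OF P] W x by blast
  have h: "holo_on (V \<inter> W) (f j)" if "j \<in> I" for j
    by (rule holo_on_subset[OF W(3)[OF that]]) auto
  have o: "open (V \<inter> W)" "V \<inter> W \<subseteq> V" "x \<in> V \<inter> W" using V W x by auto
  have "P (\<lambda>x. \<Sum>j\<in>I. f j x) x = (\<Sum>\<alpha> | mi_deg \<alpha> \<le> m. a \<alpha> x * mpd \<alpha> (\<lambda>x. \<Sum>j\<in>I. f j x) x)"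
    by (rule has_expansionD[OF V(4) o(1,2) holo_on_sum[OF h] o(3)])
  also have "\<dots> = (\<Sum>j\<in>I. \<Sum>\<alpha> | mi_deg \<alpha> \<le> m. a \<alpha> x * mpd \<alpha> (f j) x)"
    by (subst mpd_sum[OF h o(1,3)]) (auto simp: sum_distrib_left intro: sum.swap)
  also have "\<dots> = (\<Sum>j\<in>I. P (f j) x)"
    by (intro sum.cong refl has_expansionD[symmetric, OF V(4) o(1,2) h o(3)])
  finally show ?thesis .
qed

lemma D_sections_comp:
  assumes "P \<in> D_sections U" "Q \<in> D_sections U"
  shows "P \<circ> Q \<in> D_sections U"
  unfolding D_sections_def
proof (intro CollectI ballI)
  fix x assume x: "x \<in> U"
  obtain V m a where V: "open V" "x \<in> V" "V \<subseteq> U" "has_expansion V m a P"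
    using D_sectionsE[OF assms(1) x] by blast
  obtain V' n b where V': "open V'" "x \<in> V'" "V' \<subseteq> U" "has_expansion V' n b Q"
    using D_sectionsE[OF assms(2) x] by blast
  obtain c where "has_expansion (V \<inter> V') (n + m) c (P \<circ> Q)"
    using has_expansion_comp[OF has_expansion_subset[OF V(4)] has_expansion_subset[OF V'(4)], of "V \<inter> V'"] V V'
    by auto
  then show "\<exists>W m a. open W \<and> x \<in> W \<and> W \<subseteq> U \<and> has_expansion W m a (P \<circ> Q)"
    using V V' by (intro exI[of _ "V \<inter> V'"]) blast
qed

lemma D_sections_add:
  assumes "P \<in> D_sections U" "Q \<in> D_sections U"
  shows "(\<lambda>f x. P f x + Q f x) \<in> D_sections U"
  unfolding D_sections_def
proof (intro CollectI ballI)
  fix x assume x: "x \<in> U"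
  obtain V m a where V: "open V" "x \<in> V" "V \<subseteq> U" "has_expansion V m a P"
    using D_sectionsE[OF assms(1) x] by blast
  obtain V' n b where V': "open V'" "x \<in> V'" "V' \<subseteq> U" "has_expansion V' n b Q"
    using D_sectionsE[OF assms(2) x] by blast
  have "\<exists>c. has_expansion (V \<inter> V') (max m n) c (\<lambda>f x. P f x + Q f x)"
    using has_expansion_add[OF has_expansion_raise[OF has_expansion_subset[OF V(4)]]
        has_expansion_raise[OF has_expansion_subset[OF V'(4)]], of "V \<inter> V'" "max m n"] by auto
  then show "\<exists>W m a. open W \<and> x \<in> W \<and> W \<subseteq> U \<and> has_expansion W m a (\<lambda>f x. P f x + Q f x)"
    using V V' by (intro exI[of _ "V \<inter> V'"]) blast
qed

lemma D_sections_mult: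
  assumes "P \<in> D_sections U" "holo_on U c"
  shows "(\<lambda>f x. c x * P f x) \<in> D_sections U"
  unfolding D_sections_def
proof (intro CollectI ballI)
  fix x assume x: "x \<in> U"
  obtain V m a where V: "open V" "x \<in> V" "V \<subseteq> U" "has_expansion V m a P"
    using D_sectionsE[OF assms(1) x] by blast
  then show "\<exists>W m a. open W \<and> x \<in> W \<and> W \<subseteq> U \<and> has_expansion W m a (\<lambda>f x. c x * P f x)"
    using has_expansion_mult[OF V(4) holo_on_subset[OF assms(2) V(3)]] by blast
qed

lemma D_sections_id: "open U \<Longrightarrow> (\<lambda>f. f) \<in> D_sections U"
  by (rule D_sectionsI[OF _ has_expansion_id])

lemma D_sections_zero: "open U \<Longrightarrow> (\<lambda>f x. 0) \<in> D_sections U"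
  using D_sections_mult[OF D_sections_id holo_on_const, of U 0] by simp

lemma D_sections_sum:
  assumes "open U" "\<And>j. j \<in> I \<Longrightarrow> P j \<in> D_sections U"
  shows "(\<lambda>f x. \<Sum>j\<in>I. P j f x) \<in> D_sections U"
  using assms(2) by (induction I rule: infinite_finite_induct) (auto intro: D_sections_zero D_sections_add assms)

lemma D_sections_pd: "open U \<Longrightarrow> P \<in> D_sections U \<Longrightarrow> (\<lambda>f. pd i (P f)) \<in> D_sections U"
  using D_sections_comp[OF D_sectionsI[OF _ has_expansion_pd[OF has_expansion_id]], of U P i]
  by (simp add: o_def)

subsection \<open>Left ideals generated by finitely many operators\<close>

text \<open>The commutation relations produce coefficients over all of N, and one for every element
  of \<open>S\<close>. \<open>left_ideal\<close> asks for much less, namely local coefficients; the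
  stronger form is what composes easily.\<close>

definition in_left_ideal :: "'k::{finite,linorder} diffop set \<Rightarrow> 'k diffop \<Rightarrow> bool" where
  "in_left_ideal S H \<longleftrightarrow> (\<exists>B. (\<forall>G\<in>S. B G \<in> D_sections UNIV) \<and>
     (\<forall>W f. open W \<longrightarrow> holo_on W f \<longrightarrow> (\<forall>y\<in>W. H f y = (\<Sum>G\<in>S. B G (G f) y))))"

lemma in_left_ideal_gen:
  fixes H :: "'k::{finite,linorder} diffop" and S :: "'k diffop set"
  assumes "finite S" "G \<in> S" "Q \<in> D_sections UNIV"
    and "\<And>W f y. open W \<Longrightarrow> holo_on W f \<Longrightarrow> y \<in> W \<Longrightarrow> H f y = Q (G f) y"
  shows "in_left_ideal S H"
  unfolding in_left_ideal_def
proof (intro exI conjI ballI allI impI)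
  show "(if G' = G then Q else (\<lambda>f x. 0)) \<in> D_sections UNIV" for G'
    using assms(3) by (auto intro: D_sections_zero)
  fix W :: "'k base set" and f y assume "open W" "holo_on W f" "y \<in> W"
  then have "H f y = Q (G f) y" by (rule assms(4))
  also have "\<dots> = (\<Sum>G'\<in>S. if G' = G then Q (G' f) y else 0)"
    using assms(1,2) by simp
  also have "\<dots> = (\<Sum>G'\<in>S. (if G' = G then Q else (\<lambda>f x. 0)) (G' f) y)"
    by (intro sum.cong) auto
  finally show "H f y = (\<Sum>G'\<in>S. (if G' = G then Q else (\<lambda>f x. 0)) (G' f) y)" .
qed

lemma in_left_ideal_add:
  fixes H :: "'k::{finite,linorder} diffop" and S :: "'k diffop set"
  assumes "in_left_ideal S P" "in_left_ideal S Q"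
    and "\<And>W f y. open W \<Longrightarrow> holo_on W f \<Longrightarrow> y \<in> W \<Longrightarrow> H f y = P f y + Q f y"
  shows "in_left_ideal S H"
proof -
  obtain B where B: "\<forall>G\<in>S. B G \<in> D_sections UNIV"
    "\<And>W f y. open W \<Longrightarrow> holo_on W f \<Longrightarrow> y \<in> W \<Longrightarrow> P f y = (\<Sum>G\<in>S. B G (G f) y)"
    using assms(1) unfolding in_left_ideal_def by blast
  obtain C where C: "\<forall>G\<in>S. C G \<in> D_sections UNIV"
    "\<And>W f y. open W \<Longrightarrow> holo_on W f \<Longrightarrow> y \<in> W \<Longrightarrow> Q f y = (\<Sum>G\<in>S. C G (G f) y)"
    using assms(2) unfolding in_left_ideal_def by blast
  show ?thesis
    unfolding in_left_ideal_def
    by (rule exI[of _ "\<lambda>G f x. B G f x + C G f x"])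
      (use B C in \<open>simp add: D_sections_add sum.distrib assms(3)\<close>)
qed

lemma left_idealD1: "P \<in> left_ideal S U \<Longrightarrow> P \<in> D_sections U"
  by (simp only: left_ideal_def mem_Collect_eq)

lemma left_idealD2:
  assumes "P \<in> left_ideal S U" "x \<in> U"
  shows "\<exists>V F Q. open V \<and> x \<in> V \<and> V \<subseteq> U \<and> finite F \<and> F \<subseteq> S \<and> (\<forall>G\<in>F. Q G \<in> D_sections V) \<and>
      (\<forall>W f. open W \<and> W \<subseteq> V \<and> holo_on W f \<longrightarrow> (\<forall>y\<in>W. P f y = (\<Sum>G\<in>F. Q G (G f) y)))"
  using assms(1)[unfolded left_ideal_def mem_Collect_eq, THEN conjunct2] assms(2) by (rule bspec)

text \<open>If P is a sum of Q_G G and each G R is a sum of B_(G,G') G', then P R is the sum of (Q_G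
  B_(G,G')) G'. Stability under right multiplication has therefore to be checked on generators
  only.\<close>

lemma left_ideal_comp:
  assumes fin: "finite S" and S: "S \<subseteq> D_sections UNIV" and U: "open U"
    and R: "R \<in> D_sections UNIV" and SR: "\<And>G. G \<in> S' \<Longrightarrow> in_left_ideal S (G \<circ> R)"
    and P: "P \<in> left_ideal S' U"
  shows "P \<circ> R \<in> left_ideal S U"
  unfolding left_ideal_def
proof (intro CollectI conjI ballI)
  have RU: "R \<in> D_sections V" if "open V" for V using D_sections_subset[OF R _ that] by simp
  show "P \<circ> R \<in> D_sections U"
    by (rule D_sections_comp[OF left_idealD1[OF P] RU[OF U]])
  fix x assume x: "x \<in> U"
  obtain V F Q where *: "open V \<and> x \<in> V \<and> V \<subseteq> U \<and> finite F \<and> F \<subseteq> S' \<and> (\<forall>G\<in>F. Q G \<in> D_sections V) \<and>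
      (\<forall>W f. open W \<and> W \<subseteq> V \<and> holo_on W f \<longrightarrow> (\<forall>y\<in>W. P f y = (\<Sum>G\<in>F. Q G (G f) y)))"
    using left_idealD2[OF P x] by (elim exE)
  then have V: "open V" "x \<in> V" "V \<subseteq> U" and F: "finite F" "F \<subseteq> S'"
    and Q: "\<And>G. G \<in> F \<Longrightarrow> Q G \<in> D_sections V"
    and eq: "\<And>W f y. open W \<Longrightarrow> W \<subseteq> V \<Longrightarrow> holo_on W f \<Longrightarrow> y \<in> W \<Longrightarrow> P f y = (\<Sum>G\<in>F. Q G (G f) y)"
    by blast+
  have "\<forall>G\<in>F. \<exists>B. (\<forall>G'\<in>S. B G' \<in> D_sections UNIV) \<and>
     (\<forall>W f. open W \<longrightarrow> holo_on W f \<longrightarrow> (\<forall>y\<in>W. (G \<circ> R) f y = (\<Sum>G'\<in>S. B G' (G' f) y)))"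
    using SR F unfolding in_left_ideal_def by blast
  from bchoice[OF this] obtain B where B: "\<forall>G\<in>F. (\<forall>G'\<in>S. B G G' \<in> D_sections UNIV) \<and>
     (\<forall>W f. open W \<longrightarrow> holo_on W f \<longrightarrow> (\<forall>y\<in>W. (G \<circ> R) f y = (\<Sum>G'\<in>S. B G G' (G' f) y)))" ..
  have BD: "B G G' \<in> D_sections UNIV" if "G \<in> F" "G' \<in> S" for G G'
    using B that by blast
  have Beq: "G (R f) y = (\<Sum>G'\<in>S. B G G' (G' f) y)" if "G \<in> F" "open W" "holo_on W f" "y \<in> W" for G W f y
    using bspec[OF B that(1)] that(2-4) unfolding comp_apply by blast
  have BV: "B G G' \<in> D_sections V" if "G \<in> F" "G' \<in> S" for G G'
    using D_sections_subset[OF BD[OF that] _ V(1)] by simp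
  define Q' where "Q' G' = (\<lambda>f x. \<Sum>G\<in>F. Q G (B G G' f) x)" for G'
  have Q': "Q' G' \<in> D_sections V" if "G' \<in> S" for G'
    unfolding Q'_def
    using D_sections_sum[OF V(1), of F "\<lambda>G. Q G \<circ> B G G'"] D_sections_comp[OF Q BV[OF _ that]] by simp
  have "(P \<circ> R) f y = (\<Sum>G'\<in>S. Q' G' (G' f) y)" if W: "open W" "W \<subseteq> V" "holo_on W f" "y \<in> W" for W f y
  proof -
    have hR: "holo_on W (R f)" by (rule D_sections_result_holo[OF R W(1) _ W(3)]) simp
    have hG: "holo_on W (G' f)" if "G' \<in> S" for G'
      by (rule D_sections_result_holo[of _ UNIV]) (use S that W in auto)
    have hB: "holo_on W (B G G' (G' f))" if "G \<in> F" "G' \<in> S" for G G'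
      by (rule D_sections_result_holo[OF BD[OF that] W(1) _ hG]) (use that in auto)
    have "(P \<circ> R) f y = (\<Sum>G\<in>F. Q G (G (R f)) y)" using eq[OF W(1,2) hR W(4)] by simp
    also have "\<dots> = (\<Sum>G\<in>F. \<Sum>G'\<in>S. Q G (B G G' (G' f)) y)"
    proof (rule sum.cong[OF refl])
      fix G assume G: "G \<in> F"
      \<comment> \<open>The two arguments are known to agree on \<open>W\<close> only, so locality
        of \<open>Q G\<close> comes before its additivity.\<close>
      have "Q G (\<lambda>x. \<Sum>G'\<in>S. B G G' (G' f) x) y = Q G (G (R f)) y"
        by (rule D_sections_local[OF Q[OF G] W(1,2) holo_on_sum W(4)])
          (use hB[OF G] Beq[OF G W(1,3)] in \<open>simp_all\<close>)
      moreover have "Q G (\<lambda>x. \<Sum>G'\<in>S. B G G' (G' f) x) y = (\<Sum>G'\<in>S. Q G (B G G' (G' f)) y)"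
        by (rule D_sections_sum_arg[OF Q[OF G] W(1,2) _ W(4)]) (rule hB[OF G])
      ultimately show "Q G (G (R f)) y = (\<Sum>G'\<in>S. Q G (B G G' (G' f)) y)" by simp
    qed
    also have "\<dots> = (\<Sum>G'\<in>S. Q' G' (G' f) y)" unfolding Q'_def by (rule sum.swap)
    finally show ?thesis .
  qed
  then show "\<exists>V F Q. open V \<and> x \<in> V \<and> V \<subseteq> U \<and> finite F \<and> F \<subseteq> S \<and> (\<forall>G\<in>F. Q G \<in> D_sections V) \<and>
        (\<forall>W f. open W \<and> W \<subseteq> V \<and> holo_on W f \<longrightarrow> (\<forall>y\<in>W. (P \<circ> R) f y = (\<Sum>G\<in>F. Q G (G f) y)))"
    using V fin Q' by (intro exI[of _ V] exI[of _ S] exI[of _ Q'] conjI) blast+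
qed

lemma left_ideal_generator:
  assumes "G \<in> S" "G \<in> D_sections U" "open U"
  shows "G \<in> left_ideal S U"
  unfolding left_ideal_def
  using assms D_sections_id[OF assms(3)]
  by (intro CollectI conjI ballI exI[of _ U] exI[of _ "{G}"] exI[of _ "\<lambda>_ f. f"]) auto


subsection \<open>Commutation relations\<close>

lemma bij_betw_crd: "bij_betw (crd :: nat \<Rightarrow> 'k::{finite,linorder}) {1..CARD('k)} UNIV"
proof -
  let ?xs = "sorted_list_of_set (UNIV :: 'k set)"
  have "bij_betw ((!) ?xs) {..<length ?xs} (set ?xs)"
    by (rule bij_betw_nth) auto
  then have b: "bij_betw ((!) ?xs) {..<CARD('k)} UNIV" by simp
  have "bij_betw (\<lambda>h::nat. h - 1) {1..CARD('k)} {..<CARD('k)}"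
    by (rule bij_betw_byWitness[where f'=Suc]) auto
  from bij_betw_trans[OF this b] show ?thesis by (simp add: o_def crd_def[abs_def])
qed

lemma crd_eq_iff: "p \<in> {1..CARD('k)} \<Longrightarrow> q \<in> {1..CARD('k)} \<Longrightarrow> (crd p :: 'k::{finite,linorder}) = crd q \<longleftrightarrow> p = q"
  using bij_betw_crd[where 'k='k] unfolding bij_betw_def by (auto dest: inj_onD)

lemma crd_surj: obtains h where "h \<in> {1..CARD('k)}" "crd h = (i :: 'k::{finite,linorder})"
  using bij_betw_crd[where 'k='k] unfolding bij_betw_def by (metis imageE UNIV_I)

lemma sum_crd: "(\<Sum>i\<in>UNIV. g (i :: 'k::{finite,linorder})) = (\<Sum>h=1..CARD('k). g (crd h))"
  by (rule sum.reindex_bij_betw[OF bij_betw_crd, symmetric])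

lemma holo_on_sig [holo_intros]: "holo_on U (sig h)"
  unfolding sig_def by (cases "h = 0"; cases "h \<le> CARD('a)") (auto intro: holo_intros)

text \<open>The conventions \<open>sig 0 = 1\<close> and \<open>sig (k + 1) = 0\<close> are covered
  as well: these are constants, and their index never equals \<open>p\<close>.\<close>

lemma dd_sig:
  assumes "p \<in> {1..CARD('k)}"
  shows "dd p (sig h) (x :: 'k::{finite,linorder} base) = (if p = h then 1 else 0)"
proof (cases "h \<in> {1..CARD('k)}")
  case True
  then have "sig h = (\<lambda>x :: 'k base. x $ crd h)" by (auto simp: sig_def)
  then show ?thesis using assms True by (simp add: dd_def pd_nth crd_eq_iff)
next
  case False
  then have "sig h = (\<lambda>x :: 'k base. if h = 0 then 1 else 0)" by (auto simp: sig_def)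
  then show ?thesis using assms False by (auto simp: dd_def pd_const)
qed

lemma sig_0 [simp]: "sig 0 x = 1" by (simp add: sig_def)

lemma sig_gt [simp]: "h > CARD('k) \<Longrightarrow> sig h (x :: 'k::{finite,linorder} base) = 0" by (simp add: sig_def)

section \<open>Vector fields and their commutators\<close>

definition vf :: "(nat \<Rightarrow> 'k base \<Rightarrow> complex) \<Rightarrow> 'k::{finite,linorder} diffop" where
  "vf c f x = (\<Sum>h=1..CARD('k). c h x * dd h f x)"

definition Emu :: "complex \<Rightarrow> 'k::{finite,linorder} diffop" where
  "Emu \<mu> f x = E_op f x + \<mu> * f x"

definition Vop :: "complex \<Rightarrow> 'k::{finite,linorder} diffop" where
  "Vop \<mu> f x = U1_op f x + \<mu> * sig 1 x * f x"

lemma E_op_vf: "E_op = vf sig"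
  by (simp add: fun_eq_iff E_op_def vf_def)

lemma U0_op_vf: "U0_op = vf (\<lambda>h x. of_nat h * sig h x)"
  by (simp add: fun_eq_iff U0_op_def vf_def)

lemma U1_op_vf: "U1_op = vf (\<lambda>h x. sig 1 x * sig h x - of_nat (h + 1) * sig (h + 1) x)"
  by (simp add: fun_eq_iff U1_op_def vf_def)

lemma Um1_op_vf: "(Um1_op :: 'k::{finite,linorder} diffop) =
   vf (\<lambda>h x. of_nat (CARD('k) - (h - 1)) * sig (h - 1) x)"
proof (intro ext)
  fix f and x :: "'k base"
  have c: "CARD('k) = Suc (CARD('k) - 1)" by simp
  have "Um1_op f x = (\<Sum>h=0..CARD('k) - 1. of_nat (CARD('k) - (Suc h - 1)) * sig (Suc h - 1) x * dd (Suc h) f x)"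
    by (simp add: Um1_op_def)
  also have "\<dots> = (\<Sum>h=Suc 0..Suc (CARD('k) - 1). of_nat (CARD('k) - (h - 1)) * sig (h - 1) x * dd h f x)"
    by (rule sum.shift_bounds_cl_Suc_ivl[symmetric])
  finally show "Um1_op f x = vf (\<lambda>h x. of_nat (CARD('k) - (h - 1)) * sig (h - 1) x) f x"
    by (simp add: vf_def)
qed

context
  fixes W :: "'k::{finite,linorder} base set"
  assumes W: "open W"
begin

lemma holo_on_dd [holo_intros]: "holo_on W f \<Longrightarrow> holo_on W (dd h f)"
  unfolding dd_def by (rule holo_on_pd[OF _ W])

lemma holo_on_vf [holo_intros]: "(\<And>h. holo_on W (c h)) \<Longrightarrow> holo_on W f \<Longrightarrow> holo_on W (vf c f)"
  unfolding vf_def[abs_def] by (intro holo_intros)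

lemma dd_commute: "holo_on W f \<Longrightarrow> x \<in> W \<Longrightarrow> dd p (dd q f) x = dd q (dd p f) x"
  unfolding dd_def by (rule pd_commute[OF _ W])

lemma dd_cong: "x \<in> W \<Longrightarrow> (\<And>y. y \<in> W \<Longrightarrow> f y = g y) \<Longrightarrow> dd p f x = dd p g x"
  unfolding dd_def by (rule pd_cong[OF W])

lemma dd_add: "holo_on W f \<Longrightarrow> holo_on W g \<Longrightarrow> x \<in> W \<Longrightarrow> dd p (\<lambda>x. f x + g x) x = dd p f x + dd p g x"
  unfolding dd_def by (rule pd_add)

lemma dd_diff: "holo_on W f \<Longrightarrow> holo_on W g \<Longrightarrow> x \<in> W \<Longrightarrow> dd p (\<lambda>x. f x - g x) x = dd p f x - dd p g x"
  unfolding dd_def by (rule pd_diff)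

lemma dd_mult: "holo_on W f \<Longrightarrow> holo_on W g \<Longrightarrow> x \<in> W \<Longrightarrow>
    dd p (\<lambda>x. f x * g x) x = dd p f x * g x + f x * dd p g x"
  unfolding dd_def by (rule pd_mult)

lemma dd_cmult: "holo_on W f \<Longrightarrow> x \<in> W \<Longrightarrow> dd p (\<lambda>x. c * f x) x = c * dd p f x"
  unfolding dd_def by (rule pd_cmult)

lemma dd_const: "dd p (\<lambda>x. c) x = 0"
  by (simp add: dd_def pd_const)

lemma vf_add: "holo_on W f \<Longrightarrow> holo_on W g \<Longrightarrow> x \<in> W \<Longrightarrow> vf c (\<lambda>x. f x + g x) x = vf c f x + vf c g x"
  by (simp add: vf_def dd_add ring_distribs sum.distrib)

lemma vf_diff: "holo_on W f \<Longrightarrow> holo_on W g \<Longrightarrow> x \<in> W \<Longrightarrow> vf c (\<lambda>x. f x - g x) x = vf c f x - vf c g x"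
  by (simp add: vf_def dd_diff ring_distribs sum_subtractf)

lemma vf_mult: "holo_on W f \<Longrightarrow> holo_on W g \<Longrightarrow> x \<in> W \<Longrightarrow>
    vf c (\<lambda>x. f x * g x) x = vf c f x * g x + f x * vf c g x"
  by (simp add: vf_def dd_mult ring_distribs sum.distrib sum_distrib_left sum_distrib_right mult_ac)

lemma vf_cmult: "holo_on W f \<Longrightarrow> x \<in> W \<Longrightarrow> vf c (\<lambda>x. a * f x) x = a * vf c f x"
  by (simp add: vf_def dd_cmult sum_distrib_left mult_ac)

lemma vf_sig: "vf c (sig h) x = (if h \<in> {1..CARD('k)} then c h x else 0)" for x :: "'k base"
proof -
  have "vf c (sig h) x = (\<Sum>q=1..CARD('k). if q = h then c q x else 0)"
    unfolding vf_def by (intro sum.cong refl) (simp add: dd_sig)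
  then show ?thesis by simp
qed

text \<open>\<open>E_op\<close>, \<open>Um1_op\<close>, \<open>U0_op\<close> and
  \<open>U1_op\<close> are all of the form \<open>vf c\<close>, so this formula and
  \<open>vf_vf\<close> supply every commutator that is needed.\<close>

lemma dd_vf:
  assumes c: "\<And>h. holo_on W (c h)" and f: "holo_on W f" and x: "x \<in> W"
  shows "dd p (vf c f) x = vf c (dd p f) x + (\<Sum>h=1..CARD('k). dd p (c h) x * dd h f x)"
proof -
  have "dd p (vf c f) x = (\<Sum>h=1..CARD('k). dd p (\<lambda>x. c h x * dd h f x) x)"
    unfolding vf_def[abs_def] dd_def[of p]
    by (rule pd_sum[OF _ x]) (intro holo_intros c f)
  also have "\<dots> = (\<Sum>h=1..CARD('k). c h x * dd h (dd p f) x + dd p (c h) x * dd h f x)"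
    by (intro sum.cong refl) (simp add: dd_mult[OF c _ x] holo_intros f dd_commute[OF f x, of p])
  finally show ?thesis by (simp add: vf_def sum.distrib)
qed

text \<open>Both orders of application have the same second-order part because partial derivatives
  commute; only derivatives of the coefficients survive.\<close>

lemma vf_vf:
  assumes c: "\<And>h. holo_on W (c h)" "\<And>h. holo_on W (c' h)" and f: "holo_on W f" and x: "x \<in> W"
  shows "vf c (vf c' f) x = vf c' (vf c f) x + vf (\<lambda>h y. vf c (c' h) y - vf c' (c h) y) f x"
proof -
  have *: "vf c (vf c' f) x = (\<Sum>p=1..CARD('k). c p x * vf c' (dd p f) x) + vf (\<lambda>h. vf c (c' h)) f x"
    if "\<And>h. holo_on W (c h)" "\<And>h. holo_on W (c' h)" for c c'
  proof -
    have "vf c (vf c' f) x = (\<Sum>p=1..CARD('k). c p x * (vf c' (dd p f) x +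
         (\<Sum>h=1..CARD('k). dd p (c' h) x * dd h f x)))"
      unfolding vf_def[of c] using dd_vf[OF that(2) f x] by simp
    also have "\<dots> = (\<Sum>p=1..CARD('k). c p x * vf c' (dd p f) x) +
        (\<Sum>p=1..CARD('k). \<Sum>h=1..CARD('k). c p x * dd p (c' h) x * dd h f x)"
      by (simp add: ring_distribs sum.distrib sum_distrib_left mult_ac)
    also have "(\<Sum>p=1..CARD('k). \<Sum>h=1..CARD('k). c p x * dd p (c' h) x * dd h f x) =
       vf (\<lambda>h. vf c (c' h)) f x"
      unfolding vf_def sum_distrib_right by (rule sum.swap)
    finally show ?thesis .
  qed
  have "(\<Sum>p=1..CARD('k). c p x * vf c' (dd p f) x) = (\<Sum>p=1..CARD('k). c' p x * vf c (dd p f) x)"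
    unfolding vf_def sum_distrib_left
    by (subst sum.swap) (simp add: mult_ac dd_commute[OF f x])
  with *[OF c] *[OF c(2,1)] show ?thesis
    by (simp add: vf_def ring_distribs sum_subtractf)
qed

lemma holo_on_E [holo_intros]: "holo_on W f \<Longrightarrow> holo_on W (E_op f)"
  unfolding E_op_vf by (intro holo_intros)

lemma holo_on_Emu [holo_intros]: "holo_on W f \<Longrightarrow> holo_on W (Emu \<mu> f)"
  unfolding Emu_def[abs_def] by (intro holo_intros)

lemma holo_on_Um1 [holo_intros]: "holo_on W f \<Longrightarrow> holo_on W (Um1_op f)"
  unfolding Um1_op_vf by (intro holo_intros)

lemma holo_on_U0 [holo_intros]: "holo_on W f \<Longrightarrow> holo_on W (U0_op f)"
  unfolding U0_op_vf by (intro holo_intros)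

lemma holo_on_V [holo_intros]: "holo_on W f \<Longrightarrow> holo_on W (Vop \<mu> f)"
  unfolding Vop_def[abs_def] U1_op_vf by (intro holo_intros)

lemma sum_delta_p: "p \<in> {1..CARD('k)} \<Longrightarrow> (\<Sum>h=1..CARD('k). (if p = h then 1 else 0) * g h) = (g p :: complex)"
  by (simp add: if_distrib[of "\<lambda>u. u * _"] cong: if_cong)

lemma dd_E:
  assumes "holo_on W f" "x \<in> W" "p \<in> {1..CARD('k)}"
  shows "dd p (E_op f) x = E_op (dd p f) x + dd p f x"
proof -
  have "dd p (E_op f) x = E_op (dd p f) x + (\<Sum>h=1..CARD('k). (if p = h then 1 else 0) * dd h f x)"
    unfolding E_op_vf by (subst dd_vf[OF holo_on_sig assms(1,2)]) (simp only: dd_sig[OF assms(3)])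
  then show ?thesis by (simp only: sum_delta_p[OF assms(3)])
qed

text \<open>This relation is the source of every shift of \<mu>: a derivative passing E + \<mu>
  turns it into E + \<mu> + 1.\<close>

lemma dd_Emu:
  assumes "holo_on W f" "x \<in> W" "p \<in> {1..CARD('k)}"
  shows "dd p (Emu \<mu> f) x = Emu (\<mu> + 1) (dd p f) x"
  unfolding Emu_def[abs_def] using assms
  by (subst dd_add) (auto simp: dd_E dd_cmult algebra_simps intro!: holo_intros)

lemma dd_U0:
  assumes "holo_on W f" "x \<in> W" "p \<in> {1..CARD('k)}"
  shows "dd p (U0_op f) x = U0_op (dd p f) x + of_nat p * dd p f x"
proof -
  have "dd p (U0_op f) x = U0_op (dd p f) x +
      (\<Sum>h=1..CARD('k). (if p = h then 1 else 0) * (of_nat h * dd h f x))"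
    unfolding U0_op_vf
    by (subst dd_vf[OF _ assms(1,2)], intro holo_intros)
      (simp add: dd_cmult[OF holo_on_sig assms(2)] dd_sig[OF assms(3)] mult_ac)
  then show ?thesis by (simp only: sum_delta_p[OF assms(3)])
qed

text \<open>At \<open>p = k\<close> the factor \<open>k - p\<close> vanishes, which matters since
  \<open>dd (k + 1)\<close> is no derivative along a coordinate of interest.\<close>

lemma dd_Um1:
  assumes "holo_on W f" "x \<in> W" "p \<in> {1..CARD('k)}"
  shows "dd p (Um1_op f) x = Um1_op (dd p f) x + of_nat (CARD('k) - p) * dd (p + 1) f x"
proof -
  have "dd p (Um1_op f) x = Um1_op (dd p f) x +
      (\<Sum>h=1..CARD('k). (if p = h - 1 then 1 else 0) * (of_nat (CARD('k) - (h - 1)) * dd h f x))"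
    unfolding Um1_op_vf
    by (subst dd_vf[OF _ assms(1,2)], intro holo_intros)
      (simp only: dd_cmult[OF holo_on_sig assms(2)] dd_sig[OF assms(3)], simp only: mult_ac)
  also have "(\<Sum>h=1..CARD('k). (if p = h - 1 then 1 else 0) * (of_nat (CARD('k) - (h - 1)) * dd h f x)) =
      (\<Sum>h=1..CARD('k). if h = p + 1 then of_nat (CARD('k) - p) * dd (p + 1) f x else 0)"
    using assms(3) by (intro sum.cong refl) auto
  also have "\<dots> = of_nat (CARD('k) - p) * dd (p + 1) f x"
    using assms(3) by simp
  finally show ?thesis .
qed

text \<open>With \<partial>_0 = -(E + \<mu>) both branches read -p \<partial>_(p-1). For
  \<open>p = 1\<close> the derivative hits the common factor \<sigma>_1 of the coefficients and of
  the constant term, which reproduces E + \<mu>.\<close>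

lemma dd_V:
  assumes f: "holo_on W f" and x: "x \<in> W" and p: "p \<in> {1..CARD('k)}"
  shows "dd p (Vop \<mu> f) x = Vop \<mu> (dd p f) x + (sig 1 x * dd p f x +
    (if p = 1 then Emu \<mu> f x else - of_nat p * dd (p - 1) f x))"
proof -
  let ?c = "\<lambda>h x. sig 1 x * sig h x - of_nat (h + 1) * sig (h + 1) x"
  have c: "holo_on W (?c h)" for h by (intro holo_intros)
  have s: "dd p (?c h) x = (if p = 1 then 1 else 0) * sig h x + sig 1 x * (if p = h then 1 else 0) -
      of_nat (h + 1) * (if p = h + 1 then 1 else 0)" for h
    using p x by (simp add: dd_diff dd_mult dd_const dd_sig holo_intros)
  have "dd p (U1_op f) x = U1_op (dd p f) x + (\<Sum>h=1..CARD('k). ((if p = 1 then 1 else 0) * sig h x +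
     sig 1 x * (if p = h then 1 else 0) - of_nat (h + 1) * (if p = h + 1 then 1 else 0)) * dd h f x)"
    unfolding U1_op_vf using dd_vf[of ?c, OF c f x] by (simp only: s)
  also have "(\<Sum>h=1..CARD('k). ((if p = 1 then 1 else 0) * sig h x +
     sig 1 x * (if p = h then 1 else 0) - of_nat (h + 1) * (if p = h + 1 then 1 else 0)) * dd h f x) =
     (\<Sum>h=1..CARD('k). (if p = 1 then 1 else 0) * (sig h x * dd h f x)) +
     (\<Sum>h=1..CARD('k). (if p = h then 1 else 0) * (sig 1 x * dd h f x)) -
     (\<Sum>h=1..CARD('k). if h = p - 1 then of_nat p * dd (p - 1) f x else 0)"
    unfolding sum.distrib[symmetric] sum_subtractf[symmetric]
    by (intro sum.cong refl) (auto simp: algebra_simps)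
  also have "(\<Sum>h=1..CARD('k). (if p = 1 then 1 else 0) * (sig h x * dd h f x)) =
      (if p = 1 then 1 else 0) * E_op f x" by (simp add: E_op_def)
  also have "(\<Sum>h=1..CARD('k). (if p = h then 1 else 0) * (sig 1 x * dd h f x)) = sig 1 x * dd p f x"
    by (rule sum_delta_p[OF p])
  also have "(\<Sum>h=1..CARD('k). if h = p - 1 then of_nat p * dd (p - 1) f x else 0) =
     (if p = 1 then 0 else of_nat p * dd (p - 1) f x)"
    using p by auto
  finally have U: "dd p (U1_op f) x = U1_op (dd p f) x + ((if p = 1 then 1 else 0) * E_op f x +
     sig 1 x * dd p f x - (if p = 1 then 0 else of_nat p * dd (p - 1) f x))" .
  have "dd p (Vop \<mu> f) x = dd p (U1_op f) x + \<mu> * ((if p = 1 then 1 else 0) * f x + sig 1 x * dd p f x)"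
    unfolding Vop_def[abs_def] U1_op_vf mult.assoc
    using x f p by (simp add: dd_add dd_cmult dd_mult dd_sig holo_intros)
  then show ?thesis unfolding U by (auto simp: Vop_def Emu_def algebra_simps)
qed

text \<open>E commutes with vector fields whose coefficients are linear. The only other term of
  U_(-1) is k \<partial>_1, which stems from \<sigma>_0 = 1 and has degree -1.\<close>

lemma E_Um1:
  assumes f: "holo_on W f" and x: "x \<in> W"
  shows "E_op (Um1_op f) x = Um1_op (E_op f) x - of_nat CARD('k) * dd 1 f x"
proof -
  let ?c = "\<lambda>h x :: 'k base. of_nat (CARD('k) - (h - 1)) * sig (h - 1) x"
  have "E_op (Um1_op f) x = Um1_op (E_op f) x + vf (\<lambda>h y. vf sig (?c h) y - vf ?c (sig h) y) f x"
    unfolding Um1_op_vf E_op_vf by (rule vf_vf[OF _ _ f x]) (intro holo_intros)+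
  also have "vf (\<lambda>h y. vf sig (?c h) y - vf ?c (sig h) y) f x =
     (\<Sum>h=1..CARD('k). if h = 1 then - of_nat CARD('k) * dd 1 f x else 0)"
    unfolding vf_def[of _ f]
    by (intro sum.cong refl) (auto simp: vf_cmult[OF holo_on_sig x] vf_sig)
  also have "\<dots> = - of_nat CARD('k) * dd 1 f x"
    by simp
  finally show ?thesis by simp
qed

lemma E_U0:
  assumes f: "holo_on W f" and x: "x \<in> W"
  shows "E_op (U0_op f) x = U0_op (E_op f) x"
proof -
  let ?c = "\<lambda>h x :: 'k base. of_nat h * sig h x"
  have "E_op (U0_op f) x = U0_op (E_op f) x + vf (\<lambda>h y. vf sig (?c h) y - vf ?c (sig h) y) f x"
    unfolding U0_op_vf E_op_vf by (rule vf_vf[OF _ _ f x]) (intro holo_intros)+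
  also have "vf (\<lambda>h y. vf sig (?c h) y - vf ?c (sig h) y) f x = 0"
    unfolding vf_def[of _ f]
    by (intro sum.neutral ballI) (auto simp: vf_cmult[OF holo_on_sig x] vf_sig)
  finally show ?thesis by simp
qed

text \<open>U_1 + \<mu> \<sigma>_1 is \<sigma>_1 (E + \<mu>) plus a vector field with linear
  coefficients. The latter commutes with E, and the factor \<sigma>_1 has degree one.\<close>

lemma Emu_V:
  assumes f: "holo_on W f" and x: "x \<in> W"
  shows "Emu \<mu> (Vop \<mu> f) x = Vop \<mu> (Emu \<mu> f) x + sig 1 x * Emu \<mu> f x"
proof -
  let ?c = "\<lambda>h x :: 'k base. sig 1 x * sig h x - of_nat (h + 1) * sig (h + 1) x"
  have 1: "1 \<in> {1..CARD('k)}" by simp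
  have "E_op (U1_op f) x = U1_op (E_op f) x + vf (\<lambda>h y. vf sig (?c h) y - vf ?c (sig h) y) f x"
    unfolding U1_op_vf E_op_vf by (rule vf_vf[OF _ _ f x]) (intro holo_intros)+
  also have "vf (\<lambda>h y. vf sig (?c h) y - vf ?c (sig h) y) f x = (\<Sum>h=1..CARD('k). sig 1 x * sig h x * dd h f x)"
    unfolding vf_def[of _ f]
  proof (intro sum.cong refl)
    fix h assume h: "h \<in> {1..CARD('k)}"
    have h1: "holo_on W (\<lambda>x. sig 1 x * sig h x)" and h2: "holo_on W (\<lambda>x. of_nat (h + 1) * sig (h + 1) x)"
      by (intro holo_intros)+
    have "vf sig (?c h) x - vf ?c (sig h) x = sig 1 x * sig h x"
      unfolding vf_diff[OF h1 h2 x] vf_mult[OF holo_on_sig holo_on_sig x] vf_cmult[OF holo_on_sig x] vf_sig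
      using h by (auto simp: algebra_simps)
    then show "(vf sig (?c h) x - vf ?c (sig h) x) * dd h f x = sig 1 x * sig h x * dd h f x" by simp
  qed
  also have "\<dots> = sig 1 x * E_op f x" by (simp add: E_op_def sum_distrib_left mult_ac)
  finally have EU: "E_op (U1_op f) x = U1_op (E_op f) x + sig 1 x * E_op f x" .
  have hU: "holo_on W (U1_op f)" unfolding U1_op_vf by (intro holo_intros f)
  have "Emu \<mu> (Vop \<mu> f) x = E_op (U1_op f) x + \<mu> * (sig 1 x * f x + sig 1 x * E_op f x) + \<mu> * Vop \<mu> f x"
    unfolding Emu_def Vop_def[abs_def] mult.assoc
    using f x hU 1 by (simp add: E_op_vf vf_add vf_cmult vf_mult vf_sig holo_intros)
  moreover have "Vop \<mu> (Emu \<mu> f) x = U1_op (E_op f) x + \<mu> * U1_op f x + \<mu> * sig 1 x * Emu \<mu> f x"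
    unfolding Emu_def[abs_def] Vop_def
    using f x by (simp add: U1_op_vf vf_add vf_cmult holo_intros)
  ultimately show ?thesis unfolding EU by (simp add: Emu_def Vop_def algebra_simps)
qed

text \<open>The commutator \<open>R p\<close> is kept abstract and is differentiated in turn: for
  \<open>Vop\<close> it has non-constant coefficients, so the two derivatives do not contribute
  independently.\<close>

lemma dd_dd_commutator:
  assumes L: "\<And>g p y. holo_on W g \<Longrightarrow> p \<in> {1..CARD('k)} \<Longrightarrow> y \<in> W \<Longrightarrow> dd p (L g) y = L (dd p g) y + R p g y"
    and hL: "\<And>g. holo_on W g \<Longrightarrow> holo_on W (L g)" and hR: "\<And>g p. holo_on W g \<Longrightarrow> holo_on W (R p g)"
    and f: "holo_on W f" and x: "x \<in> W" and pq: "p \<in> {1..CARD('k)}" "q \<in> {1..CARD('k)}"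
  shows "dd p (dd q (L f)) x = L (dd p (dd q f)) x + R p (dd q f) x + dd p (R q f) x"
proof -
  have "dd p (dd q (L f)) x = dd p (\<lambda>y. L (dd q f) y + R q f y) x"
    by (rule dd_cong[OF x]) (rule L[OF f pq(2)])
  also have "\<dots> = dd p (L (dd q f)) x + dd p (R q f) x"
    by (intro dd_add x hL hR holo_on_dd f)
  finally show ?thesis using L[OF holo_on_dd[OF f] pq(1) x] by simp
qed

end


subsection \<open>Right multiplication and the ideals\<close>

definition gens :: "complex \<Rightarrow> 'k::{finite,linorder} diffop set" where
  "gens \<mu> = {A_op p q | p q. p \<in> {1..CARD('k) - 1} \<and> q \<in> {2..CARD('k)}} \<union>
      {T_op \<mu> m | m. m \<in> {2..CARD('k)}}"

lemma I_sheaf_gens: "I_sheaf \<mu> = left_ideal (gens \<mu>)"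
  by (simp add: I_sheaf_def gens_def fun_eq_iff)

lemma T_op_Emu: "T_op \<mu> m f x = dd 1 (dd (m - 1) f) x + dd m (Emu \<mu> f) x"
  by (simp add: T_op_def Emu_def[abs_def])

lemma finite_gens: "finite (gens \<mu> :: 'k::{finite,linorder} diffop set)"
  unfolding gens_def
  by (intro finite_UnI finite_image_set[of "\<lambda>m. m \<in> {2..CARD('k)}"]
      finite_image_set2[of "\<lambda>p. p \<in> {1..CARD('k) - 1}" "\<lambda>q. q \<in> {2..CARD('k)}"]) auto

lemma D_sections_dd: "open U \<Longrightarrow> P \<in> D_sections U \<Longrightarrow> (\<lambda>f. dd h (P f)) \<in> D_sections U"
  unfolding dd_def by (rule D_sections_pd)

lemma D_sections_cmult: "P \<in> D_sections U \<Longrightarrow> (\<lambda>f x. c * P f x) \<in> D_sections U"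
  by (rule D_sections_mult[OF _ holo_on_const])

lemma D_sections_vf:
  assumes "open U" "\<And>h. holo_on U (c h)" shows "vf c \<in> D_sections U"
proof -
  have "(\<lambda>f x. \<Sum>h=1..CARD('a). c h x * dd h f x) \<in> D_sections U"
    by (intro D_sections_sum D_sections_mult assms D_sections_dd D_sections_id)
  then show ?thesis by (simp add: vf_def[abs_def])
qed

lemma D_sections_Emu: "open U \<Longrightarrow> Emu \<mu> \<in> D_sections U"
  unfolding Emu_def[abs_def] E_op_vf
  by (intro D_sections_add D_sections_cmult D_sections_id D_sections_vf holo_on_sig)

lemma D_sections_Um1: "open U \<Longrightarrow> Um1_op \<in> D_sections U"
  unfolding Um1_op_vf by (intro D_sections_vf holo_intros)

lemma D_sections_U0: "open U \<Longrightarrow> U0_op \<in> D_sections U"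
  unfolding U0_op_vf by (intro D_sections_vf holo_intros)

lemma D_sections_V: "open U \<Longrightarrow> Vop \<mu> \<in> D_sections U"
  unfolding Vop_def[abs_def] U1_op_vf
  by (intro D_sections_vf holo_intros D_sections_add D_sections_mult D_sections_id)

lemma D_sections_gens: "gens \<mu> \<subseteq> D_sections UNIV"
proof -
  have A: "A_op p q \<in> D_sections UNIV" for p q
  proof (rule D_sections_cong)
    show "(\<lambda>f x. dd p (dd q f) x + (- 1) * dd (p + 1) (dd (q - 1) f) x) \<in> D_sections UNIV"
      by (intro D_sections_add D_sections_cmult D_sections_dd D_sections_id) auto
  qed (simp add: A_op_def)
  have T: "T_op \<mu> m \<in> D_sections UNIV" for m
  proof (rule D_sections_cong)
    show "(\<lambda>f x. dd 1 (dd (m - 1) f) x + dd m (Emu \<mu> f) x) \<in> D_sections UNIV"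
      by (intro D_sections_add D_sections_dd D_sections_id D_sections_Emu) auto
  qed (simp add: T_op_Emu)
  show ?thesis using A T by (auto simp: gens_def)
qed

lemma in_left_ideal_cong:
  fixes H :: "'k::{finite,linorder} diffop" and S :: "'k diffop set"
  assumes "in_left_ideal S P"
    and "\<And>W f y. open W \<Longrightarrow> holo_on W f \<Longrightarrow> y \<in> W \<Longrightarrow> H f y = P f y"
  shows "in_left_ideal S H"
proof -
  obtain B where B: "\<forall>G\<in>S. B G \<in> D_sections UNIV"
    "\<And>W f y. open W \<Longrightarrow> holo_on W f \<Longrightarrow> y \<in> W \<Longrightarrow> P f y = (\<Sum>G\<in>S. B G (G f) y)"
    using assms(1) unfolding in_left_ideal_def by blast
  show ?thesis
    unfolding in_left_ideal_def by (rule exI[of _ B]) (use B in \<open>simp add: assms(2)\<close>)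
qed

text \<open>Membership of \<open>G\<close> is required for nonzero \<open>c\<close> only. At the
  ends of the index ranges the commutation relations contain operators outside the list of
  generators, always with coefficient zero.\<close>

lemma in_left_ideal_scale:
  fixes G :: "'k::{finite,linorder} diffop"
  assumes "finite S" "c \<noteq> 0 \<Longrightarrow> G \<in> S"
  shows "in_left_ideal S (\<lambda>f x. c * G f x)"
proof (cases "c = 0")
  case True
  then show ?thesis
    unfolding in_left_ideal_def by (intro exI[of _ "\<lambda>_ _ _. 0"]) (auto intro: D_sections_zero)
next
  case False
  show ?thesis
    by (rule in_left_ideal_gen[OF assms(1) assms(2)[OF False] D_sections_cmult[OF D_sections_id, of UNIV c]]) auto
qed

lemma in_left_ideal_left:
  fixes G :: "'k::{finite,linorder} diffop"
  assumes "finite S" "G \<in> S" "Q \<in> D_sections UNIV"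
  shows "in_left_ideal S (\<lambda>f. Q (G f))"
  by (rule in_left_ideal_gen[OF assms]) auto

lemma A_in_gens: "p \<in> {1..CARD('k) - 1} \<Longrightarrow> q \<in> {2..CARD('k)} \<Longrightarrow> (A_op p q :: 'k::{finite,linorder} diffop) \<in> gens \<mu>"
  by (auto simp: gens_def)

lemma T_in_gens: "m \<in> {2..CARD('k)} \<Longrightarrow> (T_op \<mu> m :: 'k::{finite,linorder} diffop) \<in> gens \<mu>"
  by (auto simp: gens_def)

lemma gens_cases:
  fixes G :: "'k::{finite,linorder} diffop"
  assumes "G \<in> gens \<mu>"
  obtains (A) p q where "p \<in> {1..CARD('k) - 1}" "q \<in> {2..CARD('k)}" "G = A_op p q"
    | (T) m where "m \<in> {2..CARD('k)}" "G = T_op \<mu> m"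
  using assms unfolding gens_def by blast

lemma dd_commute3:
  assumes *: "open W" "holo_on W f" and y: "y \<in> W"
  shows "dd a (dd b (dd h f)) y = dd h (dd a (dd b f)) y"
proof -
  have "dd a (dd b (dd h f)) y = dd a (dd h (dd b f)) y"
    by (rule dd_cong[OF *(1) y]) (rule dd_commute[OF *])
  also have "\<dots> = dd h (dd a (dd b f)) y"
    by (rule dd_commute[OF *(1) holo_on_dd[OF *] y])
  finally show ?thesis .
qed

text \<open>\<open>dd h\<close> simply passes through: by \<open>dd_Emu\<close>, a generator for
  \<mu> + 1 followed on the right by \<open>dd h\<close> is \<open>dd h\<close> times the generator
  of the same index for \<mu>.\<close>

lemma gens_dd:
  fixes G :: "'k::{finite,linorder} diffop"
  assumes h: "h \<in> {1..CARD('k)}" and "G \<in> gens (\<mu> + 1)"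
  shows "in_left_ideal (gens \<mu>) (G \<circ> dd h)"
  using assms(2)
proof (cases rule: gens_cases)
  case (A p q)
  show ?thesis
  proof (rule in_left_ideal_cong[OF in_left_ideal_left[OF finite_gens A_in_gens[OF A(1,2)] D_sections_dd[OF _ D_sections_id]]])
    fix W :: "'k base set" and f y assume *: "open W" "holo_on W f" and y: "y \<in> W"
    note c = dd_commute[OF *(1)] and hd = holo_on_dd[OF *(1)]
    have "dd a (dd b (dd h f)) y = dd h (dd a (dd b f)) y" for a b
      by (rule dd_commute3[OF * y])
    then show "(G \<circ> dd h) f y = dd h (A_op p q f) y"
      unfolding A A_op_def[abs_def] by (simp add: dd_diff[OF *(1)] hd *(2) y)
  qed auto
next
  case (T m)
  show ?thesis
  proof (rule in_left_ideal_cong[OF in_left_ideal_left[OF finite_gens T_in_gens[OF T(1)] D_sections_dd[OF _ D_sections_id]]])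
    fix W :: "'k base set" and f y assume *: "open W" "holo_on W f" and y: "y \<in> W"
    note c = dd_commute[OF *(1)] and hd = holo_on_dd[OF *(1)] and hE = holo_on_Emu[OF *(1)]
    have 1: "dd a (dd b (dd h f)) y = dd h (dd a (dd b f)) y" for a b
      by (rule dd_commute3[OF * y])
    have "dd m (Emu (\<mu> + 1) (dd h f)) y = dd m (dd h (Emu \<mu> f)) y"
      by (rule dd_cong[OF *(1) y]) (simp add: dd_Emu[OF *(1,2) _ h])
    then have 2: "dd m (Emu (\<mu> + 1) (dd h f)) y = dd h (dd m (Emu \<mu> f)) y"
      by (simp add: c[OF hE[OF *(2)] y])
    show "(G \<circ> dd h) f y = dd h (T_op \<mu> m f) y"
      unfolding T comp_apply T_op_Emu[abs_def] dd_add[OF *(1) hd[OF hd[OF *(2)]] hd[OF hE[OF *(2)]] y] 1 2 ..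
  qed auto
qed

lemma Emu_diff:
  assumes "open W" "holo_on W f" "holo_on W g" "x \<in> W"
  shows "Emu \<mu> (\<lambda>x. f x - g x) x = Emu \<mu> f x - Emu \<mu> g x"
  unfolding Emu_def E_op_vf by (simp add: vf_diff[OF assms] algebra_simps)

lemma Emu_add:
  assumes "open W" "holo_on W f" "holo_on W g" "x \<in> W"
  shows "Emu \<mu> (\<lambda>x. f x + g x) x = Emu \<mu> f x + Emu \<mu> g x"
  unfolding Emu_def E_op_vf by (simp add: vf_add[OF assms] algebra_simps)

lemma dd_dd_Emu:
  fixes f :: "'k::{finite,linorder} base \<Rightarrow> complex"
  assumes *: "open W" "holo_on W f" and y: "y \<in> W" and a: "a \<in> {1..CARD('k)}" and b: "b \<in> {1..CARD('k)}"
  shows "dd a (dd b (Emu \<mu> f)) y = Emu (\<mu> + 2) (dd a (dd b f)) y"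
proof -
  have "dd a (dd b (Emu \<mu> f)) y = dd a (Emu (\<mu> + 1) (dd b f)) y"
    by (rule dd_cong[OF *(1) y]) (rule dd_Emu[OF * _ b])
  also have "\<dots> = Emu (\<mu> + 1 + 1) (dd a (dd b f)) y"
    by (rule dd_Emu[OF *(1) holo_on_dd[OF *] y a])
  finally show ?thesis by (simp add: add.assoc)
qed

text \<open>Two derivatives passing E + \<mu> turn it into E + \<mu> + 2, uniformly in all terms of
  a generator. In the E-term of T one of the two steps is the replacement of \<mu> by \<mu> + 1 in
  the generator.\<close>

lemma gens_Emu:
  fixes G :: "'k::{finite,linorder} diffop"
  assumes "G \<in> gens (\<mu> + 1)"
  shows "in_left_ideal (gens \<mu>) (G \<circ> Emu \<mu>)"
  using assms
proof (cases rule: gens_cases)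
  case (A p q)
  show ?thesis
  proof (rule in_left_ideal_cong[OF in_left_ideal_left[OF finite_gens A_in_gens[OF A(1,2)] D_sections_Emu]])
    fix W :: "'k base set" and f y assume *: "open W" "holo_on W f" and y: "y \<in> W"
    note hd = holo_on_dd[OF *(1)]
    have i: "p \<in> {1..CARD('k)}" "q \<in> {1..CARD('k)}" "p + 1 \<in> {1..CARD('k)}" "q - 1 \<in> {1..CARD('k)}" using A by auto
    show "(G \<circ> Emu \<mu>) f y = Emu (\<mu> + 2) (A_op p q f) y"
      unfolding A A_op_def[abs_def] comp_apply Emu_diff[OF *(1) hd[OF hd[OF *(2)]] hd[OF hd[OF *(2)]] y]
      unfolding dd_dd_Emu[OF * y i(1,2)] dd_dd_Emu[OF * y i(3,4)] ..
  qed auto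
next
  case (T m)
  show ?thesis
  proof (rule in_left_ideal_cong[OF in_left_ideal_left[OF finite_gens T_in_gens[OF T(1)] D_sections_Emu]])
    fix W :: "'k base set" and f y assume *: "open W" "holo_on W f" and y: "y \<in> W"
    note hd = holo_on_dd[OF *(1)] and hE = holo_on_Emu[OF *(1)]
    have i: "1 \<in> {1..CARD('k)}" "m \<in> {1..CARD('k)}" "m - 1 \<in> {1..CARD('k)}" using T by auto
    have E: "dd m (Emu (\<mu> + 1) (Emu \<mu> f)) y = Emu (\<mu> + 2) (dd m (Emu \<mu> f)) y"
      using dd_Emu[OF *(1) hE[OF *(2)] y i(2), of "\<mu> + 1"] by (simp add: add.assoc)
    show "(G \<circ> Emu \<mu>) f y = Emu (\<mu> + 2) (T_op \<mu> m f) y"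
      unfolding T T_op_Emu[abs_def] comp_apply Emu_add[OF *(1) hd[OF hd[OF *(2)]] hd[OF hE[OF *(2)]] y] E
      unfolding dd_dd_Emu[OF * y i(1,3)] ..
  qed auto
qed

text \<open>U_0 is the Euler field that gives \<sigma>_h the weight h. The generators are
  homogeneous, A_(p,q) of weight p + q and T^m of weight m, so each commutator is a multiple of the
  generator.\<close>

lemma gens_U0:
  fixes G :: "'k::{finite,linorder} diffop"
  assumes "G \<in> gens \<mu>"
  shows "in_left_ideal (gens \<mu>) (G \<circ> U0_op)"
  using assms
proof -
  have dd2: "dd a (dd b (U0_op f)) y = U0_op (dd a (dd b f)) y + of_nat (a + b) * dd a (dd b f) y"
    if "open W" "holo_on W f" "y \<in> W" "a \<in> {1..CARD('k)}" "b \<in> {1..CARD('k)}"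
    for a b and W :: "'k base set" and f y
    by (subst dd_dd_commutator[OF that(1) dd_U0[OF that(1)] holo_on_U0[OF that(1)] _ that(2-5)])
      (use that in \<open>auto simp: holo_intros holo_on_dd dd_cmult algebra_simps\<close>)
  have D: "(\<lambda>f x. U0_op f x + c * f x) \<in> D_sections (UNIV :: 'k base set)" for c
    by (intro D_sections_add D_sections_cmult D_sections_U0 D_sections_id) auto
  show ?thesis using assms
  proof (cases rule: gens_cases)
    case (A p q)
    show ?thesis
    proof (rule in_left_ideal_cong[OF in_left_ideal_left[OF finite_gens A_in_gens[OF A(1,2)] D]])
      fix W :: "'k base set" and f y assume *: "open W" "holo_on W f" and y: "y \<in> W"
      note hd = holo_on_dd[OF *(1)]
      have i: "p \<in> {1..CARD('k)}" "q \<in> {1..CARD('k)}" "p + 1 \<in> {1..CARD('k)}" "q - 1 \<in> {1..CARD('k)}" using A by auto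
      have e: "p + 1 + (q - 1) = p + q" using A by auto
      show "(G \<circ> U0_op) f y = U0_op (A_op p q f) y + of_nat (p + q) * A_op p q f y"
        unfolding A A_op_def[abs_def] comp_apply dd2[OF * y i(1,2)] dd2[OF * y i(3,4)] e
        unfolding U0_op_vf vf_diff[OF *(1) hd[OF hd[OF *(2)]] hd[OF hd[OF *(2)]] y]
        by (simp add: algebra_simps)
    qed
  next
    case (T m)
    show ?thesis
    proof (rule in_left_ideal_cong[OF in_left_ideal_left[OF finite_gens T_in_gens[OF T(1)] D]])
      fix W :: "'k base set" and f y assume *: "open W" "holo_on W f" and y: "y \<in> W"
      note hd = holo_on_dd[OF *(1)] and hE = holo_on_Emu[OF *(1)]
      have i: "1 \<in> {1..CARD('k)}" "m \<in> {1..CARD('k)}" "m - 1 \<in> {1..CARD('k)}" using T by auto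
      have e: "1 + (m - 1) = m" using T by auto
      have "dd m (Emu \<mu> (U0_op f)) y = dd m (U0_op (Emu \<mu> f)) y"
      proof (rule dd_cong[OF *(1) y])
        fix x assume x: "x \<in> W"
        have "U0_op (Emu \<mu> f) x = U0_op (E_op f) x + \<mu> * U0_op f x"
          unfolding Emu_def[abs_def] U0_op_vf
          by (subst vf_add[OF *(1) _ _ x]) (auto simp: vf_cmult[OF * x] holo_intros * holo_on_E[OF *])
        then show "Emu \<mu> (U0_op f) x = U0_op (Emu \<mu> f) x" by (simp add: Emu_def E_U0[OF * x])
      qed
      then have E: "dd m (Emu \<mu> (U0_op f)) y = U0_op (dd m (Emu \<mu> f)) y + of_nat m * dd m (Emu \<mu> f) y"
        by (simp add: dd_U0[OF *(1) hE[OF *(2)] y i(2)])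
      show "(G \<circ> U0_op) f y = U0_op (T_op \<mu> m f) y + of_nat m * T_op \<mu> m f y"
        unfolding T T_op_Emu[abs_def] comp_apply dd2[OF * y i(1,3)] e E
        unfolding U0_op_vf vf_add[OF *(1) hd[OF hd[OF *(2)]] hd[OF hE[OF *(2)]] y]
        by (simp add: algebra_simps)
    qed
  qed
qed

text \<open>Commuting with U_(-1) raises an index: A_(p,q) yields (k-p-1) A_(p+1,q) + (k-q)
  A_(p,q+1), and T^m yields (k-m) T^(m+1) - (k-1) A_(1,m). Where an index would leave its range the
  coefficient is zero.\<close>

lemma gens_Um1:
  fixes G :: "'k::{finite,linorder} diffop"
  assumes "G \<in> gens \<mu>"
  shows "in_left_ideal (gens \<mu>) (G \<circ> Um1_op)"
proof -
  have dd2: "dd a (dd b (Um1_op f)) y = Um1_op (dd a (dd b f)) y + of_nat (CARD('k) - a) * dd (a + 1) (dd b f) y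
      + of_nat (CARD('k) - b) * dd a (dd (b + 1) f) y"
    if "open W" "holo_on W f" "y \<in> W" "a \<in> {1..CARD('k)}" "b \<in> {1..CARD('k)}"
    for a b and W :: "'k base set" and f y
    by (subst dd_dd_commutator[OF that(1) dd_Um1[OF that(1)] holo_on_Um1[OF that(1)] _ that(2-5)])
      (use that in \<open>auto simp: holo_intros holo_on_dd dd_cmult simp del: of_nat_diff\<close>)
  have D: "Um1_op \<in> D_sections (UNIV :: 'k base set)"
    by (intro D_sections_Um1) auto
  let ?k = "of_nat CARD('k) :: complex"
  show ?thesis using assms
  proof (cases rule: gens_cases)
    case (A p q)
    have Ain: "in_left_ideal (gens \<mu>) (\<lambda>f. Um1_op (A_op p q f :: 'k base \<Rightarrow> complex))"
      by (rule in_left_ideal_left[OF finite_gens A_in_gens[OF A(1,2)] D])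
    have B: "in_left_ideal (gens \<mu>) (\<lambda>(f :: 'k base \<Rightarrow> complex) x. of_nat (CARD('k) - p - 1) * A_op (p + 1) q f x)"
      by (rule in_left_ideal_scale[OF finite_gens A_in_gens]) (use A in auto)
    have C: "in_left_ideal (gens \<mu>) (\<lambda>(f :: 'k base \<Rightarrow> complex) x. of_nat (CARD('k) - q) * A_op p (q + 1) f x)"
      by (rule in_left_ideal_scale[OF finite_gens A_in_gens]) (use A in auto)
    show ?thesis
    proof (rule in_left_ideal_add[OF in_left_ideal_add[OF Ain B refl] C])
      fix W :: "'k base set" and f y assume *: "open W" "holo_on W f" and y: "y \<in> W"
      note hd = holo_on_dd[OF *(1)]
      have i: "p \<in> {1..CARD('k)}" "q \<in> {1..CARD('k)}" "p + 1 \<in> {1..CARD('k)}" "q - 1 \<in> {1..CARD('k)}" using A by auto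
      have e: "q - 1 + 1 = q" "q + 1 - 1 = q" using A by auto
      have k: "of_nat (CARD('k) - p) = ?k - of_nat p" "of_nat (CARD('k) - q) = ?k - of_nat q"
        "of_nat (CARD('k) - p - 1) = ?k - of_nat p - 1" "of_nat (CARD('k) - (p + 1)) = ?k - of_nat p - 1"
        "of_nat (CARD('k) - (q - 1)) = ?k - of_nat q + 1"
        using A by (auto simp: of_nat_diff)
      show "(G \<circ> Um1_op) f y = Um1_op (A_op p q f) y + of_nat (CARD('k) - p - 1) * A_op (p + 1) q f y
          + of_nat (CARD('k) - q) * A_op p (q + 1) f y"
        unfolding A A_op_def[abs_def] comp_apply dd2[OF * y i(1,2)] dd2[OF * y i(3,4)] e k
        unfolding Um1_op_vf vf_diff[OF *(1) hd[OF hd[OF *(2)]] hd[OF hd[OF *(2)]] y]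
        by (simp add: algebra_simps)
    qed
  next
    case (T m)
    have Tin: "in_left_ideal (gens \<mu>) (\<lambda>f. Um1_op (T_op \<mu> m f :: 'k base \<Rightarrow> complex))"
      by (rule in_left_ideal_left[OF finite_gens T_in_gens[OF T(1)] D])
    have B: "in_left_ideal (gens \<mu>) (\<lambda>(f :: 'k base \<Rightarrow> complex) x. of_nat (CARD('k) - m) * T_op \<mu> (m + 1) f x)"
      by (rule in_left_ideal_scale[OF finite_gens T_in_gens]) (use T in auto)
    have C: "in_left_ideal (gens \<mu>) (\<lambda>(f :: 'k base \<Rightarrow> complex) x. - of_nat (CARD('k) - 1) * A_op 1 m f x)"
      by (rule in_left_ideal_scale[OF finite_gens A_in_gens]) (use T in auto)
    show ?thesis
    proof (rule in_left_ideal_add[OF in_left_ideal_add[OF Tin B refl] C])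
      fix W :: "'k base set" and f y assume *: "open W" "holo_on W f" and y: "y \<in> W"
      note hd = holo_on_dd[OF *(1)] and hE = holo_on_Emu[OF *(1)]
      have i: "1 \<in> {1..CARD('k)}" "m \<in> {1..CARD('k)}" "m - 1 \<in> {1..CARD('k)}" using T by auto
      have e: "m - 1 + 1 = m" "m + 1 - 1 = m" using T by auto
      have k: "of_nat (CARD('k) - m) = ?k - of_nat m" "of_nat (CARD('k) - 1) = ?k - 1"
        "of_nat (CARD('k) - (m - 1)) = ?k - of_nat m + 1"
        using T by (auto simp: of_nat_diff)
      have "dd m (Emu \<mu> (Um1_op f)) y = dd m (\<lambda>x. Um1_op (Emu \<mu> f) x - ?k * dd 1 f x) y"
      proof (rule dd_cong[OF *(1) y])
        fix x assume x: "x \<in> W"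
        have "Um1_op (Emu \<mu> f) x = Um1_op (E_op f) x + \<mu> * Um1_op f x"
          unfolding Emu_def[abs_def] Um1_op_vf
          by (subst vf_add[OF *(1) _ _ x]) (auto simp: vf_cmult[OF * x] holo_intros * holo_on_E[OF *])
        then show "Emu \<mu> (Um1_op f) x = Um1_op (Emu \<mu> f) x - ?k * dd 1 f x" by (simp add: Emu_def E_Um1[OF * x])
      qed
      also have "\<dots> = dd m (Um1_op (Emu \<mu> f)) y - ?k * dd m (dd 1 f) y"
        by (subst dd_diff[OF *(1) _ _ y]) (auto simp: dd_cmult[OF *(1) _ y] hd * holo_intros holo_on_Um1 hE)
      finally have E: "dd m (Emu \<mu> (Um1_op f)) y = Um1_op (dd m (Emu \<mu> f)) y +
          (?k - of_nat m) * dd (m + 1) (Emu \<mu> f) y - ?k * dd 1 (dd m f) y"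
        by (simp only: dd_Um1[OF *(1) hE[OF *(2)] y i(2)] k dd_commute[OF *(1,2) y, of m 1])
      show "(G \<circ> Um1_op) f y = Um1_op (T_op \<mu> m f) y + of_nat (CARD('k) - m) * T_op \<mu> (m + 1) f y
          + - of_nat (CARD('k) - 1) * A_op 1 m f y"
        unfolding T A_op_def T_op_Emu[abs_def] comp_apply dd2[OF * y i(1,3)] e E k
        unfolding Um1_op_vf vf_add[OF *(1) hd[OF hd[OF *(2)]] hd[OF hE[OF *(2)]] y]
        by (simp add: algebra_simps)
    qed
  qed
qed

lemma gens_V:
  fixes G :: "'k::{finite,linorder} diffop"
  assumes "G \<in> gens \<mu>"
  shows "in_left_ideal (gens \<mu>) (G \<circ> Vop \<mu>)"
proof -
  \<comment> \<open>\<open>M a b\<close> is \<open>\<partial>\<^sub>a \<partial>\<^sub>b\<^sub>-\<^sub>1\<close>, where \<open>\<partial>\<^sub>0 = - (E + \<mu>)\<close>; note that \<open>dd 0\<close> itself is \<open>dd 1\<close>.\<close>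
  define M where "M a b f = (if b = 1 then (\<lambda>y. - dd a (Emu \<mu> f) y) else dd a (dd (b - 1) f))"
    for a b and f :: "'k base \<Rightarrow> complex"
  have dd2: "dd a (dd b (Vop \<mu> f)) y = Vop \<mu> (dd a (dd b f)) y + 2 * sig 1 y * dd a (dd b f) y
      - of_nat a * M b a f y - of_nat b * M a b f y"
    if *: "open W" "holo_on W f" and y: "y \<in> W" and a: "a \<in> {1..CARD('k)}" and b: "b \<in> {1..CARD('k)}"
    for a b and W :: "'k base set" and f y
  proof -
    let ?N = "\<lambda>p g y. if p = 1 then Emu \<mu> g y else - of_nat p * dd (p - 1) g y"
    let ?R = "\<lambda>p g y. sig 1 y * dd p g y + ?N p g y"
    note hd = holo_on_dd[OF *(1)] and hE = holo_on_Emu[OF *(1)]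
    have hN: "holo_on W (?N p g)" if "holo_on W g" for p g
      by (cases "p = 1") (auto intro!: holo_intros hd hE that)
    have hR: "holo_on W (?R p g)" if "holo_on W g" for p g
      by (intro holo_on_add holo_on_mult holo_on_sig hd that hN)
    have 1: "dd a (dd b (Vop \<mu> f)) y = Vop \<mu> (dd a (dd b f)) y + ?R a (dd b f) y + dd a (?R b f) y"
      by (rule dd_dd_commutator[OF *(1) dd_V[OF *(1)] holo_on_V[OF *(1)] hR *(2) y a b])
    have 2: "dd a (?R b f) y = (if a = 1 then 1 else 0) * dd b f y + sig 1 y * dd a (dd b f) y + dd a (?N b f) y"
      using a by (simp only: dd_add[OF *(1) holo_on_mult[OF holo_on_sig hd[OF *(2)]] hN[OF *(2)] y]
         dd_mult[OF *(1) holo_on_sig hd[OF *(2)] y] dd_sig)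
    have 3: "dd a (?N b f) y = - of_nat b * M a b f y"
      using dd_cmult[OF *(1) hd[OF *(2)] y, of a "- of_nat b" "b - 1"] dd_cmult[OF *(1) hE[OF *(2)] y, of a "- 1" \<mu>]
      by (cases "b = 1") (simp_all add: M_def)
    have 4: "?N a (dd b f) y = - of_nat a * M b a f y - (if a = 1 then 1 else 0) * dd b f y"
      using dd_Emu[OF * y b] dd_commute[OF * y, of "a - 1" b]
      by (cases "a = 1") (simp_all add: M_def Emu_def algebra_simps)
    show ?thesis unfolding 1 2 3 4 by (simp add: algebra_simps)
  qed
  have D: "(\<lambda>f x. Vop \<mu> f x + 2 * sig 1 x * f x) \<in> D_sections (UNIV :: 'k base set)"
    by (intro D_sections_add D_sections_mult D_sections_V D_sections_id holo_intros) auto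
  have V_add: "Vop \<mu> (\<lambda>x. f x + g x) y = Vop \<mu> f y + Vop \<mu> g y"
    and V_diff: "Vop \<mu> (\<lambda>x. f x - g x) y = Vop \<mu> f y - Vop \<mu> g y"
    if "open W" "holo_on W f" "holo_on W g" "y \<in> W" for f g and y :: "'k base" and W
    unfolding Vop_def U1_op_vf by (simp_all add: vf_add[OF that] vf_diff[OF that] algebra_simps)
  show ?thesis using assms
  proof (cases rule: gens_cases)
    case (A p q)
    have Ain: "in_left_ideal (gens \<mu>) (\<lambda>(f :: 'k base \<Rightarrow> complex) x. Vop \<mu> (A_op p q f) x + 2 * sig 1 x * A_op p q f x)"
      by (rule in_left_ideal_left[OF finite_gens A_in_gens[OF A(1,2)] D])
    \<comment> \<open>Commuting with U_1 + \<mu> \<sigma>_1 lowers an index, with remainder -p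
      A_(p-1,q) - (q-1) A_(p,q-1). At the lower ends \<partial>_0 = -(E + \<mu>) enters: -A_(0,q) is
      T^q and A_(p,1) is T^(p+1).\<close>
    define B :: "'k diffop" where "B = (if p = 1 then T_op \<mu> q else (\<lambda>f x. - of_nat p * A_op (p - 1) q f x))"
    define C :: "'k diffop" where "C = (if q = 2 then T_op \<mu> (p + 1) else (\<lambda>f x. of_nat (q - 1) * A_op p (q - 1) f x))"
    have B: "in_left_ideal (gens \<mu>) (\<lambda>f x. 1 * B f x)"
    proof (cases "p = 1")
      case True
      have "in_left_ideal (gens \<mu>) (\<lambda>(f :: 'k base \<Rightarrow> complex) x. 1 * T_op \<mu> q f x)"
        by (rule in_left_ideal_scale[OF finite_gens T_in_gens]) (use A in auto)
      then show ?thesis using True by (simp add: B_def)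
    next
      case False
      have "in_left_ideal (gens \<mu>) (\<lambda>(f :: 'k base \<Rightarrow> complex) x. - of_nat p * A_op (p - 1) q f x)"
        by (rule in_left_ideal_scale[OF finite_gens A_in_gens]) (use A False in auto)
      then show ?thesis using False by (simp add: B_def)
    qed
    have C: "in_left_ideal (gens \<mu>) (\<lambda>f x. - 1 * C f x)"
    proof (cases "q = 2")
      case True
      have "in_left_ideal (gens \<mu>) (\<lambda>(f :: 'k base \<Rightarrow> complex) x. - 1 * T_op \<mu> (p + 1) f x)"
        by (rule in_left_ideal_scale[OF finite_gens T_in_gens]) (use A in auto)
      then show ?thesis using True by (simp add: C_def)
    next
      case False
      have "in_left_ideal (gens \<mu>) (\<lambda>(f :: 'k base \<Rightarrow> complex) x. - of_nat (q - 1) * A_op p (q - 1) f x)"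
        by (rule in_left_ideal_scale[OF finite_gens A_in_gens]) (use A False in auto)
      then show ?thesis using False by (simp add: C_def)
    qed
    show ?thesis
    proof (rule in_left_ideal_add[OF in_left_ideal_add[OF Ain B refl] C])
      fix W :: "'k base set" and f y assume *: "open W" "holo_on W f" and y: "y \<in> W"
      note hd = holo_on_dd[OF *(1)]
      have i: "p \<in> {1..CARD('k)}" "q \<in> {1..CARD('k)}" "p + 1 \<in> {1..CARD('k)}" "q - 1 \<in> {1..CARD('k)}" using A by auto
      have Bf: "B f y = - of_nat p * (M q p f y - dd p (dd (q - 1) f) y)"
        using dd_commute[OF * y, of "p - 1" q] A by (auto simp: B_def M_def T_op_Emu A_op_def)
      have Cf: "C f y = of_nat (q - 1) * (dd p (dd (q - 1) f) y - M (p + 1) (q - 1) f y)"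
        using dd_commute[OF * y, of p 1] A
        by (auto simp: C_def M_def T_op_Emu A_op_def)
      have m: "M p q f y = dd p (dd (q - 1) f) y" "M (q - 1) (p + 1) f y = dd p (dd (q - 1) f) y"
        using A dd_commute[OF * y, of p "q - 1"] by (auto simp: M_def)
      have k: "of_nat (q - 1) = (of_nat q - 1 :: complex)" using A by (auto simp: of_nat_diff)
      show "(G \<circ> Vop \<mu>) f y = Vop \<mu> (A_op p q f) y + 2 * sig 1 y * A_op p q f y + 1 * B f y + - 1 * C f y"
        unfolding A(3) A_op_def[abs_def] comp_apply dd2[OF * y i(1,2)] dd2[OF * y i(3,4)] Bf Cf m k
          V_diff[OF *(1) hd[OF hd[OF *(2)]] hd[OF hd[OF *(2)]] y]
        by (simp add: algebra_simps)
    qed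
  next
    case (T m)
    have Tin: "in_left_ideal (gens \<mu>) (\<lambda>(f :: 'k base \<Rightarrow> complex) x. Vop \<mu> (T_op \<mu> m f) x + 2 * sig 1 x * T_op \<mu> m f x)"
      by (rule in_left_ideal_left[OF finite_gens T_in_gens[OF T(1)] D])
    \<comment> \<open>For \<open>m = 2\<close> the lowered generator would be T^1 = -A_(0,1), whose
      two terms cancel.\<close>
    define c :: complex where "c = (if m = 2 then 0 else - of_nat (m - 1))"
    have B: "in_left_ideal (gens \<mu>) (\<lambda>(f :: 'k base \<Rightarrow> complex) x. c * T_op \<mu> (m - 1) f x)"
      by (rule in_left_ideal_scale[OF finite_gens T_in_gens]) (use T in \<open>auto simp: c_def split: if_splits\<close>)
    show ?thesis
    proof (rule in_left_ideal_add[OF Tin B])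
      fix W :: "'k base set" and f y assume *: "open W" "holo_on W f" and y: "y \<in> W"
      note hd = holo_on_dd[OF *(1)] and hE = holo_on_Emu[OF *(1)] and hV = holo_on_V[OF *(1)]
      have i: "1 \<in> {1..CARD('k)}" "m \<in> {1..CARD('k)}" "m - 1 \<in> {1..CARD('k)}" using T by auto
      have "dd m (Emu \<mu> (Vop \<mu> f)) y = dd m (\<lambda>x. Vop \<mu> (Emu \<mu> f) x + sig 1 x * Emu \<mu> f x) y"
        by (rule dd_cong[OF *(1) y]) (rule Emu_V[OF *])
      also have "\<dots> = dd m (Vop \<mu> (Emu \<mu> f)) y + dd m (\<lambda>x. sig 1 x * Emu \<mu> f x) y"
        by (intro dd_add[OF *(1)] hV hE *(2) y holo_intros)
      also have "dd m (\<lambda>x. sig 1 x * Emu \<mu> f x) y = sig 1 y * dd m (Emu \<mu> f) y"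
        using T by (simp add: dd_mult[OF *(1) holo_on_sig hE[OF *(2)] y] dd_sig)
      also have "dd m (Vop \<mu> (Emu \<mu> f)) y = Vop \<mu> (dd m (Emu \<mu> f)) y + (sig 1 y * dd m (Emu \<mu> f) y
          - of_nat m * dd (m - 1) (Emu \<mu> f) y)"
        using T by (simp add: dd_V[OF *(1) hE[OF *(2)] y i(2)])
      finally have E: "dd m (Emu \<mu> (Vop \<mu> f)) y = Vop \<mu> (dd m (Emu \<mu> f)) y + (sig 1 y * dd m (Emu \<mu> f) y
          - of_nat m * dd (m - 1) (Emu \<mu> f) y) + sig 1 y * dd m (Emu \<mu> f) y" .
      have k: "of_nat (m - 1) = (of_nat m - 1 :: complex)" using T by (auto simp: of_nat_diff)
      have m: "M (m - 1) 1 f y = - dd (m - 1) (Emu \<mu> f) y" by (simp add: M_def)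
      have c: "c * T_op \<mu> (m - 1) f y = - of_nat (m - 1) * (M 1 (m - 1) f y + dd (m - 1) (Emu \<mu> f) y)"
        using T by (auto simp: c_def M_def T_op_Emu)
      show "(G \<circ> Vop \<mu>) f y = Vop \<mu> (T_op \<mu> m f) y + 2 * sig 1 y * T_op \<mu> m f y + c * T_op \<mu> (m - 1) f y"
        unfolding c
        unfolding T T_op_Emu[abs_def] comp_apply dd2[OF * y i(1,3)] E m k
          V_add[OF *(1) hd[OF hd[OF *(2)]] hd[OF hE[OF *(2)]] y]
        by (simp add: algebra_simps)
    qed
  qed
qed

section \<open>The characteristic variety\<close>


subsection \<open>The points of the variety\<close>

definition sigma_poly :: "'k::{finite,linorder} base \<Rightarrow> complex poly" where
  "sigma_poly \<sigma> = monom 1 CARD('k) + (\<Sum>h=1..CARD('k). monom (sig h \<sigma>) (CARD('k) - h))"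

definition sigma_val :: "complex \<Rightarrow> 'k::{finite,linorder} base \<Rightarrow> complex" where
  "sigma_val x \<sigma> = x ^ CARD('k) + (\<Sum>h=1..CARD('k). sig h \<sigma> * x ^ (CARD('k) - h))"

lemma poly_sigma_poly: "poly (sigma_poly \<sigma>) x = sigma_val x \<sigma>"
  by (simp add: sigma_poly_def sigma_val_def poly_sum poly_monom)

lemma degree_sigma_poly: "degree (sigma_poly (\<sigma> :: 'k::{finite,linorder} base)) = CARD('k)"
proof -
  have "degree (\<Sum>h=1..CARD('k). monom (sig h \<sigma>) (CARD('k) - h)) \<le> CARD('k) - 1"
    by (rule degree_sum_le) (auto intro!: order_trans[OF degree_monom_le])
  then have "degree (\<Sum>h=1..CARD('k). monom (sig h \<sigma>) (CARD('k) - h)) < degree (monom (1::complex) CARD('k))"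
    by (simp add: degree_monom_eq order_le_less_trans)
  then show ?thesis
    unfolding sigma_poly_def by (simp add: degree_add_eq_left degree_monom_eq)
qed

lemma sigma_poly_nonzero: "sigma_poly (\<sigma> :: 'k::{finite,linorder} base) \<noteq> 0"
  using degree_sigma_poly[of \<sigma>] by auto

lemma sigma_val_root: obtains x where "sigma_val x (\<sigma> :: 'k::{finite,linorder} base) = 0"
proof -
  have "degree (sigma_poly \<sigma>) > 0" by (simp add: degree_sigma_poly)
  from alg_closed_imp_poly_has_root[OF this] show thesis
    using that by (auto simp: poly_sigma_poly)
qed

lemma mem_zero_locus_Z:
  fixes z :: "'k::{finite,linorder} cotangent"
  shows "z \<in> zero_locus Z_eqs \<longleftrightarrow>
    (\<forall>p\<in>{1..CARD('k) - 1}. \<forall>q\<in>{2..CARD('k)}. A_symb p q z = 0) \<and> (\<forall>m\<in>{2..CARD('k)}. T_symb m z = 0)"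
  unfolding zero_locus_def Z_eqs_def by blast

text \<open>On the curve T^m becomes l^2 x^(k-m) P_\<sigma>(x). Conversely, if \<eta>_k is nonzero,
  put x = \<eta>_(k-1) / \<eta>_k: the relations A_(p,k) give the powers of x and T^k gives the
  equation for x. If \<eta>_k = 0, the relations \<eta>_(h-1) \<eta>_(h+1) = \<eta>_h^2 kill
  \<eta>_(k-1), ..., \<eta>_2 in turn and T^2 kills \<eta>_1; then l = 0 and x is any root.\<close>

lemma zero_locus_param:
  fixes z :: "'k::{finite,linorder} cotangent"
  assumes k: "CARD('k) \<ge> 2"
  shows "z \<in> zero_locus Z_eqs \<longleftrightarrow>
    (\<exists>x l. (\<forall>h\<in>{1..CARD('k)}. eta h z = l * x ^ (CARD('k) - h)) \<and> sigma_val x (base_pt z) = 0)"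
    (is "_ \<longleftrightarrow> (\<exists>x l. ?param x l)")
proof
  assume "\<exists>x l. ?param x l"
  then obtain x l where eta: "\<And>h. h \<in> {1..CARD('k)} \<Longrightarrow> eta h z = l * x ^ (CARD('k) - h)"
    and x: "sigma_val x (base_pt z) = 0" by blast
  have "A_symb p q z = 0" if "p \<in> {1..CARD('k) - 1}" "q \<in> {2..CARD('k)}" for p q
  proof -
    have "CARD('k) - p + (CARD('k) - q) = CARD('k) - (p + 1) + (CARD('k) - (q - 1))" using that by auto
    then have "x ^ (CARD('k) - p) * x ^ (CARD('k) - q) = x ^ (CARD('k) - (p + 1)) * x ^ (CARD('k) - (q - 1))"
      by (simp only: power_add[symmetric])
    moreover have "p \<in> {1..CARD('k)}" "q \<in> {1..CARD('k)}" "p + 1 \<in> {1..CARD('k)}" "q - 1 \<in> {1..CARD('k)}"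
      using that by auto
    ultimately show ?thesis unfolding A_symb_def by (simp only: eta) (simp add: mult_ac)
  qed
  moreover have "T_symb m z = 0" if m: "m \<in> {2..CARD('k)}" for m
  proof -
    have "CARD('k) - 1 + (CARD('k) - (m - 1)) = CARD('k) - m + CARD('k)" using m by auto
    then have "x ^ (CARD('k) - 1) * x ^ (CARD('k) - (m - 1)) = x ^ (CARD('k) - m) * x ^ CARD('k)"
      by (simp only: power_add[symmetric])
    moreover have "(\<Sum>h=1..CARD('k). sig h (base_pt z) * eta h z) =
        l * (\<Sum>h=1..CARD('k). sig h (base_pt z) * x ^ (CARD('k) - h))"
      unfolding sum_distrib_left by (intro sum.cong refl) (simp add: eta)
    moreover have "m - 1 \<in> {1..CARD('k)}" "m \<in> {1..CARD('k)}" "1 \<in> {1..CARD('k)}" using m k by auto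
    ultimately have "T_symb m z = l * l * x ^ (CARD('k) - m) * sigma_val x (base_pt z)"
      unfolding T_symb_def sigma_val_def by (simp add: eta algebra_simps)
    then show ?thesis by (simp add: x)
  qed
  ultimately show "z \<in> zero_locus Z_eqs" by (simp add: mem_zero_locus_Z)
next
  assume "z \<in> zero_locus Z_eqs"
  then have A: "\<And>p q. p \<in> {1..CARD('k) - 1} \<Longrightarrow> q \<in> {2..CARD('k)} \<Longrightarrow> eta p z * eta q z = eta (p + 1) z * eta (q - 1) z"
    and T: "\<And>m. m \<in> {2..CARD('k)} \<Longrightarrow>
       eta 1 z * eta (m - 1) z + eta m z * (\<Sum>h=1..CARD('k). sig h (base_pt z) * eta h z) = 0"
    unfolding mem_zero_locus_Z by (auto simp: A_symb_def T_symb_def)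
  define l where "l = eta CARD('k) z"
  show "\<exists>x l. ?param x l"
  proof (cases "l = 0")
    case True
    have st: "eta (CARD('k) - j) z = 0" if "j < CARD('k) - 1" for j
      using that
    proof (induction j)
      case (Suc j)
      have "eta (CARD('k) - Suc j) z * eta (CARD('k) - Suc j) z = 0"
      proof (cases "Suc j = CARD('k) - 1")
        case False
        have "eta (CARD('k) - Suc (Suc j)) z * eta (CARD('k) - j) z =
            eta (CARD('k) - Suc (Suc j) + 1) z * eta (CARD('k) - j - 1) z"
          by (rule A) (use Suc.prems False in auto)
        then show ?thesis using Suc False by (simp add: Suc_diff_Suc)
      qed (use Suc.prems in auto)
      then show ?case by simp
    qed (use True in \<open>auto simp: l_def\<close>)
    have *: "eta h z = 0" if "h \<in> {2..CARD('k)}" for h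
    proof -
      have "CARD('k) - (CARD('k) - h) = h" "CARD('k) - h < CARD('k) - 1" using that by auto
      then show ?thesis using st[of "CARD('k) - h"] by simp
    qed
    have "eta 1 z * eta 1 z = 0" using T[of 2] *[of 2] k by simp
    with * have "eta h z = 0" if "h \<in> {1..CARD('k)}" for h
      using that by (cases "h = 1") auto
    moreover obtain x where "sigma_val x (base_pt z) = 0" by (rule sigma_val_root)
    ultimately show ?thesis by (intro exI[of _ x] exI[of _ 0]) auto
  next
    case False
    define x where "x = eta (CARD('k) - 1) z / l"
    have eta: "eta (CARD('k) - j) z = l * x ^ j" if "j < CARD('k)" for j
      using that
    proof (induction j)
      case (Suc j)
      have "eta (CARD('k) - Suc j) z * eta CARD('k) z = eta (CARD('k) - Suc j + 1) z * eta (CARD('k) - 1) z"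
        by (rule A) (use Suc.prems k in auto)
      also have "CARD('k) - Suc j + 1 = CARD('k) - j" using Suc.prems by simp
      finally show ?case using Suc False by (simp add: x_def l_def[symmetric] field_simps)
    qed (simp add: l_def)
    have eta': "eta h z = l * x ^ (CARD('k) - h)" if "h \<in> {1..CARD('k)}" for h
    proof -
      have h: "CARD('k) - (CARD('k) - h) = h" and "CARD('k) - h < CARD('k)" using that by auto
      from eta[OF this(2)] show ?thesis unfolding h .
    qed
    have "(\<Sum>h=1..CARD('k). sig h (base_pt z) * eta h z) =
        l * (\<Sum>h=1..CARD('k). sig h (base_pt z) * x ^ (CARD('k) - h))"
      unfolding sum_distrib_left by (intro sum.cong refl) (simp add: eta')
    moreover have "x ^ (CARD('k) - 1) * x = x ^ CARD('k)"
      using k by (metis One_nat_def Suc_1 Suc_le_D diff_Suc_1 power_Suc2)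
    moreover have "eta (CARD('k) - 1) z = l * x" using False by (simp add: x_def)
    ultimately have "l * l * sigma_val x (base_pt z) = 0"
      using T[of "CARD('k)"] k eta'[of 1] unfolding sigma_val_def by (simp add: l_def[symmetric] algebra_simps)
    with eta' False show ?thesis by auto
  qed
qed

subsection \<open>Symbols of the generators\<close>

lemma expansion_second_order:
  "\<exists>a. has_expansion UNIV 2 a (\<lambda>f. dd p (dd q f)) \<and> (\<forall>z. symbol 2 a z = eta p z * eta q z)"
proof -
  have "has_expansion UNIV 2 (pd_coeff (crd p) 1 (pd_coeff (crd q) 0 (\<lambda>\<alpha> x. 1))) (\<lambda>f. dd p (dd q f))"
    using has_expansion_pd[OF has_expansion_pd[OF has_expansion_id]]
    unfolding dd_def numeral_2_eq_2 One_nat_def by blast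
  moreover have "symbol 2 (pd_coeff (crd p) 1 (pd_coeff (crd q) 0 (\<lambda>\<alpha> x. 1))) z = eta p z * eta q z" for z
    unfolding numeral_2_eq_2 One_nat_def symbol_pd by (simp add: symbol_id eta_def)
  ultimately show ?thesis by blast
qed

lemma has_expansion_sum_symbol:
  assumes "finite I" "\<And>j. j \<in> I \<Longrightarrow> \<exists>a. has_expansion U m a (P j) \<and> (\<forall>z. symbol m a z = s j z)"
  shows "\<exists>a. has_expansion U m a (\<lambda>f x. \<Sum>j\<in>I. P j f x) \<and> (\<forall>z. symbol m a z = (\<Sum>j\<in>I. s j z))"
  using assms
proof (induction I rule: finite_induct)
  case empty
  show ?case by (intro exI[of _ "\<lambda>\<alpha> x. 0"]) (simp add: has_expansion_def holo_on_const symbol_def)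
next
  case (insert j I)
  then obtain a b where "has_expansion U m a (P j)" "has_expansion U m b (\<lambda>f x. \<Sum>j\<in>I. P j f x)"
    and s: "\<forall>z. symbol m a z = s j z" "\<forall>z. symbol m b z = (\<Sum>j\<in>I. s j z)" by blast
  from has_expansion_add[OF this(1,2)] have
    "has_expansion U m (\<lambda>\<alpha> x. a \<alpha> x + b \<alpha> x) (\<lambda>f x. \<Sum>j\<in>insert j I. P j f x)"
    using insert.hyps by simp
  moreover have "symbol m (\<lambda>\<alpha> x. a \<alpha> x + b \<alpha> x) z = (\<Sum>j\<in>insert j I. s j z)" for z
    using s insert.hyps by (simp add: symbol_add)
  ultimately show ?case by blast
qed

lemma expansion_A:
  "\<exists>a. has_expansion UNIV 2 a (A_op p q :: 'k::{finite,linorder} diffop) \<and> (\<forall>z. symbol 2 a z = A_symb p q z)"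
proof -
  obtain a where a: "has_expansion UNIV 2 a (\<lambda>f :: 'k base \<Rightarrow> complex. dd p (dd q f))" "\<forall>z. symbol 2 a z = eta p z * eta q z"
    using expansion_second_order by blast
  obtain b where b: "has_expansion UNIV 2 b (\<lambda>f :: 'k base \<Rightarrow> complex. dd (p + 1) (dd (q - 1) f))"
    "\<forall>z. symbol 2 b z = eta (p + 1) z * eta (q - 1) z"
    using expansion_second_order by blast
  have "has_expansion UNIV 2 (\<lambda>\<alpha> x. a \<alpha> x + - 1 * b \<alpha> x) (A_op p q :: 'k diffop)"
    by (rule has_expansion_cong[OF has_expansion_add[OF a(1) has_expansion_mult[OF b(1) holo_on_const[of _ "- 1"]]]])
      (simp add: A_op_def)
  moreover have "symbol 2 (\<lambda>\<alpha> x. a \<alpha> x + - 1 * b \<alpha> x) z = A_symb p q z" for z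
    unfolding symbol_add symbol_mult by (simp add: a b A_symb_def)
  ultimately show ?thesis by blast
qed

lemma dd_Emu_expand:
  fixes f :: "'k::{finite,linorder} base \<Rightarrow> complex"
  assumes "open W" "holo_on W f" "x \<in> W" "m \<in> {1..CARD('k)}"
  shows "dd m (Emu \<mu> f) x = (\<Sum>h=1..CARD('k). sig h x * dd h (dd m f) x) + (\<mu> + 1) * dd m f x"
  by (simp add: dd_Emu[OF assms] Emu_def E_op_def)

text \<open>Moving \<partial>_m to the right of E leaves the first-order term (\<mu> + 1)
  \<partial>_m, which the symbol of order 2 does not see; this is why the variety is independent of
  \<mu>.\<close>

lemma expansion_T:
  assumes m: "m \<in> {2..CARD('k)}"
  shows "\<exists>a. has_expansion UNIV 2 a (T_op \<mu> m :: 'k::{finite,linorder} diffop) \<and> (\<forall>z. symbol 2 a z = T_symb m z)"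
proof -
  obtain a where a: "has_expansion UNIV 2 a (\<lambda>f :: 'k base \<Rightarrow> complex. dd 1 (dd (m - 1) f))"
    "\<forall>z. symbol 2 a z = eta 1 z * eta (m - 1) z"
    using expansion_second_order by blast
  have "\<exists>b. has_expansion UNIV 2 b (\<lambda>(f :: 'k base \<Rightarrow> complex) x. \<Sum>h=1..CARD('k). sig h x * dd h (dd m f) x) \<and>
     (\<forall>z. symbol 2 b z = (\<Sum>h=1..CARD('k). sig h (base_pt z) * (eta h z * eta m z)))"
  proof (rule has_expansion_sum_symbol)
    fix h
    obtain b where b: "has_expansion UNIV 2 b (\<lambda>f :: 'k base \<Rightarrow> complex. dd h (dd m f))"
      "\<forall>z. symbol 2 b z = eta h z * eta m z"
      using expansion_second_order by blast
    show "\<exists>b. has_expansion UNIV 2 b (\<lambda>(f :: 'k base \<Rightarrow> complex) x. sig h x * dd h (dd m f) x) \<and>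
      (\<forall>z. symbol 2 b z = sig h (base_pt z) * (eta h z * eta m z))"
      using has_expansion_mult[OF b(1) holo_on_sig[of _ h]] b(2) by (metis symbol_mult)
  qed auto
  then obtain b where b: "has_expansion UNIV 2 b (\<lambda>(f :: 'k base \<Rightarrow> complex) x. \<Sum>h=1..CARD('k). sig h x * dd h (dd m f) x)"
    "\<forall>z. symbol 2 b z = (\<Sum>h=1..CARD('k). sig h (base_pt z) * (eta h z * eta m z))" by blast
  define c where "c = (\<lambda>\<alpha>. if mi_deg \<alpha> \<le> Suc 0 then pd_coeff (crd m) 0 (\<lambda>(\<alpha> :: 'k \<Rightarrow> nat) x. 1) \<alpha> else (\<lambda>_. 0))"
  have c: "has_expansion UNIV 2 c (\<lambda>f :: 'k base \<Rightarrow> complex. dd m f)"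
    unfolding c_def dd_def
    by (rule has_expansion_raise[OF has_expansion_pd[OF has_expansion_id]]) auto
  have c0: "symbol 2 c z = 0" for z unfolding c_def by (rule symbol_raise) simp
  have "has_expansion UNIV 2 (\<lambda>\<alpha> x. (a \<alpha> x + b \<alpha> x) + (\<mu> + 1) * c \<alpha> x) (T_op \<mu> m :: 'k diffop)"
    by (rule has_expansion_cong[OF has_expansion_add[OF has_expansion_add[OF a(1) b(1)]
         has_expansion_mult[OF c holo_on_const[of _ "\<mu> + 1"]]]])
      (use m in \<open>simp add: T_op_Emu dd_Emu_expand\<close>)
  moreover have "symbol 2 (\<lambda>\<alpha> x. (a \<alpha> x + b \<alpha> x) + (\<mu> + 1) * c \<alpha> x) z = T_symb m z" for z
    unfolding symbol_add symbol_mult by (simp add: a b c0 T_symb_def sum_distrib_left mult_ac)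
  ultimately show ?thesis by blast
qed

lemma char_variety_subset:
  "char_variety (I_sheaf \<mu> :: ('k::{finite,linorder} base) set \<Rightarrow> 'k diffop set) \<subseteq> zero_locus Z_eqs"
proof
  fix z :: "'k cotangent" assume z: "z \<in> char_variety (I_sheaf \<mu>)"
  have *: "symbol 2 a z = 0" if "G \<in> gens \<mu>" "has_expansion UNIV 2 a G" for a and G :: "'k diffop"
  proof -
    have "G \<in> I_sheaf \<mu> UNIV"
      unfolding I_sheaf_gens by (rule left_ideal_generator[OF that(1)]) (use D_sections_gens that in auto)
    then show ?thesis using z that(2) unfolding char_variety_def by blast
  qed
  have "A_symb p q z = 0" if "p \<in> {1..CARD('k) - 1}" "q \<in> {2..CARD('k)}" for p q
    using expansion_A[of p q] *[OF A_in_gens[OF that]] by metis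
  moreover have "T_symb m z = 0" if "m \<in> {2..CARD('k)}" for m
    using expansion_T[OF that, of \<mu>] *[OF T_in_gens[OF that]] by metis
  ultimately show "z \<in> zero_locus Z_eqs" by (simp add: mem_zero_locus_Z)
qed


subsection \<open>Test functions with a singularity along a hyperplane\<close>

lemma pd_compose:
  assumes "(\<phi> has_field_derivative d) (at (s x))" "holo_on U s" "x \<in> U"
  shows "pd i (\<lambda>y. \<phi> (s y)) x = d * pd i s x"
proof (rule pd_eqI)
  have "(\<phi> has_derivative (\<lambda>v. d * v)) (at (s x))"
    using assms(1) by (simp add: has_field_derivative_def)
  from has_derivative_compose[OF holo_on_has_derivative[OF assms(2,3)] this]
  show "((\<lambda>y. \<phi> (s y)) has_derivative (\<lambda>v. \<Sum>i\<in>UNIV. v $ i * (d * pd i s x))) (at x)"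
    by (rule has_derivative_eq_rhs) (auto simp: sum_distrib_left mult_ac)
qed

text \<open>The derivatives of \<phi> are given in advance as a tower \<open>\<phi> j\<close>, so
  that closed formulas can be inserted later. As \<open>s\<close> has constant first derivatives,
  each derivative of order j is a constant times \<open>\<phi> j\<close> of
  \<open>s\<close>.\<close>

lemma mpd_compose:
  assumes \<phi>: "\<And>j w. w \<in> \<Omega> \<Longrightarrow> (\<phi> j has_field_derivative \<phi> (Suc j) w) (at w)"
    and W: "open W" "\<And>x. x \<in> W \<Longrightarrow> s x \<in> \<Omega>" and s: "holo_on W s" "\<And>i x. x \<in> W \<Longrightarrow> pd i s x = \<zeta> i"
    and h: "holo_on W (\<lambda>y. \<phi> 0 (s y))"
  shows "x \<in> W \<Longrightarrow> mpd \<alpha> (\<lambda>y. \<phi> 0 (s y)) x = (\<Prod>i\<in>UNIV. \<zeta> i ^ \<alpha> i) * \<phi> (mi_deg \<alpha>) (s x)"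
proof (induction \<alpha> arbitrary: x rule: multi_index_induct)
  case zero
  then show ?case by (simp add: mpd_zero mi_deg_def)
next
  case (Suc \<alpha> i)
  have "mpd (\<alpha>(i := Suc (\<alpha> i))) (\<lambda>y. \<phi> 0 (s y)) x = pd i (mpd \<alpha> (\<lambda>y. \<phi> 0 (s y))) x"
    by (rule mpd_Suc[OF h W(1) Suc.prems])
  also have "\<dots> = pd i (\<lambda>y. (\<lambda>w. (\<Prod>i\<in>UNIV. \<zeta> i ^ \<alpha> i) * \<phi> (mi_deg \<alpha>) w) (s y)) x"
    by (rule pd_cong[OF W(1) Suc.prems]) (rule Suc.IH)
  also have "\<dots> = (\<Prod>i\<in>UNIV. \<zeta> i ^ \<alpha> i) * \<phi> (Suc (mi_deg \<alpha>)) (s x) * \<zeta> i"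
    unfolding s(2)[OF Suc.prems, symmetric]
    by (intro pd_compose[OF _ s(1) Suc.prems] DERIV_cmult \<phi> W Suc.prems)
  also have "(\<Prod>j\<in>UNIV. \<zeta> j ^ \<alpha> j) * \<zeta> i = (\<Prod>j\<in>UNIV. \<zeta> j ^ (\<alpha>(i := Suc (\<alpha> i))) j)"
    by (simp add: prod.remove[of UNIV i] mult_ac)
  then have "(\<Prod>j\<in>UNIV. \<zeta> j ^ \<alpha> j) * \<phi> (Suc (mi_deg \<alpha>)) (s x) * \<zeta> i =
      (\<Prod>j\<in>UNIV. \<zeta> j ^ (\<alpha>(i := Suc (\<alpha> i))) j) * \<phi> (Suc (mi_deg \<alpha>)) (s x)"
    by (metis mult.assoc mult.commute)
  finally show ?case by (simp only: mi_deg_Suc)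
qed

text \<open>The gradient of \<sigma> \<mapsto> P_\<sigma>(x), with entry x^(k-h) at
  \<open>crd h\<close>. The inverse of \<open>crd\<close> enters because fibre coordinates are
  indexed by the type \<open>'k\<close>.\<close>

definition sigma_dir :: "complex \<Rightarrow> 'k::{finite,linorder} \<Rightarrow> complex" where
  "sigma_dir x i = x ^ (CARD('k) - the_inv_into {1..CARD('k)} crd i)"

lemma sigma_dir_crd: "h \<in> {1..CARD('k)} \<Longrightarrow> sigma_dir x (crd h :: 'k::{finite,linorder}) = x ^ (CARD('k) - h)"
  using the_inv_into_f_f[OF bij_betw_imp_inj_on[OF bij_betw_crd[where 'k='k]]] by (simp add: sigma_dir_def)

lemma holo_on_sigma_val: "holo_on U (sigma_val x)"
  unfolding sigma_val_def[abs_def] by (intro holo_intros)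

lemma pd_sigma_val: "pd i (sigma_val x) (\<sigma> :: 'k::{finite,linorder} base) = sigma_dir x i"
proof -
  obtain p where p: "p \<in> {1..CARD('k)}" and i: "i = (crd p :: 'k)" by (metis crd_surj)
  have h: "holo_on UNIV (\<lambda>\<sigma> :: 'k base. x ^ (CARD('k) - h) * sig h \<sigma>)" for h by (intro holo_intros)
  have "pd i (sigma_val x) \<sigma> = pd i (\<lambda>\<sigma>. x ^ CARD('k)) \<sigma> + pd i (\<lambda>\<sigma>. \<Sum>h=1..CARD('k). x ^ (CARD('k) - h) * sig h \<sigma>) \<sigma>"
    unfolding sigma_val_def[abs_def] mult.commute[of "sig _ _"]
    by (rule pd_add[of UNIV]) (intro holo_intros, intro holo_intros, simp)
  also have "pd i (\<lambda>\<sigma>. \<Sum>h=1..CARD('k). x ^ (CARD('k) - h) * sig h \<sigma>) \<sigma> =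
      (\<Sum>h=1..CARD('k). x ^ (CARD('k) - h) * dd p (sig h) \<sigma>)"
    unfolding dd_def i[symmetric]
    by (subst pd_sum[OF h]) (auto simp: pd_cmult[OF holo_on_sig, of _ UNIV])
  also have "\<dots> = (\<Sum>h=1..CARD('k). if h = p then x ^ (CARD('k) - p) else 0)"
    by (intro sum.cong refl) (auto simp: dd_sig[OF p])
  finally show ?thesis using p by (simp add: pd_const i sigma_dir_crd)
qed

text \<open>\<sigma>_k is the constant term of P_\<sigma>. It is the handle by which a point is
  moved onto the hypersurface P_\<sigma>(x) = 0, or away from it at a prescribed rate.\<close>

lemma sigma_val_add_axis:
  "sigma_val x (\<sigma> + axis (crd CARD('k)) c) = sigma_val x (\<sigma> :: 'k::{finite,linorder} base) + c"
proof -
  have sg: "sig h (\<sigma> + axis (crd CARD('k)) c) = sig h \<sigma> + (if h = CARD('k) then c else 0)" if "h \<in> {1..CARD('k)}" for h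
    using that by (auto simp: sig_def axis_def crd_eq_iff)
  have "(\<Sum>h=1..CARD('k). sig h (\<sigma> + axis (crd CARD('k)) c) * x ^ (CARD('k) - h)) =
      (\<Sum>h=1..CARD('k). sig h \<sigma> * x ^ (CARD('k) - h)) + (\<Sum>h=1..CARD('k). if h = CARD('k) then c else 0)"
    unfolding sum.distrib[symmetric] by (intro sum.cong refl) (auto simp: sg ring_distribs)
  then show ?thesis unfolding sigma_val_def by simp
qed

lemma dd_compose_sigma_val:
  assumes \<phi>: "\<And>j w. w \<in> \<Omega> \<Longrightarrow> (\<phi> j has_field_derivative \<phi> (Suc j) w) (at w)"
    and W: "open W" "\<And>y. y \<in> W \<Longrightarrow> sigma_val x (y :: 'k::{finite,linorder} base) \<in> \<Omega>" and y: "y \<in> W"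
  shows "dd p (\<lambda>y. \<phi> j (sigma_val x y)) y = sigma_dir x (crd p :: 'k) * \<phi> (Suc j) (sigma_val x y)"
    and "dd p (dd q (\<lambda>y. \<phi> 0 (sigma_val x y))) y = sigma_dir x (crd p :: 'k) * sigma_dir x (crd q :: 'k) * \<phi> 2 (sigma_val x y)"
proof -
  have 1: "dd p (\<lambda>y. c * \<phi> j (sigma_val x y)) y = c * sigma_dir x (crd p :: 'k) * \<phi> (Suc j) (sigma_val x y)"
    if "y \<in> W" for y p j c
    using pd_compose[OF DERIV_cmult[OF \<phi>[OF W(2)[OF that]], of c j] holo_on_sigma_val[of UNIV], of "crd p"]
    by (simp add: dd_def pd_sigma_val mult_ac)
  show "dd p (\<lambda>y. \<phi> j (sigma_val x y)) y = sigma_dir x (crd p :: 'k) * \<phi> (Suc j) (sigma_val x y)"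
    using 1[OF y, of p 1 j] by simp
  have "dd p (dd q (\<lambda>y. \<phi> 0 (sigma_val x y))) y = dd p (\<lambda>y. sigma_dir x (crd q :: 'k) * \<phi> (Suc 0) (sigma_val x y)) y"
    by (rule dd_cong[OF W(1) y]) (use 1[of _ q 1 0] in simp)
  also have "\<dots> = sigma_dir x (crd p :: 'k) * sigma_dir x (crd q :: 'k) * \<phi> 2 (sigma_val x y)"
    using 1[OF y] by (simp add: numeral_2_eq_2 mult_ac)
  finally show "dd p (dd q (\<lambda>y. \<phi> 0 (sigma_val x y))) y =
     sigma_dir x (crd p :: 'k) * sigma_dir x (crd q :: 'k) * \<phi> 2 (sigma_val x y)" .
qed

text \<open>On functions of w = P_\<sigma>(x) every second derivative is x^(2k-p-q) \<phi>'', so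
  A_(p,q) gives zero; and since the \<sigma>_h x^(k-h) add up to w - x^k, T^m becomes x^(k-m) times
  the ordinary operator w \<phi>'' + (\<mu>+1) \<phi>'. The constant \<open>c\<close> depends on the
  generator alone, not on the open set.\<close>

lemma gens_compose:
  assumes k: "CARD('k) \<ge> 2"
    and \<phi>: "\<And>j w. w \<in> \<Omega> \<Longrightarrow> (\<phi> j has_field_derivative \<phi> (Suc j) w) (at w)"
    and ode: "\<And>w. w \<in> \<Omega> \<Longrightarrow> w * \<phi> 2 w + (\<mu> + 1) * \<phi> 1 w = r w"
    and G: "G \<in> gens \<mu>"
  obtains c where "\<And>W y. open W \<Longrightarrow> (\<And>y. y \<in> W \<Longrightarrow> sigma_val x (y :: 'k::{finite,linorder} base) \<in> \<Omega>) \<Longrightarrow>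
     holo_on W (\<lambda>y. \<phi> 0 (sigma_val x y)) \<Longrightarrow> y \<in> W \<Longrightarrow> G (\<lambda>y. \<phi> 0 (sigma_val x y)) y = c * r (sigma_val x y)"
  using G
proof (cases rule: gens_cases)
  case (A p q)
  show thesis
  proof (rule that[of 0])
    fix W :: "'k base set" and y
    assume W: "open W" "\<And>y. y \<in> W \<Longrightarrow> sigma_val x y \<in> \<Omega>" and y: "y \<in> W"
    have i: "p \<in> {1..CARD('k)}" "q \<in> {1..CARD('k)}" "p + 1 \<in> {1..CARD('k)}" "q - 1 \<in> {1..CARD('k)}" using A by auto
    have "CARD('k) - p + (CARD('k) - q) = CARD('k) - (p + 1) + (CARD('k) - (q - 1))" using A by auto
    then have "x ^ (CARD('k) - p) * x ^ (CARD('k) - q) = x ^ (CARD('k) - (p + 1)) * x ^ (CARD('k) - (q - 1))"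
      by (simp only: power_add[symmetric])
    then show "G (\<lambda>y. \<phi> 0 (sigma_val x y)) y = 0 * r (sigma_val x y)"
      unfolding A A_op_def dd_compose_sigma_val(2)[where \<phi>=\<phi> and \<Omega>=\<Omega>, OF \<phi> W y, simplified]
      by (simp only: sigma_dir_crd i) simp
  qed
next
  case (T m)
  show thesis
  proof (rule that[of "x ^ (CARD('k) - m)"])
    fix W :: "'k base set" and y
    assume W: "open W" "\<And>y. y \<in> W \<Longrightarrow> sigma_val x y \<in> \<Omega>" and y: "y \<in> W"
      and h: "holo_on W (\<lambda>y. \<phi> 0 (sigma_val x y))"
    have i: "1 \<in> {1..CARD('k)}" "m \<in> {1..CARD('k)}" "m - 1 \<in> {1..CARD('k)}" using T by auto
    have "CARD('k) - 1 + (CARD('k) - (m - 1)) = CARD('k) - m + CARD('k)" using T by auto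
    then have e: "x ^ (CARD('k) - 1) * x ^ (CARD('k) - (m - 1)) = x ^ (CARD('k) - m) * x ^ CARD('k)"
      by (simp only: power_add[symmetric])
    let ?w = "sigma_val x y"
    have c1: "dd m (\<lambda>y. \<phi> 0 (sigma_val x y)) y = x ^ (CARD('k) - m) * \<phi> 1 ?w"
      using dd_compose_sigma_val(1)[where \<phi>=\<phi> and \<Omega>=\<Omega> and j=0, OF \<phi> W y, of m] by (simp add: sigma_dir_crd[OF i(2)])
    have c2: "dd p (dd q (\<lambda>y. \<phi> 0 (sigma_val x y))) y = x ^ (CARD('k) - p) * x ^ (CARD('k) - q) * \<phi> 2 ?w"
      if "p \<in> {1..CARD('k)}" "q \<in> {1..CARD('k)}" for p q
      using dd_compose_sigma_val(2)[where \<phi>=\<phi> and \<Omega>=\<Omega>, OF \<phi> W y, of p q] by (simp only: sigma_dir_crd[OF that(1)] sigma_dir_crd[OF that(2)])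
    have "(\<Sum>h=1..CARD('k). sig h y * dd h (dd m (\<lambda>y. \<phi> 0 (sigma_val x y))) y) =
       (\<Sum>h=1..CARD('k). sig h y * x ^ (CARD('k) - h)) * (x ^ (CARD('k) - m) * \<phi> 2 ?w)"
      unfolding sum_distrib_right by (intro sum.cong refl) (simp add: c2[OF _ i(2)])
    also have "(\<Sum>h=1..CARD('k). sig h y * x ^ (CARD('k) - h)) = ?w - x ^ CARD('k)"
      by (simp add: sigma_val_def)
    finally have "G (\<lambda>y. \<phi> 0 (sigma_val x y)) y = x ^ (CARD('k) - m) * (?w * \<phi> 2 ?w + (\<mu> + 1) * \<phi> 1 ?w)"
      unfolding T T_op_Emu dd_Emu_expand[OF W(1) h y i(2)] c1 c2[OF i(1,3)] e by (simp add: algebra_simps)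
    then show "G (\<lambda>y. \<phi> 0 (sigma_val x y)) y = x ^ (CARD('k) - m) * r ?w"
      using ode[OF W(2)[OF y]] by simp
  qed
qed

text \<open>\<open>P\<close>, applied to \<phi>(P_\<sigma>(x)), is a sum of coefficients times
  \<phi>^(j)(P_\<sigma>(x)) with j up to \<open>m\<close>, and by the ideal also a function that
  stays holomorphic across the hyperplane. After multiplication by \<open>wt\<close>, all orders
  below \<open>m\<close> and the holomorphic side tend to zero, and only the symbol times
  \<open>c\<close> is left.\<close>

lemma symbol_vanishes_test:
  fixes P :: "'k::{finite,linorder} diffop" and wt :: "real \<Rightarrow> complex"
  assumes k: "CARD('k) \<ge> 2"
    and P: "P \<in> I_sheaf \<mu> U" and U: "open U" "\<sigma>0 \<in> U" and a: "has_expansion U m a P"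
    and x: "sigma_val x \<sigma>0 = 0"
    and \<Omega>: "open \<Omega>" "\<And>t. t > 0 \<Longrightarrow> complex_of_real t \<in> \<Omega>"
    and \<phi>: "\<And>j w. w \<in> \<Omega> \<Longrightarrow> (\<phi> j has_field_derivative \<phi> (Suc j) w) (at w)"
    and ode: "\<And>w. w \<in> \<Omega> \<Longrightarrow> w * \<phi> 2 w + (\<mu> + 1) * \<phi> 1 w = r w" and r: "r holomorphic_on UNIV"
    and small: "(\<forall>w. r w = 0) \<or> (wt \<longlongrightarrow> 0) (at_right 0)"
    and wt: "\<And>j. j < m \<Longrightarrow> ((\<lambda>t. wt t * \<phi> j (of_real t)) \<longlongrightarrow> 0) (at_right 0)"
      "((\<lambda>t. wt t * \<phi> m (of_real t)) \<longlongrightarrow> c) (at_right 0)" "c \<noteq> 0"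
  shows "(\<Sum>\<alpha> | mi_deg \<alpha> = m. a \<alpha> \<sigma>0 * (\<Prod>i\<in>UNIV. sigma_dir x i ^ \<alpha> i)) = 0"
proof -
  define s where "s = (sigma_val x :: 'k base \<Rightarrow> complex)"
  define f where "f y = \<phi> 0 (s y)" for y
  obtain V F Q where *: "open V \<and> \<sigma>0 \<in> V \<and> V \<subseteq> U \<and> finite F \<and> F \<subseteq> gens \<mu> \<and> (\<forall>G\<in>F. Q G \<in> D_sections V) \<and>
      (\<forall>W f. open W \<and> W \<subseteq> V \<and> holo_on W f \<longrightarrow> (\<forall>y\<in>W. P f y = (\<Sum>G\<in>F. Q G (G f) y)))"
    using left_idealD2[OF P[unfolded I_sheaf_gens] U(2)] by (elim exE)
  then have V: "open V" "\<sigma>0 \<in> V" "V \<subseteq> U" and F: "F \<subseteq> gens \<mu>"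
    and Q: "\<And>G. G \<in> F \<Longrightarrow> Q G \<in> D_sections V"
    and eq: "\<And>W f y. open W \<Longrightarrow> W \<subseteq> V \<Longrightarrow> holo_on W f \<Longrightarrow> y \<in> W \<Longrightarrow> P f y = (\<Sum>G\<in>F. Q G (G f) y)"
    by blast+
  have "\<forall>G\<in>F. \<exists>c. \<forall>W y. open W \<longrightarrow> (\<forall>y\<in>W. s y \<in> \<Omega>) \<longrightarrow> holo_on W f \<longrightarrow> y \<in> W \<longrightarrow> G f y = c * r (s y)"
  proof
    fix G assume "G \<in> F"
    then have G: "G \<in> gens \<mu>" using F by blast
    show "\<exists>c. \<forall>W y. open W \<longrightarrow> (\<forall>y\<in>W. s y \<in> \<Omega>) \<longrightarrow> holo_on W f \<longrightarrow> y \<in> W \<longrightarrow> G f y = c * r (s y)"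
      by (rule gens_compose[where \<phi>=\<phi> and \<Omega>=\<Omega> and x=x, OF k \<phi> ode G], assumption+)
        (unfold f_def[abs_def] s_def, blast)
  qed
  from bchoice[OF this] obtain e where e: "\<And>G W y. G \<in> F \<Longrightarrow> open W \<Longrightarrow> (\<forall>y\<in>W. s y \<in> \<Omega>) \<Longrightarrow>
      holo_on W f \<Longrightarrow> y \<in> W \<Longrightarrow> G f y = e G * r (s y)" by metis
  \<comment> \<open>The test function lives only where P_\<sigma>(x) avoids the cut, but r is
    entire, so this right-hand side is holomorphic on all of \<open>V\<close>, including
    \<open>\<sigma>0\<close>.\<close>
  define H where "H y = (\<Sum>G\<in>F. Q G (\<lambda>y. e G * r (s y)) y)" for y
  have hs: "holo_on A s" for A unfolding s_def by (rule holo_on_sigma_val)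
  have hr: "holo_on A (\<lambda>y. e G * r (s y))" for A G
    by (intro holo_on_mult holo_on_const holo_on_holomorphic_compose[OF r] hs) auto
  have hH: "holo_on V H"
    unfolding H_def by (intro holo_on_sum D_sections_result_holo[OF Q] V hr) auto
  define W where "W = V \<inter> s -` \<Omega>"
  have W: "open W" "W \<subseteq> V" "\<And>y. y \<in> W \<Longrightarrow> s y \<in> \<Omega>"
    using open_vimage[OF \<Omega>(1)] holo_on_continuous[OF hs[of UNIV]] V by (auto simp: W_def intro: open_Int)
  have hf: "holo_on W f"
    unfolding f_def
    by (rule holo_on_holomorphic_compose[OF _ \<Omega>(1) hs W(3)])
      (meson \<phi> \<Omega>(1) holomorphic_on_open)
  have main: "(\<Sum>\<alpha> | mi_deg \<alpha> \<le> m. a \<alpha> y * ((\<Prod>i\<in>UNIV. sigma_dir x i ^ \<alpha> i) * \<phi> (mi_deg \<alpha>) (s y))) = H y"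
    if y: "y \<in> W" for y
  proof -
    have "Q G (G f) y = Q G (\<lambda>y. e G * r (s y)) y" if "G \<in> F" for G
      by (rule D_sections_local[OF Q[OF that] W(1,2) holo_on_cong[OF W(1) _ hr] y, symmetric, rotated -1])
        (use e[OF that W(1) _ hf] W(3) in auto)
    then have "P f y = H y" unfolding H_def using eq[OF W(1,2) hf y] by simp
    moreover have "P f y = (\<Sum>\<alpha> | mi_deg \<alpha> \<le> m. a \<alpha> y * mpd \<alpha> f y)"
      by (rule has_expansionD[OF a W(1) _ hf y]) (use W V in auto)
    moreover have "mpd \<alpha> f y = (\<Prod>i\<in>UNIV. sigma_dir x i ^ \<alpha> i) * \<phi> (mi_deg \<alpha>) (s y)" for \<alpha>
      unfolding f_def
      by (rule mpd_compose[where \<phi>=\<phi> and \<Omega>=\<Omega>, OF \<phi> W(1,3) hs _ hf[unfolded f_def] y]) (auto simp: s_def pd_sigma_val)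
    ultimately show ?thesis by simp
  qed
  \<comment> \<open>Along this path P_\<sigma>(x) is the parameter itself, a positive real number
    and so never on the cut.\<close>
  define y where "y t = \<sigma>0 + axis (crd CARD('k)) (complex_of_real t)" for t :: real
  have sy: "s (y t) = of_real t" for t
    by (simp add: s_def y_def sigma_val_add_axis x)
  have ylim: "(y \<longlongrightarrow> \<sigma>0) (at_right 0)"
  proof -
    have "(y \<longlongrightarrow> \<sigma>0 + axis (crd CARD('k)) (of_real 0)) (at_right 0)"
      unfolding y_def by (intro tendsto_intros bounded_linear.tendsto[OF bounded_linear_axis])
    then show ?thesis by (simp add: axis_zero)
  qed
  have yW: "\<forall>\<^sub>F t in at_right 0. y t \<in> W"
  proof -
    have "\<forall>\<^sub>F t in at_right 0. y t \<in> V" using topological_tendstoD[OF ylim V(1,2)] .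
    moreover have "\<forall>\<^sub>F t in at_right (0::real). t > 0" by (simp add: eventually_at_right_less)
    ultimately show ?thesis by eventually_elim (auto simp: W_def sy \<Omega>)
  qed
  have limV: "((\<lambda>t. g (y t)) \<longlongrightarrow> g \<sigma>0) (at_right 0)" if "holo_on V g" for g :: "'k base \<Rightarrow> complex"
  proof -
    have "isCont g \<sigma>0" using holo_on_continuous[OF that] V continuous_on_eq_continuous_at by blast
    then show ?thesis using ylim by (rule isCont_tendsto_compose)
  qed
  let ?z = "\<lambda>\<alpha>. \<Prod>i\<in>UNIV. sigma_dir x i ^ \<alpha> i"
  have "((\<lambda>t. \<Sum>\<alpha> | mi_deg \<alpha> \<le> m. a \<alpha> (y t) * (?z \<alpha> * (wt t * \<phi> (mi_deg \<alpha>) (of_real t)))) \<longlongrightarrow>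
     (\<Sum>\<alpha> | mi_deg \<alpha> \<le> m. a \<alpha> \<sigma>0 * (?z \<alpha> * (if mi_deg \<alpha> = m then c else 0)))) (at_right 0)"
  proof (intro tendsto_sum tendsto_mult tendsto_const limV)
    fix \<alpha> :: "'k \<Rightarrow> nat" assume \<alpha>: "\<alpha> \<in> {\<alpha>. mi_deg \<alpha> \<le> m}"
    then show "holo_on V (a \<alpha>)" using has_expansion_holo[OF a] V by (auto intro: holo_on_subset)
    show "((\<lambda>t. wt t * \<phi> (mi_deg \<alpha>) (of_real t)) \<longlongrightarrow> (if mi_deg \<alpha> = m then c else 0)) (at_right 0)"
      using wt \<alpha> by auto
  qed
  moreover have "((\<lambda>t. \<Sum>\<alpha> | mi_deg \<alpha> \<le> m. a \<alpha> (y t) * (?z \<alpha> * (wt t * \<phi> (mi_deg \<alpha>) (of_real t)))) \<longlongrightarrow> 0) (at_right 0)"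
  proof -
    have "((\<lambda>t. wt t * H (y t)) \<longlongrightarrow> 0) (at_right 0)"
      using small
    proof
      assume r0: "\<forall>w. r w = 0"
      \<comment> \<open>If r vanishes, each \<open>Q G\<close> is applied to the zero function, an
        empty sum.\<close>
      have "H v = 0" if "v \<in> V" for v
        unfolding H_def using D_sections_sum_arg[OF Q V(1) order_refl, of _ "{}" "\<lambda>_ _. 0" v] that r0 by simp
      then have "\<forall>\<^sub>F t in at_right 0. wt t * H (y t) = 0"
        using yW W(2) by (auto elim!: eventually_mono)
      then show ?thesis by (simp add: tendsto_eventually)
    next
      assume "(wt \<longlongrightarrow> 0) (at_right 0)"
      from tendsto_mult[OF this limV[OF hH]] show ?thesis by simp
    qed
    moreover have "\<forall>\<^sub>F t in at_right 0. wt t * H (y t) =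
        (\<Sum>\<alpha> | mi_deg \<alpha> \<le> m. a \<alpha> (y t) * (?z \<alpha> * (wt t * \<phi> (mi_deg \<alpha>) (of_real t))))"
      using yW
    proof eventually_elim
      case (elim t)
      show ?case using main[OF elim] by (simp add: sy sum_distrib_left[symmetric] mult_ac flip: sum_distrib_left)
    qed
    ultimately show ?thesis by (rule Lim_transform_eventually)
  qed
  ultimately have "(\<Sum>\<alpha> | mi_deg \<alpha> \<le> m. a \<alpha> \<sigma>0 * (?z \<alpha> * (if mi_deg \<alpha> = m then c else 0))) = 0"
    by (rule tendsto_unique[rotated]) simp
  moreover have "(\<Sum>\<alpha> | mi_deg \<alpha> \<le> m. a \<alpha> \<sigma>0 * (?z \<alpha> * (if mi_deg \<alpha> = m then c else 0))) =
      (\<Sum>\<alpha> | mi_deg \<alpha> = m. a \<alpha> \<sigma>0 * ?z \<alpha>) * c"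
    unfolding sum_distrib_right by (intro sum.mono_neutral_cong_right finite_mi_deg) auto
  ultimately show ?thesis using wt(3) by simp
qed


section \<open>Complex powers, logarithms and their limits\<close>

definition cpow :: "complex \<Rightarrow> complex \<Rightarrow> complex" where
  "cpow e w = exp (e * Ln w)"

lemma cpow_add: "cpow (a + b) w = cpow a w * cpow b w"
  by (simp add: cpow_def ring_distribs exp_add)

lemma cpow_one: "w \<noteq> 0 \<Longrightarrow> cpow 1 w = w"
  by (simp add: cpow_def)

lemma cpow_of_nat: "w \<noteq> 0 \<Longrightarrow> cpow (of_nat n) w = w ^ n"
  by (simp add: cpow_def exp_of_nat_mult)

lemma has_field_derivative_cpow:
  assumes "w \<notin> \<real>\<^sub>\<le>\<^sub>0"
  shows "(cpow e has_field_derivative e * cpow (e - 1) w) (at w)"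
proof -
  have w: "w \<noteq> 0" using assms by auto
  have "(cpow e has_field_derivative exp (e * Ln w) * (e * inverse w)) (at w)"
    unfolding cpow_def[abs_def] by (rule derivative_eq_intros refl assms | simp)+
  moreover have "cpow (e - 1) w * w = cpow e w"
    using cpow_add[of "e - 1" 1 w] w by (simp add: cpow_one)
  then have "exp (e * Ln w) * (e * inverse w) = e * cpow (e - 1) w"
    using w by (simp add: cpow_def[symmetric] field_simps)
  ultimately show ?thesis by simp
qed

lemma tendsto_power_times_ln: "((\<lambda>t::real. t ^ Suc q * ln t) \<longlongrightarrow> 0) (at_right 0)"
proof -
  have "((\<lambda>x::real. - (ln x / x)) \<longlongrightarrow> - 0) at_top"
    by (intro tendsto_minus ln_x_over_x_tendsto_0)
  moreover have "\<forall>\<^sub>F x::real in at_top. - (ln x / x) = inverse x * ln (inverse x)"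
    using eventually_gt_at_top[of 0] by eventually_elim (simp add: ln_inverse divide_inverse)
  ultimately have "((\<lambda>x::real. inverse x * ln (inverse x)) \<longlongrightarrow> - 0) at_top"
    by (rule Lim_transform_eventually)
  then have "((\<lambda>t::real. t * ln t) \<longlongrightarrow> 0) (at_right 0)"
    by (subst at_right_to_top) (simp add: filterlim_filtermap)
  moreover have "((\<lambda>t::real. t ^ q) \<longlongrightarrow> 0 ^ q) (at_right 0)"
    by (intro tendsto_intros)
  ultimately have "((\<lambda>t::real. t ^ q * (t * ln t)) \<longlongrightarrow> 0 ^ q * 0) (at_right 0)"
    by (rule tendsto_mult[rotated])
  then show ?thesis by (simp add: mult_ac)
qed

lemma tendsto_power_times_Ln:
  assumes "j < m"
  shows "((\<lambda>t. of_real t ^ (m - j) * (A * Ln (of_real t) + B)) \<longlongrightarrow> 0) (at_right (0::real))"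
proof -
  obtain q where q: "m - j = Suc q" using assms by (metis Suc_diff_Suc)
  have "((\<lambda>t. A * complex_of_real (t ^ Suc q * ln t) + complex_of_real t ^ Suc q * B) \<longlongrightarrow>
     A * of_real 0 + of_real 0 ^ Suc q * B) (at_right 0)"
    by (intro tendsto_intros tendsto_power_times_ln)
  then have "((\<lambda>t. A * complex_of_real (t ^ Suc q * ln t) + complex_of_real t ^ Suc q * B) \<longlongrightarrow> 0) (at_right 0)"
    by simp
  moreover have "\<forall>\<^sub>F t in at_right (0::real). A * complex_of_real (t ^ Suc q * ln t) + complex_of_real t ^ Suc q * B =
      of_real t ^ (m - j) * (A * Ln (of_real t) + B)"
    using eventually_at_right_less[of 0]
    by eventually_elim (simp add: q Ln_of_real algebra_simps)
  ultimately show ?thesis by (rule Lim_transform_eventually)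
qed

lemma char_variety_superset:
  assumes k: "CARD('k) \<ge> 2" and \<mu>: "\<mu> \<noteq> 0"
  shows "zero_locus Z_eqs \<subseteq> char_variety (I_sheaf \<mu> :: ('k::{finite,linorder} base) set \<Rightarrow> 'k diffop set)"
proof
  fix z :: "'k cotangent" assume "z \<in> zero_locus Z_eqs"
  then obtain x l where eta: "\<And>h. h \<in> {1..CARD('k)} \<Longrightarrow> eta h z = l * x ^ (CARD('k) - h)"
    and x: "sigma_val x (base_pt z) = 0"
    unfolding zero_locus_param[OF k] by blast
  have fib: "fibre_pt z $ i = l * sigma_dir x i" for i
    by (rule crd_surj[of i]) (use eta in \<open>auto simp: eta_def sigma_dir_crd\<close>)
  have "symbol m a z = 0" if P: "P \<in> I_sheaf \<mu> U" and U: "open U" "base_pt z \<in> U" and a: "has_expansion U m a P"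
    for U m a and P :: "'k diffop"
  proof -
    define \<kappa> where "\<kappa> = - \<mu>"
    \<comment> \<open>The falling factorial, the coefficient in the derivative of order j of
      w^\<kappa>. It vanishes at \<open>m\<close> exactly if \<kappa> is a natural number below
      \<open>m\<close>, when the power alone no longer detects order \<open>m\<close>.\<close>
    define ff where "ff j = (\<Prod>i<j. \<kappa> - of_nat i)" for j
    have ff_Suc: "ff (Suc j) = ff j * (\<kappa> - of_nat j)" for j by (simp add: ff_def)
    have ff1: "ff (Suc 0) = \<kappa>" by (simp add: ff_def)
    let ?\<Omega> = "- \<real>\<^sub>\<le>\<^sub>0 :: complex set"
    have \<Omega>: "open ?\<Omega>" "\<And>t. t > 0 \<Longrightarrow> complex_of_real t \<in> ?\<Omega>" by (auto simp: open_Compl)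
    have pos: "complex_of_real t \<noteq> 0" if "t > 0" for t using that by simp
    \<comment> \<open>The weight t^(m-\<kappa>) makes the derivative of order \<open>m\<close>
      constant and leaves a factor t^(m-j) on those of order j < m, enough to beat a
      logarithm.\<close>
    define wt where "wt t = cpow (of_nat m - \<kappa>) (of_real t)" for t :: real
    have wt_mult: "wt t * cpow (\<kappa> - of_nat j) (of_real t) = of_real t ^ (m - j)" if "t > 0" "j \<le> m" for t j
      unfolding wt_def cpow_add[symmetric] using cpow_of_nat[OF pos[OF that(1)], of "m - j"] that(2)
      by (simp add: of_nat_diff)
    have wt_lim: "((\<lambda>t. wt t * (cpow (\<kappa> - of_nat j) (of_real t) * (A * Ln (of_real t) + B))) \<longlongrightarrow> 0) (at_right 0)"
      if "j < m" for j A B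
    proof (rule Lim_transform_eventually[OF tendsto_power_times_Ln[OF that]])
      show "\<forall>\<^sub>F t in at_right 0. of_real t ^ (m - j) * (A * Ln (of_real t) + B) =
         wt t * (cpow (\<kappa> - of_nat j) (of_real t) * (A * Ln (of_real t) + B))"
        using eventually_at_right_less[of 0] by eventually_elim (use wt_mult that in \<open>simp flip: mult.assoc\<close>)
    qed
    have wt_lim_m: "((\<lambda>t. wt t * (cpow (\<kappa> - of_nat m) (of_real t) * B)) \<longlongrightarrow> B) (at_right 0)" for B
    proof (rule Lim_transform_eventually[OF tendsto_const])
      show "\<forall>\<^sub>F t in at_right 0. B = wt t * (cpow (\<kappa> - of_nat m) (of_real t) * B)"
        using eventually_at_right_less[of 0]
        by eventually_elim (use wt_mult[of _ m] in \<open>simp flip: mult.assoc\<close>)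
    qed
    have mult_cpow: "w * cpow (\<kappa> - 2) w = cpow (\<kappa> - 1) w" if "w \<in> ?\<Omega>" for w
    proof -
      have "w \<noteq> 0" using that by auto
      then show ?thesis using cpow_add[of 1 "\<kappa> - 2" w] cpow_one[of w] by simp
    qed
    have "(\<Sum>\<alpha> | mi_deg \<alpha> = m. a \<alpha> (base_pt z) * (\<Prod>i\<in>UNIV. sigma_dir x i ^ \<alpha> i)) = 0"
    proof (cases "ff m = 0")
      case False
      define \<phi> where "\<phi> j w = ff j * cpow (\<kappa> - of_nat j) w" for j w
      show ?thesis
      proof (rule symbol_vanishes_test[OF k P U a x \<Omega>, where \<phi>=\<phi> and r="\<lambda>_. 0" and wt=wt and c="ff m"])
        show "(\<phi> j has_field_derivative \<phi> (Suc j) w) (at w)" if "w \<in> ?\<Omega>" for j w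
          using DERIV_cmult[OF has_field_derivative_cpow[of w "\<kappa> - of_nat j"], of "ff j"] that
          unfolding \<phi>_def[abs_def] by (simp add: ff_Suc mult.assoc diff_diff_add add.commute)
        show "w * \<phi> 2 w + (\<mu> + 1) * \<phi> 1 w = 0" if "w \<in> ?\<Omega>" for w
        proof -
          have "w * \<phi> 2 w + (\<mu> + 1) * \<phi> 1 w = ff 2 * (w * cpow (\<kappa> - 2) w) + (\<mu> + 1) * ff 1 * cpow (\<kappa> - 1) w"
            by (simp add: \<phi>_def)
          also have "\<dots> = 0"
            unfolding mult_cpow[OF that] by (simp add: numeral_2_eq_2 ff_Suc ff1 \<kappa>_def ff_def algebra_simps)
          finally show ?thesis .
        qed
        show "((\<lambda>t. wt t * \<phi> j (of_real t)) \<longlongrightarrow> 0) (at_right 0)" if "j < m" for j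
          using wt_lim[OF that, of 0 "ff j"] by (simp add: \<phi>_def mult_ac)
        show "((\<lambda>t. wt t * \<phi> m (of_real t)) \<longlongrightarrow> ff m) (at_right 0)"
          using wt_lim_m[of "ff m"] by (simp add: \<phi>_def mult_ac)
      qed (use False in auto)
    next
      case True
      then obtain n where n: "n < m" "\<kappa> = of_nat n" by (auto simp: ff_def)
      have n0: "n > 0" using \<mu> n by (auto simp: \<kappa>_def intro!: Nat.gr0I)
      \<comment> \<open>The derivative of order j of w^\<kappa> ln w is w^(\<kappa>-j) (ff_j ln w +
        d_j); differentiating once more gives the recursion.\<close>
      define d where "d = rec_nat 0 (\<lambda>j dj. ff j + (\<kappa> - of_nat j) * dj)"
      have d: "d 0 = 0" "d (Suc j) = ff j + (\<kappa> - of_nat j) * d j" for j by (simp_all add: d_def)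
      have ff0: "ff j = 0 \<longleftrightarrow> n < j" for j by (auto simp: ff_def n)
      \<comment> \<open>d_(n+1) is ff_n, which is nonzero; from there on ff_j = 0 and each step
        multiplies by \<kappa> - j, which is nonzero as j > n.\<close>
      have dj: "d j \<noteq> 0" if "n < j" for j
        using that
      proof (induction j)
        case (Suc j)
        show ?case
        proof (cases "j = n")
          case True then show ?thesis using ff0[of n] by (simp add: d n)
        next
          case False
          then have "n < j" using Suc.prems by simp
          then show ?thesis using Suc.IH ff0[of j] by (simp add: d n)
        qed
      qed simp
      define \<phi> where "\<phi> j w = cpow (\<kappa> - of_nat j) w * (ff j * Ln w + d j)" for j w
      show ?thesis
      \<comment> \<open>In w \<phi>'' + (\<mu>+1) \<phi>' the logarithms cancel and \<kappa> w^(n-1)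
        remains, an entire function because n > 0. It is harmless in the limit since the weight
        t^(m-n) tends to zero.\<close>
      proof (rule symbol_vanishes_test[OF k P U a x \<Omega>, where \<phi>=\<phi> and r="\<lambda>w. \<kappa> * w ^ (n - 1)" and wt=wt and c="d m"])
        show "(\<phi> j has_field_derivative \<phi> (Suc j) w) (at w)" if "w \<in> ?\<Omega>" for j w
        proof -
          have w: "w \<noteq> 0" "w \<notin> \<real>\<^sub>\<le>\<^sub>0" using that by auto
          have "(\<phi> j has_field_derivative (\<kappa> - of_nat j) * cpow (\<kappa> - of_nat j - 1) w * (ff j * Ln w + d j) +
             ff j * inverse w * cpow (\<kappa> - of_nat j) w) (at w)"
            unfolding \<phi>_def[abs_def] using w
            by (intro DERIV_mult has_field_derivative_cpow) (auto intro!: derivative_eq_intros simp: field_simps)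
          moreover have "cpow (\<kappa> - of_nat j) w = cpow (\<kappa> - of_nat j - 1) w * w"
            using cpow_add[of "\<kappa> - of_nat j - 1" 1 w] w by (simp add: cpow_one)
          then have "(\<kappa> - of_nat j) * cpow (\<kappa> - of_nat j - 1) w * (ff j * Ln w + d j) +
             ff j * inverse w * cpow (\<kappa> - of_nat j) w = \<phi> (Suc j) w"
            using w by (simp add: \<phi>_def d ff_Suc diff_diff_add add.commute) (simp add: algebra_simps)
          ultimately show ?thesis by simp
        qed
        show "w * \<phi> 2 w + (\<mu> + 1) * \<phi> 1 w = \<kappa> * w ^ (n - 1)" if "w \<in> ?\<Omega>" for w
        proof -
          have w: "w \<noteq> 0" using that by auto
          have c: "cpow (\<kappa> - 1) w = w ^ (n - 1)"
            using cpow_of_nat[OF w, of "n - 1"] n0 by (simp add: n of_nat_diff)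
          have d12: "d (Suc 0) = 1" "d 2 = 2 * \<kappa> - 1"
            by (simp_all add: numeral_2_eq_2 d ff1) (simp_all add: ff_def)
          have "w * \<phi> 2 w + (\<mu> + 1) * \<phi> 1 w = w * cpow (\<kappa> - 2) w * (ff 2 * Ln w + d 2) +
             (\<mu> + 1) * (cpow (\<kappa> - 1) w * (ff 1 * Ln w + d 1))"
            by (simp add: \<phi>_def)
          also have "\<dots> = \<kappa> * w ^ (n - 1)"
            unfolding mult_cpow[OF that] c d12
            by (simp add: d12 numeral_2_eq_2 ff_Suc ff1) (simp add: \<kappa>_def ff_def algebra_simps)
          finally show ?thesis .
        qed
        show "((\<lambda>t. wt t * \<phi> j (of_real t)) \<longlongrightarrow> 0) (at_right 0)" if "j < m" for j
          unfolding \<phi>_def by (rule wt_lim[OF that])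
        show "((\<lambda>t. wt t * \<phi> m (of_real t)) \<longlongrightarrow> d m) (at_right 0)"
          unfolding \<phi>_def True using wt_lim_m[of "d m"] by simp
        have "((\<lambda>t. of_real t ^ (m - n) * (0 * Ln (of_real t) + 1)) \<longlongrightarrow> (0::complex)) (at_right (0::real))"
          by (rule tendsto_power_times_Ln[OF n(1)])
        then have "(wt \<longlongrightarrow> 0) (at_right 0)"
        proof (rule Lim_transform_eventually)
          show "\<forall>\<^sub>F t in at_right 0. of_real t ^ (m - n) * (0 * Ln (of_real t) + 1) = wt t"
            using eventually_at_right_less[of 0]
          proof eventually_elim
            case (elim t)
            then show ?case using cpow_of_nat[OF pos[OF elim], of "m - n"] n by (simp add: wt_def of_nat_diff)
          qed
        qed
        then show "(\<forall>w. \<kappa> * w ^ (n - 1) = 0) \<or> (wt \<longlongrightarrow> 0) (at_right 0)" ..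
        show "d m \<noteq> 0" by (rule dj[OF n(1)])
      qed (auto intro!: holomorphic_intros)
    qed
    \<comment> \<open>The test gives the direction with l = 1; the symbol is homogeneous of degree
      \<open>m\<close> in the fibre.\<close>
    moreover have "symbol m a z = l ^ m * (\<Sum>\<alpha> | mi_deg \<alpha> = m. a \<alpha> (base_pt z) * (\<Prod>i\<in>UNIV. sigma_dir x i ^ \<alpha> i))"
      unfolding symbol_def sum_distrib_left
      by (intro sum.cong refl) (auto simp: fib power_mult_distrib prod.distrib mi_deg_def power_sum)
    ultimately show ?thesis by simp
  qed
  then show "z \<in> char_variety (I_sheaf \<mu>)" unfolding char_variety_def by blast
qed

subsection \<open>Irreducibility\<close>

text \<open>Near a limit point of the parameters that lead into \<open>A\<close>, the local
  equations of \<open>A\<close> pulled back to the curve vanish on a whole disc by the identity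
  theorem. So the limit points form a closed and open subset of the plane.\<close>

lemma analytic_subset_curve:
  fixes \<gamma> :: "complex \<Rightarrow> complex ^ 'n::finite"
  assumes A: "analytic_subset A" and \<gamma>: "\<And>i. (\<lambda>t. \<gamma> t $ i) holomorphic_on UNIV" and lim: "t0 islimpt {t. \<gamma> t \<in> A}"
  shows "\<gamma> t \<in> A"
proof -
  define T where "T = {t. \<gamma> t \<in> A}"
  have cont: "continuous_on UNIV \<gamma>"
    using continuous_on_vec_lambda[of UNIV "\<lambda>i t. \<gamma> t $ i", OF holomorphic_on_imp_continuous_on[OF \<gamma>]] by simp
  have loc: "\<exists>e>0. ball t e \<subseteq> T" if t: "t islimpt T" for t
  proof -
    obtain W F where W: "open W" "\<gamma> t \<in> W" and F: "\<And>f. f \<in> F \<Longrightarrow> holo_on W f"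
      and AW: "A \<inter> W = {w \<in> W. \<forall>f\<in>F. f w = 0}"
      using A[unfolded analytic_subset_def, rule_format, of "\<gamma> t"] by blast
    have "open (\<gamma> -` W)" by (rule open_vimage[OF W(1) cont])
    then obtain e where e: "e > 0" "ball t e \<subseteq> \<gamma> -` W" using W(2) by (metis open_contains_ball vimageI)
    have "\<gamma> s \<in> A" if s: "s \<in> ball t e" for s
    proof -
      have "f (\<gamma> s) = 0" if f: "f \<in> F" for f
      proof (rule analytic_continuation[of "\<lambda>s. f (\<gamma> s)" "ball t e" "T \<inter> ball t e" t])
        show "(\<lambda>s. f (\<gamma> s)) holomorphic_on ball t e"
          by (rule holo_on_curve[OF F[OF f]]) (use e in \<open>auto intro: holomorphic_on_subset[OF \<gamma>]\<close>)
        show "t islimpt T \<inter> ball t e"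
          by (rule islimpt_Int_eventually[OF t], rule eventually_mono[OF eventually_at_ball[OF e(1)]])
            (auto simp: dist_commute)
        show "f (\<gamma> s) = 0" if "s \<in> T \<inter> ball t e" for s
        proof -
          have "\<gamma> s \<in> A \<inter> W" using that e by (auto simp: T_def)
          then show ?thesis unfolding AW using f by blast
        qed
      qed (use e s in auto)
      moreover have "\<gamma> s \<in> W" using e s by auto
      ultimately have "\<gamma> s \<in> A \<inter> W" unfolding AW by blast
      then show ?thesis by blast
    qed
    then show ?thesis using e by (auto simp: T_def)
  qed
  define L where "L = {t. t islimpt T}"
  have "closed L" unfolding L_def by (rule closed_limpts)
  moreover have "open L"
    unfolding open_contains_ball
  proof
    fix t assume "t \<in> L"
    then obtain e where e: "e > 0" "ball t e \<subseteq> T" using loc by (auto simp: L_def)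
    have "ball t e \<subseteq> L"
    proof
      fix s assume "s \<in> ball t e"
      then have "s islimpt ball t e" by (intro interior_limit_point) (simp add: interior_open)
      then show "s \<in> L" using islimpt_subset[OF _ e(2)] by (simp add: L_def)
    qed
    then show "\<exists>e>0. ball t e \<subseteq> L" using e by blast
  qed
  ultimately have "L = {} \<or> L = UNIV" using clopen by blast
  then have "L = UNIV" using lim by (auto simp: L_def T_def)
  then have "t islimpt T" by (auto simp: L_def)
  then obtain e where "e > 0" "ball t e \<subseteq> T" using loc by blast
  then have "t \<in> T" using subsetD[of "ball t e" T t] by simp
  then show ?thesis by (simp add: T_def)
qed

definition cotpt :: "'k base \<Rightarrow> ('k \<Rightarrow> complex) \<Rightarrow> 'k::finite cotangent" where
  "cotpt \<sigma> \<eta> = (\<chi> i. case i of Inl j \<Rightarrow> \<sigma> $ j | Inr j \<Rightarrow> \<eta> j)"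

lemma cotpt_simps [simp]:
  "cotpt \<sigma> \<eta> $ Inl i = \<sigma> $ i" "cotpt \<sigma> \<eta> $ Inr i = \<eta> i" "base_pt (cotpt \<sigma> \<eta>) = \<sigma>" "fibre_pt (cotpt \<sigma> \<eta>) $ i = \<eta> i"
  by (simp_all add: cotpt_def base_pt_def fibre_pt_def vec_eq_iff)

lemma cotpt_in_Z:
  fixes \<sigma> :: "'k::{finite,linorder} base"
  assumes "CARD('k) \<ge> 2" "sigma_val x \<sigma> = 0"
  shows "cotpt \<sigma> (\<lambda>i. l * sigma_dir x i) \<in> zero_locus Z_eqs"
  unfolding zero_locus_param[OF assms(1)]
  by (intro exI[of _ x] exI[of _ l]) (auto simp: assms eta_def sigma_dir_crd)

lemma zero_locus_cotptE:
  fixes z :: "'k::{finite,linorder} cotangent"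
  assumes "CARD('k) \<ge> 2" "z \<in> zero_locus Z_eqs"
  obtains \<sigma> x l where "sigma_val x \<sigma> = 0" "z = cotpt \<sigma> (\<lambda>i. l * sigma_dir x i)"
proof -
  obtain x l where eta: "\<And>h. h \<in> {1..CARD('k)} \<Longrightarrow> eta h z = l * x ^ (CARD('k) - h)"
    and x: "sigma_val x (base_pt z) = 0"
    using assms(2) unfolding zero_locus_param[OF assms(1)] by blast
  have fib: "z $ Inr i = l * sigma_dir x i" for i
    by (rule crd_surj[of i]) (use eta in \<open>auto simp: eta_def sigma_dir_crd fibre_pt_def\<close>)
  have "z $ j = cotpt (base_pt z) (\<lambda>i. l * sigma_dir x i) $ j" for j
    by (cases j) (simp_all add: fib, simp add: base_pt_def)
  then have "z = cotpt (base_pt z) (\<lambda>i. l * sigma_dir x i)" unfolding vec_eq_iff by (rule allI)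
  then show thesis by (rule that[OF x])
qed

lemma irreducible_zero_locus:
  assumes k: "CARD('k) \<ge> 2"
  shows "irreducible_subset (zero_locus Z_eqs :: ('k::{finite,linorder} cotangent) set)"
  unfolding irreducible_subset_def
proof (intro conjI allI impI)
  let ?Z = "zero_locus Z_eqs :: ('k cotangent) set"
  obtain x where "sigma_val x (0 :: 'k base) = 0" by (rule sigma_val_root)
  then show "?Z \<noteq> {}" using cotpt_in_Z[OF k] by blast
  fix A B :: "('k cotangent) set"
  assume "analytic_subset A \<and> analytic_subset B \<and> ?Z = A \<union> B"
  then have A: "analytic_subset A" and B: "analytic_subset B" and Z: "?Z = A \<union> B" by auto
  show "?Z = A \<or> ?Z = B"
  proof (rule ccontr)
    assume "\<not> (?Z = A \<or> ?Z = B)"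
    then obtain p q where p: "p \<in> ?Z" "p \<notin> A" and q: "q \<in> ?Z" "q \<notin> B" using Z by blast
    obtain \<sigma>p xp lp where P: "sigma_val xp \<sigma>p = 0" "p = cotpt \<sigma>p (\<lambda>i. lp * sigma_dir xp i)"
      using zero_locus_cotptE[OF k p(1)] .
    obtain \<sigma>q xq lq where Q: "sigma_val xq \<sigma>q = 0" "q = cotpt \<sigma>q (\<lambda>i. lq * sigma_dir xq i)"
      using zero_locus_cotptE[OF k q(1)] .
    define x where "x t = xp + t * (xq - xp)" for t
    define l where "l t = lp + t * (lq - lp)" for t
    define b where "b t = \<sigma>p + t *s (\<sigma>q - \<sigma>p)" for t
    \<comment> \<open>Linear interpolation alone would lose the root; the correction of \<sigma>_k
      makes \<open>x t\<close> a root for every \<open>t\<close>, and it vanishes at t = 0 and t =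
      1.\<close>
    define \<sigma> where "\<sigma> t = b t + axis (crd CARD('k)) (- sigma_val (x t) (b t))" for t
    define \<gamma> where "\<gamma> t = cotpt (\<sigma> t) (\<lambda>i. l t * sigma_dir (x t) i)" for t
    have \<gamma>Z: "\<gamma> t \<in> ?Z" for t
      unfolding \<gamma>_def by (rule cotpt_in_Z[OF k]) (simp add: \<sigma>_def sigma_val_add_axis)
    have \<gamma>0: "\<gamma> 0 = p" by (simp add: \<gamma>_def \<sigma>_def x_def l_def b_def P axis_zero)
    have \<gamma>1: "\<gamma> 1 = q" by (simp add: \<gamma>_def \<sigma>_def x_def l_def b_def Q axis_zero)
    have hb: "(\<lambda>t. b t $ j) holomorphic_on UNIV" for j
      unfolding b_def by (auto intro!: holomorphic_intros)
    have hx: "x holomorphic_on UNIV" "l holomorphic_on UNIV"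
      unfolding x_def[abs_def] l_def[abs_def] by (auto intro!: holomorphic_intros)
    have hsig: "(\<lambda>t. sig h (b t)) holomorphic_on UNIV" for h
      using holo_on_curve[OF holo_on_sig[of UNIV h] hb] by auto
    have hs: "(\<lambda>t. sigma_val (x t) (b t)) holomorphic_on UNIV"
      unfolding sigma_val_def by (intro holomorphic_intros hx hsig)
    have \<gamma>: "(\<lambda>t. \<gamma> t $ i) holomorphic_on UNIV" for i
    proof (cases i)
      case (Inl j)
      have "(\<lambda>t. b t $ j + (if j = crd CARD('k) then - sigma_val (x t) (b t) else 0)) holomorphic_on UNIV"
        by (cases "j = crd CARD('k)") (auto intro!: holomorphic_intros hb hs)
      then show ?thesis by (simp add: Inl \<gamma>_def \<sigma>_def axis_def)
    next
      case (Inr j)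
      then show ?thesis by (auto simp: \<gamma>_def sigma_dir_def intro!: holomorphic_intros hx)
    qed
    \<comment> \<open>If the parameters leading into \<open>A\<close> accumulated at 0, the whole
      curve would lie in \<open>A\<close>, contrary to the choice of \<open>p\<close>; likewise for
      \<open>B\<close> and \<open>q\<close>. But together they exhaust the plane.\<close>
    have "\<not> 0 islimpt {t. \<gamma> t \<in> A}" using analytic_subset_curve[OF A \<gamma>, of 0 0] p \<gamma>0 by auto
    moreover have "\<not> 0 islimpt {t. \<gamma> t \<in> B}" using analytic_subset_curve[OF B \<gamma>, of 0 1] q \<gamma>1 by auto
    moreover have "{t. \<gamma> t \<in> A} \<union> {t. \<gamma> t \<in> B} = UNIV" using \<gamma>Z Z by auto
    moreover have "(0::complex) islimpt UNIV" by (rule islimpt_UNIV)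
    ultimately show False by (metis islimpt_Un)
  qed
qed

section \<open>Reducedness\<close>


subsection \<open>Hadamard's lemma\<close>

text \<open>Integrate the derivative of \<open>f\<close> along the segment from \<open>b x\<close>
  to \<open>a x\<close>, which convexity keeps in \<open>B\<close>. Two maps instead of two points
  let \<open>b\<close> be a projection onto a subvariety, with quotients holomorphic in
  \<open>x\<close>.\<close>

lemma hadamard:
  fixes a b :: "complex ^ 'm::finite \<Rightarrow> complex ^ 'n::finite"
  assumes f: "holo_on B f" and B: "open B" "convex B" and V: "open V"
    and a: "\<And>i. holo_on V (\<lambda>x. a x $ i)" "\<And>x. x \<in> V \<Longrightarrow> a x \<in> B"
    and b: "\<And>i. holo_on V (\<lambda>x. b x $ i)" "\<And>x. x \<in> V \<Longrightarrow> b x \<in> B"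
  obtains G where "\<And>i. holo_on V (G i)"
    "\<And>x. x \<in> V \<Longrightarrow> f (a x) - f (b x) = (\<Sum>i\<in>UNIV. (a x $ i - b x $ i) * G i x)"
proof -
  define l where "l x s = b x + s *\<^sub>R (a x - b x)" for x and s :: real
  have lB: "l x s \<in> B" if "x \<in> V" "s \<in> {0..1}" for x s
  proof -
    have "l x s = (1 - s) *\<^sub>R b x + s *\<^sub>R a x" by (simp add: l_def algebra_simps)
    then show ?thesis using that a(2) b(2) B(2) by (auto intro!: convexD)
  qed
  define h where "h = (\<lambda>i x s. pd i f (l x s))"
  have hl: "holo_on V (\<lambda>x. l x s $ i)" for s i
    unfolding l_def by (simp add: scaleR_conv_of_real) (intro holo_intros a b)
  have holo: "holo_on V (\<lambda>x. h i x s)" if "s \<in> {0..1}" for i s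
    unfolding h_def by (rule holo_on_compose[OF holo_on_pd[OF f B(1)] hl lB]) (use that in auto)
  have ca: "continuous_on V a" "continuous_on V b"
    using continuous_on_vec_lambda[of V "\<lambda>i x. a x $ i", OF holo_on_continuous[OF a(1)]]
      continuous_on_vec_lambda[of V "\<lambda>i x. b x $ i", OF holo_on_continuous[OF b(1)]]
    by simp_all
  have cl: "continuous_on (V \<times> {0..1}) (\<lambda>p. l (fst p) (snd p))"
    unfolding l_def by (intro continuous_intros continuous_on_compose2[OF ca(1)] continuous_on_compose2[OF ca(2)]) auto
  have cont: "continuous_on (V \<times> {0..1}) (\<lambda>(x, s). h i x s)" for i
    unfolding h_def split_beta
    by (rule continuous_on_compose2[OF holo_on_continuous[OF holo_on_pd[OF f B(1)]] cl]) (use lB in auto)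
  define G where "G i x = integral {0..1} (h i x)" for i x
  show thesis
  proof (rule that[of G])
    show "holo_on V (G i)" for i
      unfolding G_def by (rule holo_on_param_integral[OF V cont holo])
    fix x assume x: "x \<in> V"
    let ?d = "a x - b x"
    have "((\<lambda>s. \<Sum>i\<in>UNIV. ?d $ i * h i x s) has_integral (f (l x 1) - f (l x 0))) {0..1}"
    proof (rule fundamental_theorem_of_calculus)
      fix s :: real assume s: "s \<in> {0..1}"
      have 1: "((\<lambda>s. l x s) has_derivative (\<lambda>t. t *\<^sub>R ?d)) (at s within {0..1})"
        unfolding l_def by (auto intro!: derivative_eq_intros)
      have 2: "(f has_derivative (\<lambda>v. \<Sum>i\<in>UNIV. v $ i * pd i f (l x s))) (at (l x s))"
        by (rule holo_on_has_derivative[OF f lB[OF x s]])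
      have "((\<lambda>s. f (l x s)) has_derivative (\<lambda>t. \<Sum>i\<in>UNIV. (t *\<^sub>R ?d) $ i * pd i f (l x s))) (at s within {0..1})"
        by (rule has_derivative_compose[OF 1 2])
      then show "((\<lambda>s. f (l x s)) has_vector_derivative (\<Sum>i\<in>UNIV. ?d $ i * h i x s)) (at s within {0..1})"
        unfolding has_vector_derivative_def h_def
        by (rule has_derivative_eq_rhs) (simp add: fun_eq_iff scaleR_sum_right)
    qed simp
    moreover have "((\<lambda>s. \<Sum>i\<in>UNIV. ?d $ i * h i x s) has_integral (\<Sum>i\<in>UNIV. ?d $ i * G i x)) {0..1}"
    proof (intro has_integral_sum has_integral_mult_right)
      fix i
      have "continuous_on {0..1} (\<lambda>s. (\<lambda>(x, s). h i x s) (x, s))"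
        by (rule continuous_on_compose2[OF cont[of i]]) (use x in \<open>auto intro!: continuous_intros\<close>)
      then show "(h i x has_integral G i x) {0..1}"
        unfolding G_def by (intro integrable_integral integrable_continuous_real) simp
    qed auto
    ultimately have "f (l x 1) - f (l x 0) = (\<Sum>i\<in>UNIV. ?d $ i * G i x)"
      by (rule has_integral_unique)
    then show "f (a x) - f (b x) = (\<Sum>i\<in>UNIV. (a x $ i - b x $ i) * G i x)"
      by (simp add: l_def)
  qed
qed

subsection \<open>Germs in an ideal\<close>

text \<open>Coefficients indexed by all of \<open>S\<close>, zero off the finite set of the
  definition, can be added termwise.\<close>

lemma germ_in_ideal_full:
  assumes "finite S" "germ_in_ideal S z f"
  obtains W g where "open W" "z \<in> W" "\<And>s. s \<in> S \<Longrightarrow> holo_on W (g s)"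
    "\<And>w. w \<in> W \<Longrightarrow> f w = (\<Sum>s\<in>S. g s w * s w)"
proof -
  obtain W F g where W: "open W" "z \<in> W" and F: "finite F" "F \<subseteq> S" and g: "\<forall>s\<in>F. holo_on W (g s)"
    and eq: "\<forall>w\<in>W. f w = (\<Sum>s\<in>F. g s w * s w)"
    using assms(2) unfolding germ_in_ideal_def by blast
  show thesis
  proof (rule that[of W "\<lambda>s w. if s \<in> F then g s w else 0"])
    show "holo_on W (\<lambda>w. if s \<in> F then g s w else 0)" for s
      using g by (cases "s \<in> F") (auto simp: holo_on_const)
    show "f w = (\<Sum>s\<in>S. (if s \<in> F then g s w else 0) * s w)" if "w \<in> W" for w
      using eq that assms(1) F by (subst sum.mono_neutral_cong_right[of S F]) auto
  qed (use W in auto)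
qed

lemma germ_in_idealI:
  assumes "finite S" "open W" "z \<in> W" "\<And>s. s \<in> S \<Longrightarrow> holo_on W (g s)"
    "\<And>w. w \<in> W \<Longrightarrow> f w = (\<Sum>s\<in>S. g s w * s w)"
  shows "germ_in_ideal S z f"
  unfolding germ_in_ideal_def using assms by (intro exI[of _ W] exI[of _ S] exI[of _ g]) auto

lemma germ_in_ideal_add:
  assumes S: "finite S" and "germ_in_ideal S z f" "germ_in_ideal S z g"
  shows "germ_in_ideal S z (\<lambda>w. f w + g w)"
proof -
  obtain W1 c where 1: "open W1" "z \<in> W1" "\<And>s. s \<in> S \<Longrightarrow> holo_on W1 (c s)"
    "\<And>w. w \<in> W1 \<Longrightarrow> f w = (\<Sum>s\<in>S. c s w * s w)" using germ_in_ideal_full[OF assms(1,2)] by blast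
  obtain W2 d where 2: "open W2" "z \<in> W2" "\<And>s. s \<in> S \<Longrightarrow> holo_on W2 (d s)"
    "\<And>w. w \<in> W2 \<Longrightarrow> g w = (\<Sum>s\<in>S. d s w * s w)" using germ_in_ideal_full[OF assms(1,3)] by blast
  show ?thesis
  proof (rule germ_in_idealI[OF S, of "W1 \<inter> W2" _ "\<lambda>s w. c s w + d s w"])
    show "holo_on (W1 \<inter> W2) (\<lambda>w. c s w + d s w)" if "s \<in> S" for s
      using 1(3)[OF that] 2(3)[OF that] by (auto intro!: holo_on_add intro: holo_on_subset)
  qed (use 1 2 in \<open>auto simp: sum.distrib ring_distribs\<close>)
qed

lemma germ_in_ideal_mult:
  assumes S: "finite S" and "germ_in_ideal S z f" and h: "holo_on V h" "open V" "z \<in> V"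
  shows "germ_in_ideal S z (\<lambda>w. h w * f w)"
proof -
  obtain W c where 1: "open W" "z \<in> W" "\<And>s. s \<in> S \<Longrightarrow> holo_on W (c s)"
    "\<And>w. w \<in> W \<Longrightarrow> f w = (\<Sum>s\<in>S. c s w * s w)" using germ_in_ideal_full[OF assms(1,2)] by blast
  show ?thesis
  proof (rule germ_in_idealI[OF S, of "W \<inter> V" _ "\<lambda>s w. h w * c s w"])
    show "holo_on (W \<inter> V) (\<lambda>w. h w * c s w)" if "s \<in> S" for s
      using 1(3)[OF that] h(1) by (auto intro!: holo_on_mult intro: holo_on_subset)
  qed (use 1 h in \<open>auto simp: sum_distrib_left mult_ac\<close>)
qed

lemma germ_in_ideal_cong:
  assumes S: "finite S" and "germ_in_ideal S z f" and V: "open V" "z \<in> V" "\<And>w. w \<in> V \<Longrightarrow> f w = g w"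
  shows "germ_in_ideal S z g"
proof -
  obtain W c where 1: "open W" "z \<in> W" "\<And>s. s \<in> S \<Longrightarrow> holo_on W (c s)"
    "\<And>w. w \<in> W \<Longrightarrow> f w = (\<Sum>s\<in>S. c s w * s w)" using germ_in_ideal_full[OF assms(1,2)] by blast
  show ?thesis
  proof (rule germ_in_idealI[OF S, of "W \<inter> V" _ c])
    show "g w = (\<Sum>s\<in>S. c s w * s w)" if "w \<in> W \<inter> V" for w
      using 1(4)[of w] V(3)[of w] that by simp
  qed (use 1 V in \<open>auto intro: holo_on_subset[OF 1(3)]\<close>)
qed

lemma germ_in_ideal_zero: "finite S \<Longrightarrow> germ_in_ideal S z (\<lambda>w. 0)"
  by (rule germ_in_idealI[of S UNIV z "\<lambda>_ _. 0"]) (auto simp: holo_on_const)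

lemma germ_in_ideal_gen:
  assumes "finite S" "s \<in> S" shows "germ_in_ideal S z s"
proof (rule germ_in_idealI[OF assms(1), of UNIV z "\<lambda>t w. if t = s then 1 else 0"])
  show "holo_on UNIV (\<lambda>w. if t = s then 1 else 0)" for t by (cases "t = s") (auto simp: holo_on_const)
  show "s w = (\<Sum>t\<in>S. (if t = s then 1 else 0) * t w)" for w
    using assms by (simp add: if_distrib[of "\<lambda>u. u * _"] cong: if_cong)
qed auto

lemma germ_in_ideal_sum:
  assumes "finite S" "\<And>i. i \<in> I \<Longrightarrow> germ_in_ideal S z (f i)"
  shows "germ_in_ideal S z (\<lambda>w. \<Sum>i\<in>I. f i w)"
  using assms(2) by (induction I rule: infinite_finite_induct) (auto intro: germ_in_ideal_zero germ_in_ideal_add assms)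

lemma finite_Z_eqs: "finite (Z_eqs :: ('k::{finite,linorder} cotangent \<Rightarrow> complex) set)"
  unfolding Z_eqs_def
  by (intro finite_UnI finite_image_set[of "\<lambda>m. m \<in> {2..CARD('k)}"]
      finite_image_set2[of "\<lambda>p. p \<in> {1..CARD('k) - 1}" "\<lambda>q. q \<in> {2..CARD('k)}"]) auto

lemma eta_nth: "eta h w = w $ Inr (crd h)"
  by (simp add: eta_def fibre_pt_def)

lemma base_pt_nth: "base_pt w $ i = w $ Inl i"
  by (simp add: base_pt_def)

lemma holo_on_eta [holo_intros]: "holo_on U (eta h)"
  unfolding eta_nth[abs_def] by (rule holo_on_nth)

lemma holo_on_sig_base [holo_intros]: "holo_on U (\<lambda>w. sig h (base_pt w))"
  by (rule holo_on_compose[OF holo_on_sig[of UNIV]]) (auto simp: base_pt_def intro: holo_on_nth)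

lemma A_symb_in: "p \<in> {1..CARD('k) - 1} \<Longrightarrow> q \<in> {2..CARD('k)} \<Longrightarrow> (A_symb p q :: 'k::{finite,linorder} cotangent \<Rightarrow> complex) \<in> Z_eqs"
  unfolding Z_eqs_def by blast

lemma T_symb_in: "m \<in> {2..CARD('k)} \<Longrightarrow> (T_symb m :: 'k::{finite,linorder} cotangent \<Rightarrow> complex) \<in> Z_eqs"
  unfolding Z_eqs_def by blast

subsection \<open>Reducedness off the zero section\<close>

text \<open>Here x is a function, which gives a holomorphic projection \<pi> onto the variety. As f
  vanishes on the image, Hadamard's lemma expresses it by the components of w - \<pi>(w), and these
  lie in the ideal because \<eta>_k is invertible.\<close>

lemma germ_vanishing_off_zero_section:
  fixes z :: "'k::{finite,linorder} cotangent"
  assumes k: "CARD('k) \<ge> 2" and z: "z \<in> zero_locus Z_eqs" and zk: "eta CARD('k) z \<noteq> 0"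
    and f: "holo_on W f" "open W" "z \<in> W" and van: "\<And>w. w \<in> W \<Longrightarrow> w \<in> zero_locus Z_eqs \<Longrightarrow> f w = 0"
  shows "germ_in_ideal Z_eqs z f"
proof -
  let ?k = "CARD('k)"
  note fin = finite_Z_eqs[where 'k='k]
  define U0 where "U0 = {w :: 'k cotangent. eta ?k w \<noteq> 0}"
  have U0: "open U0" "z \<in> U0"
  proof -
    have "open (eta ?k -` (- {0}) :: 'k cotangent set)"
      by (rule open_vimage[OF _ holo_on_continuous[OF holo_on_eta]]) auto
    then show "open U0" by (simp add: U0_def vimage_def)
  qed (use zk in \<open>auto simp: U0_def\<close>)
  define x where "x w = eta (?k - 1) w / eta ?k w" for w :: "'k cotangent"
  have hx: "holo_on U0 x" unfolding x_def[abs_def] by (intro holo_intros) (auto simp: U0_def)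
  \<comment> \<open>Keep \<sigma>_1, ..., \<sigma>_(k-1), \<eta>_k and x, and recompute all other
    coordinates from the equations.\<close>
  define \<pi> where "\<pi> w = cotpt (base_pt w + axis (crd ?k) (- sigma_val (x w) (base_pt w))) (\<lambda>i. eta ?k w * sigma_dir (x w) i)"
    for w :: "'k cotangent"
  have \<pi>Z: "\<pi> w \<in> zero_locus Z_eqs" for w
    unfolding \<pi>_def by (rule cotpt_in_Z[OF k]) (simp add: sigma_val_add_axis)
  have hsv: "holo_on U0 (\<lambda>w. sigma_val (x w) (base_pt w))"
    unfolding sigma_val_def by (intro holo_intros hx)
  have \<pi>_holo: "holo_on U0 (\<lambda>w. \<pi> w $ i)" for i
  proof (cases i)
    case (Inl j)
    have "holo_on U0 (\<lambda>w. w $ Inl j + (if j = crd ?k then - sigma_val (x w) (base_pt w) else 0))"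
      by (cases "j = crd ?k") (auto intro!: holo_intros hsv)
    then show ?thesis by (simp add: Inl \<pi>_def axis_def base_pt_nth)
  next
    case (Inr j)
    then show ?thesis by (auto simp: \<pi>_def sigma_dir_def intro!: holo_intros hx)
  qed
  have \<pi>z: "\<pi> z = z"
  proof -
    obtain \<sigma> x0 l where P: "sigma_val x0 \<sigma> = 0" "z = cotpt \<sigma> (\<lambda>i. l * sigma_dir x0 i)"
      using zero_locus_cotptE[OF k z] .
    have "eta ?k z = l" "eta (?k - 1) z = l * x0" using k by (auto simp: P eta_nth sigma_dir_crd)
    then have "x z = x0" using zk by (simp add: x_def)
    then show ?thesis using \<open>eta ?k z = l\<close> P(1) by (simp add: \<pi>_def P(2) axis_zero)
  qed
  obtain r where r: "r > 0" "ball z r \<subseteq> W" using f open_contains_ball by blast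
  have c\<pi>: "continuous_on U0 \<pi>"
    using continuous_on_vec_lambda[of U0 "\<lambda>i w. \<pi> w $ i", OF holo_on_continuous[OF \<pi>_holo]] by simp
  define V where "V = ball z r \<inter> (U0 \<inter> \<pi> -` ball z r)"
  have "open V"
    unfolding V_def by (intro open_Int[OF open_ball] continuous_open_preimage[OF c\<pi>] U0) simp
  moreover have "z \<in> V" "V \<subseteq> U0" using U0 r \<pi>z by (auto simp: V_def)
  ultimately have V: "open V" "z \<in> V" "V \<subseteq> U0" by auto
  obtain G where G: "\<And>i. holo_on V (G i)" "\<And>w. w \<in> V \<Longrightarrow> f w - f (\<pi> w) = (\<Sum>i\<in>UNIV. (w $ i - \<pi> w $ i) * G i w)"
    by (rule hadamard[OF holo_on_subset[OF f(1) r(2)] open_ball convex_ball V(1), of "\<lambda>w. w" \<pi>])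
      (auto simp: V_def intro: holo_on_nth holo_on_subset[OF \<pi>_holo])
  \<comment> \<open>With x = \<eta>_(k-1) / \<eta>_k, dividing A_(k-j-1,k) by \<eta>_k gives
    \<eta>_(k-j-1) - x \<eta>_(k-j), the step from j to j + 1.\<close>
  have \<delta>: "germ_in_ideal Z_eqs z (\<lambda>w. eta (?k - j) w - eta ?k w * x w ^ j)" if "j < ?k" for j
    using that
  proof (induction j)
    case 0
    show ?case using germ_in_ideal_zero[OF fin] by simp
  next
    case (Suc j)
    have A: "germ_in_ideal Z_eqs z (A_symb (?k - Suc j) ?k)"
      by (rule germ_in_ideal_gen[OF fin A_symb_in]) (use Suc.prems k in auto)
    have "germ_in_ideal Z_eqs z (\<lambda>w. 1 / eta ?k w * A_symb (?k - Suc j) ?k w + x w * (eta (?k - j) w - eta ?k w * x w ^ j))"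
      by (intro germ_in_ideal_add fin germ_in_ideal_mult[OF fin A _ U0] germ_in_ideal_mult[OF fin Suc.IH hx U0] holo_intros)
        (use Suc.prems in \<open>auto simp: U0_def\<close>)
    then show ?case
    proof (rule germ_in_ideal_cong[OF fin _ U0])
      fix w assume "w \<in> U0"
      then have "eta ?k w \<noteq> 0" by (simp add: U0_def)
      moreover have "?k - Suc j + 1 = ?k - j" using Suc.prems by simp
      ultimately show "1 / eta ?k w * A_symb (?k - Suc j) ?k w + x w * (eta (?k - j) w - eta ?k w * x w ^ j) =
          eta (?k - Suc j) w - eta ?k w * x w ^ Suc j"
        unfolding A_symb_def x_def by (simp add: field_simps)
    qed
  qed
  have \<delta>': "germ_in_ideal Z_eqs z (\<lambda>w. eta h w - eta ?k w * x w ^ (?k - h))" if "h \<in> {1..?k}" for h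
    using \<delta>[of "?k - h"] that by simp
  have sv: "germ_in_ideal Z_eqs z (\<lambda>w. sigma_val (x w) (base_pt w))"
  proof -
    let ?d = "\<lambda>h w. eta h w - eta ?k w * x w ^ (?k - h)"
    have T: "germ_in_ideal Z_eqs z (T_symb ?k)"
      by (rule germ_in_ideal_gen[OF fin T_symb_in]) (use k in auto)
    have d1: "germ_in_ideal Z_eqs z (?d 1)" by (rule \<delta>') (use k in auto)
    \<comment> \<open>Replacing each \<eta>_h in T^k by \<eta>_k x^(k-h) leaves \<eta>_k^2
      P_\<sigma>(x); the replacements cost multiples of the differences just treated.\<close>
    have "germ_in_ideal Z_eqs z (\<lambda>w. 1 / (eta ?k w)\<^sup>2 * (T_symb ?k w + (- (eta ?k w * x w) * ?d 1 w +
         - eta ?k w * (\<Sum>h=1..?k. sig h (base_pt w) * ?d h w))))"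
      by (rule germ_in_ideal_mult[OF fin _ _ U0], rule germ_in_ideal_add[OF fin T], rule germ_in_ideal_add[OF fin],
          rule germ_in_ideal_mult[OF fin d1 _ U0], (intro holo_intros hx)[1],
          rule germ_in_ideal_mult[OF fin _ _ U0], rule germ_in_ideal_sum[OF fin],
          rule germ_in_ideal_mult[OF fin \<delta>' _ U0], assumption, (intro holo_intros)[1], (intro holo_intros)[1],
          intro holo_intros) (auto simp: U0_def)
    then show ?thesis
    proof (rule germ_in_ideal_cong[OF fin _ U0])
      fix w assume "w \<in> U0"
      then have n: "eta ?k w \<noteq> 0" by (simp add: U0_def)
      have e: "eta (?k - 1) w = eta ?k w * x w" using n by (simp add: x_def)
      have p: "x w ^ ?k = x w ^ (?k - 1) * x w"
        using k by (metis One_nat_def Suc_1 Suc_le_D diff_Suc_1 power_Suc2)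
      have sm: "(\<Sum>h=1..?k. sig h (base_pt w) * ?d h w) = (\<Sum>h=1..?k. sig h (base_pt w) * eta h w) -
          eta ?k w * (\<Sum>h=1..?k. sig h (base_pt w) * x w ^ (?k - h))"
        unfolding sum_distrib_left sum_subtractf[symmetric] by (intro sum.cong refl) (simp add: algebra_simps)
      have "T_symb ?k w + (- (eta ?k w * x w) * ?d 1 w + - eta ?k w * (\<Sum>h=1..?k. sig h (base_pt w) * ?d h w)) =
         (eta ?k w)\<^sup>2 * sigma_val (x w) (base_pt w)"
        unfolding sm T_symb_def sigma_val_def e p by (simp add: power2_eq_square algebra_simps)
      then show "1 / (eta ?k w)\<^sup>2 * (T_symb ?k w + (- (eta ?k w * x w) * ?d 1 w +
         - eta ?k w * (\<Sum>h=1..?k. sig h (base_pt w) * ?d h w))) = sigma_val (x w) (base_pt w)"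
        using n by simp
    qed
  qed
  have comp: "germ_in_ideal Z_eqs z (\<lambda>w. w $ i - \<pi> w $ i)" for i
  proof (cases i)
    case (Inl j)
    show ?thesis
      by (cases "j = crd ?k")
        (use sv germ_in_ideal_zero[OF fin] in \<open>simp_all add: Inl \<pi>_def axis_def base_pt_nth\<close>)
  next
    case (Inr j)
    obtain h where h: "h \<in> {1..?k}" "j = crd h" by (metis crd_surj)
    show ?thesis using \<delta>'[OF h(1)] h by (simp add: Inr \<pi>_def eta_nth sigma_dir_crd)
  qed
  have "germ_in_ideal Z_eqs z (\<lambda>w. \<Sum>i\<in>UNIV. G i w * (w $ i - \<pi> w $ i))"
    by (intro germ_in_ideal_sum fin germ_in_ideal_mult[OF fin comp G(1) V(1,2)])
  then show ?thesis
  proof (rule germ_in_ideal_cong[OF fin _ V(1,2)])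
    fix w assume w: "w \<in> V"
    have "f (\<pi> w) = 0" by (rule van[OF _ \<pi>Z]) (use w r in \<open>auto simp: V_def\<close>)
    then show "(\<Sum>i\<in>UNIV. G i w * (w $ i - \<pi> w $ i)) = f w" using G(2)[OF w] by (simp add: mult.commute)
  qed
qed


subsection \<open>Circle means\<close>

text \<open>The mean value property at infinity: inversion maps the circle of radius R to that of
  radius 1/R with reversed orientation, and a mean does not notice the orientation.\<close>

lemma circle_mean_inverse:
  assumes R: "R > 0" and h: "h holomorphic_on U" "open U" "cball 0 (1 / R) \<subseteq> U"
  shows "((\<lambda>s. h (1 / (of_real R * cis (2 * pi * s)))) has_integral h 0) {0..1}"
proof -
  have "((\<lambda>s. h (of_real (1 / R) * cis (2 * pi * s))) has_integral h 0) (cbox 0 1)"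
    using circle_mean_value[OF _ h] R by (simp add: box_real)
  from has_integral_affinity[OF this, of "- 1" 1]
  have "((\<lambda>s. h (of_real (1 / R) * cis (2 * pi * (1 - s)))) has_integral h 0) ((\<lambda>x. - x + 1) ` {0..1})"
    by (simp add: box_real)
  moreover have "(\<lambda>x::real. - x + 1) ` {0..1} = {0..1}"
    by (auto simp: image_iff intro!: bexI[of _ "1 - _"])
  moreover have "of_real (1 / R) * cis (2 * pi * (1 - s)) = 1 / (of_real R * cis (2 * pi * s))" for s
  proof -
    have "cis (2 * pi * (1 - s)) = cis (2 * pi) * cis (- (2 * pi * s))" by (simp add: cis_mult algebra_simps)
    also have "\<dots> = inverse (cis (2 * pi * s))" by simp
    finally have c: "cis (2 * pi * (1 - s)) = inverse (cis (2 * pi * s))" .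
    show ?thesis unfolding c by (simp only: divide_inverse inverse_mult_distrib of_real_mult of_real_inverse of_real_1 mult_1)
  qed
  ultimately show ?thesis by simp
qed

text \<open>Riemann's theorem, one point at a time; an extension over one point leaves the values
  near the remaining points, hence their bounds, unchanged.\<close>

lemma holomorphic_extend_finite:
  assumes "finite K" "open D" "K \<subseteq> D" "q holomorphic_on (D - K)"
    "\<And>\<xi>. \<xi> \<in> K \<Longrightarrow> \<exists>B. eventually (\<lambda>u. norm (q u) \<le> B) (at \<xi>)"
  shows "\<exists>g. g holomorphic_on D \<and> (\<forall>u\<in>D - K. g u = q u)"
  using assms
proof (induction K arbitrary: q rule: finite_induct)
  case empty then show ?case by auto
next
  case (insert \<xi> K)
  let ?S = "D - K"
  have oS: "open ?S" using insert.prems(1) insert.hyps(1) by (simp add: open_Diff finite_imp_closed)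
  have "\<xi> \<in> ?S" using insert.hyps(2) insert.prems(2) by auto
  then have \<xi>: "\<xi> \<in> interior ?S" by (simp only: interior_open[OF oS])
  have "q holomorphic_on ?S - {\<xi>}"
    by (subst Diff_insert[symmetric]) (rule insert.prems(3))
  from iffD2[OF holomorphic_on_extend_bounded[OF this \<xi>] insert.prems(4)[OF insertI1]]
  obtain q' where q': "q' holomorphic_on ?S" "\<forall>u\<in>?S - {\<xi>}. q' u = q u" by (elim exE conjE)
  have "\<exists>B. eventually (\<lambda>u. norm (q' u) \<le> B) (at \<zeta>)" if \<zeta>: "\<zeta> \<in> K" for \<zeta>
  proof -
    obtain B where B: "eventually (\<lambda>u. norm (q u) \<le> B) (at \<zeta>)" using insert.prems(4)[of \<zeta>] \<zeta> by auto
    have "open (D - insert \<xi> (K - {\<zeta>}))"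
      by (intro open_Diff insert.prems(1) finite_imp_closed) (simp add: insert.hyps(1))
    moreover have "\<zeta> \<in> D - insert \<xi> (K - {\<zeta>})" using insert.hyps(2) insert.prems(2) \<zeta> by auto
    ultimately have "eventually (\<lambda>u. u \<in> D - insert \<xi> (K - {\<zeta>}) - {\<zeta>}) (at \<zeta>)"
      unfolding eventually_at_topological by blast
    with B have "eventually (\<lambda>u. norm (q' u) \<le> B) (at \<zeta>)"
      by eventually_elim (use q' in auto)
    then show ?thesis by blast
  qed
  then obtain g where g: "g holomorphic_on D" "\<forall>u\<in>D - K. g u = q' u"
    using insert.IH[OF insert.prems(1) _ q'(1)] insert.prems(2) by auto
  then show ?case using q'(2) by (intro exI[of _ g]) auto
qed

lemma sigma_val_sum: "sigma_val u (\<sigma> :: 'k::{finite,linorder} base) = (\<Sum>h\<le>CARD('k). sig h \<sigma> * u ^ (CARD('k) - h))"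
proof -
  have "{..CARD('k)} = insert 0 {1..CARD('k)}" by auto
  then show ?thesis by (simp add: sigma_val_def)
qed

text \<open>Up to a power of u, the inner sum is P(u) cut off after \<sigma>_(k-b-1), so the
  integrand is u^(i-b) (1 - tail / P). For i \<le> b it is holomorphic at infinity with the stated
  value there. For i > b the first term has mean zero, and the second vanishes at infinity because
  its numerator has degree at most i < k.\<close>

lemma horner_circle_mean:
  fixes \<sigma> :: "'k::{finite,linorder} base"
  assumes R: "R > 0" and nz: "\<And>u. norm u \<ge> R \<Longrightarrow> sigma_val u \<sigma> \<noteq> 0"
    and i: "i < CARD('k)" and b: "b < CARD('k)"
  defines "c \<equiv> \<lambda>s. complex_of_real R * cis (2 * pi * s)"
  shows "((\<lambda>s. c s ^ Suc i * (\<Sum>h<CARD('k) - b. sig h \<sigma> * c s ^ (CARD('k) - 1 - b - h)) / sigma_val (c s) \<sigma>)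
     has_integral (if i = b then 1 else 0)) {0..1}"
proof -
  let ?k = "CARD('k)"
  \<comment> \<open>The reversed polynomial v^k P(1/v), which is P in the coordinate at infinity: it
    is 1 at v = 0 and has no zero with |v| \<le> 1/R.\<close>
  define rv where "rv v = (\<Sum>h\<le>?k. sig h \<sigma> * v ^ h)" for v
  have rv: "sigma_val (1 / v) \<sigma> = rv v / v ^ ?k" if "v \<noteq> 0" for v
    unfolding sigma_val_sum rv_def sum_divide_distrib using that
    by (intro sum.cong refl) (simp add: power_divide power_diff)
  have rv0: "rv 0 = 1"
  proof -
    have "rv 0 = (\<Sum>h\<le>?k. if h = 0 then 1 else 0)" unfolding rv_def by (intro sum.cong refl) auto
    then show ?thesis by simp
  qed
  have hrv: "rv holomorphic_on A" for A unfolding rv_def[abs_def] by (intro holomorphic_intros)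
  define U where "U = {v. rv v \<noteq> 0}"
  have U: "open U"
  proof -
    have "open (rv -` (- {0}))"
      by (rule open_vimage[OF _ holomorphic_on_imp_continuous_on[OF hrv]]) auto
    then show ?thesis by (simp add: U_def vimage_def)
  qed
  have UR: "cball 0 (1 / R) \<subseteq> U"
  proof
    fix v :: complex assume "v \<in> cball 0 (1 / R)"
    then have v: "norm v \<le> 1 / R" by simp
    show "v \<in> U"
    proof (cases "v = 0")
      case False
      then have "norm (1 / v) \<ge> R" using v R by (simp add: norm_divide field_simps)
      from nz[OF this] False show ?thesis by (simp add: U_def rv)
    qed (simp add: U_def rv0)
  qed
  have c0: "c s \<noteq> 0" for s using R by (simp add: c_def)
  have cn: "norm (c s) = R" for s using R by (simp add: c_def norm_mult)
  have val: "sigma_val (c s) \<sigma> = c s ^ ?k * rv (1 / c s)" for s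
    using rv[of "1 / c s"] c0[of s] by (simp add: power_divide)
  have rvn: "rv (1 / c s) \<noteq> 0" for s
    using nz[of "c s"] cn[of s] val[of s] by auto
  have cmul: "c s ^ m * (1 / c s) ^ n = c s ^ (m - n)" if "n \<le> m" for s m n
    using that c0[of s] by (simp add: power_divide power_diff)
  show ?thesis
  proof (cases "i \<le> b")
    case True
    define q where "q v = v ^ (b - i) * (\<Sum>h<?k - b. sig h \<sigma> * v ^ h) / rv v" for v
    have "q holomorphic_on U" unfolding q_def[abs_def]
      by (intro holomorphic_intros hrv) (auto simp: U_def)
    from circle_mean_inverse[OF R this U UR]
    have "((\<lambda>s. q (1 / c s)) has_integral q 0) {0..1}" by (simp add: c_def)
    moreover have "q 0 = (if i = b then 1 else 0)"
    proof -
      have "(\<Sum>h<?k - b. sig h \<sigma> * 0 ^ h) = (\<Sum>h<?k - b. if h = 0 then 1 else (0::complex))" by (intro sum.cong refl) auto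
      then show ?thesis using True b by (auto simp: q_def rv0)
    qed
    moreover have "q (1 / c s) = c s ^ Suc i * (\<Sum>h<?k - b. sig h \<sigma> * c s ^ (?k - 1 - b - h)) / sigma_val (c s) \<sigma>" for s
    proof -
      have "c s ^ Suc i * (\<Sum>h<?k - b. sig h \<sigma> * c s ^ (?k - 1 - b - h)) =
          c s ^ ?k * ((1 / c s) ^ (b - i) * (\<Sum>h<?k - b. sig h \<sigma> * (1 / c s) ^ h))"
        unfolding sum_distrib_left
      proof (intro sum.cong refl)
        fix h assume h: "h \<in> {..<?k - b}"
        have "c s ^ ?k * (1 / c s) ^ (b - i + h) = c s ^ (?k - (b - i + h))" using h b by (intro cmul) auto
        moreover have "?k - (b - i + h) = Suc i + (?k - 1 - b - h)" using h True b by auto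
        ultimately have e: "c s ^ ?k * (1 / c s) ^ (b - i + h) = c s ^ Suc i * c s ^ (?k - 1 - b - h)"
          by (simp only: power_add)
        have "c s ^ ?k * ((1 / c s) ^ (b - i) * (sig h \<sigma> * (1 / c s) ^ h)) =
          sig h \<sigma> * (c s ^ ?k * (1 / c s) ^ (b - i + h))" by (simp only: power_add mult_ac)
        then show "c s ^ Suc i * (sig h \<sigma> * c s ^ (?k - 1 - b - h)) =
          c s ^ ?k * ((1 / c s) ^ (b - i) * (sig h \<sigma> * (1 / c s) ^ h))" unfolding e by (simp only: mult_ac)
      qed
      then show ?thesis unfolding val q_def using c0[of s] rvn[of s] by (simp add: field_simps)
    qed
    ultimately show ?thesis by simp
  next
    case False
    define q where "q v = (\<Sum>h\<in>{?k - b..?k}. sig h \<sigma> * v ^ (h - (i - b))) / rv v" for v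
    have "q holomorphic_on U" unfolding q_def[abs_def]
      by (intro holomorphic_intros hrv) (auto simp: U_def)
    from circle_mean_inverse[OF R this U UR]
    have i1: "((\<lambda>s. q (1 / c s)) has_integral q 0) {0..1}" by (simp add: c_def)
    have q0: "q 0 = 0"
      unfolding q_def using False i by (simp, intro disjI1 sum.neutral ballI) auto
    have i2: "((\<lambda>s. c s ^ (i - b)) has_integral 0) {0..1}"
    proof -
      have "((\<lambda>s. c s ^ (i - b)) has_integral 0 ^ (i - b)) {0..1}"
        unfolding c_def by (rule circle_mean_value[OF R, of "\<lambda>u. u ^ (i - b)" UNIV]) (auto intro!: holomorphic_intros)
      then show ?thesis using False by (simp add: power_0_left)
    qed
    have "((\<lambda>s. c s ^ (i - b) - q (1 / c s)) has_integral 0) {0..1}"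
      using has_integral_diff[OF i2 i1] by (simp only: q0 diff_0_right)
    moreover have "c s ^ (i - b) - q (1 / c s) =
        c s ^ Suc i * (\<Sum>h<?k - b. sig h \<sigma> * c s ^ (?k - 1 - b - h)) / sigma_val (c s) \<sigma>" for s
    proof -
      have 1: "c s ^ Suc i * (\<Sum>h<?k - b. sig h \<sigma> * c s ^ (?k - 1 - b - h)) =
         c s ^ (i - b) * (\<Sum>h<?k - b. sig h \<sigma> * c s ^ (?k - h))"
        unfolding sum_distrib_left
      proof (intro sum.cong refl)
        fix h assume "h \<in> {..<?k - b}"
        then have "Suc i + (?k - 1 - b - h) = (i - b) + (?k - h)" using False by auto
        then have "c s ^ Suc i * c s ^ (?k - 1 - b - h) = c s ^ (i - b) * c s ^ (?k - h)"
          by (simp only: power_add[symmetric])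
        then show "c s ^ Suc i * (sig h \<sigma> * c s ^ (?k - 1 - b - h)) = c s ^ (i - b) * (sig h \<sigma> * c s ^ (?k - h))"
          by (simp only: mult.left_commute)
      qed
      have 2: "c s ^ (i - b) * (\<Sum>h\<in>{?k - b..?k}. sig h \<sigma> * c s ^ (?k - h)) =
          c s ^ ?k * (\<Sum>h\<in>{?k - b..?k}. sig h \<sigma> * (1 / c s) ^ (h - (i - b)))"
        unfolding sum_distrib_left
      proof (intro sum.cong refl)
        fix h assume h: "h \<in> {?k - b..?k}"
        then have "c s ^ ?k * (1 / c s) ^ (h - (i - b)) = c s ^ (?k - (h - (i - b)))" by (intro cmul) auto
        moreover have "?k - (h - (i - b)) = (i - b) + (?k - h)" using h i False by auto
        ultimately have "c s ^ ?k * (1 / c s) ^ (h - (i - b)) = c s ^ (i - b) * c s ^ (?k - h)"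
          by (simp only: power_add)
        then show "c s ^ (i - b) * (sig h \<sigma> * c s ^ (?k - h)) = c s ^ ?k * (sig h \<sigma> * (1 / c s) ^ (h - (i - b)))"
          by (simp only: mult.left_commute)
      qed
      have un: "{..?k} = {..<?k - b} \<union> {?k - b..?k}" by auto
      have 3: "sigma_val (c s) \<sigma> = (\<Sum>h<?k - b. sig h \<sigma> * c s ^ (?k - h)) +
          (\<Sum>h\<in>{?k - b..?k}. sig h \<sigma> * c s ^ (?k - h))"
        unfolding sigma_val_sum un by (rule sum.union_disjoint) auto
      have "c s ^ Suc i * (\<Sum>h<?k - b. sig h \<sigma> * c s ^ (?k - 1 - b - h)) =
         c s ^ (i - b) * sigma_val (c s) \<sigma> - c s ^ ?k * (rv (1 / c s) * q (1 / c s))"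
        unfolding 1 3 ring_distribs 2 q_def using rvn[of s] by simp
      then show ?thesis unfolding val using c0[of s] rvn[of s] by (simp add: field_simps)
    qed
    ultimately show ?thesis using False by simp
  qed
qed

subsection \<open>The ideal over the product with the auxiliary line\<close>

text \<open>A point of \<open>complex ^ ('k + 'k) option\<close> is a pair of a cotangent vector and a complex number \<open>u\<close>,
  the latter stored at the index \<open>None\<close>.\<close>

definition pr :: "complex ^ ('k + 'k) option \<Rightarrow> 'k::finite cotangent" where
  "pr x = (\<chi> i. x $ Some i)"

definition jn :: "'k::finite cotangent \<Rightarrow> complex \<Rightarrow> complex ^ ('k + 'k) option" where
  "jn w u = (\<chi> i. case i of None \<Rightarrow> u | Some j \<Rightarrow> w $ j)"

lemma pr_jn [simp]: "pr (jn w u) = w" "jn w u $ None = u" "jn w u $ Some i = w $ i" "pr x $ i = x $ Some i"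
  by (simp_all add: pr_def jn_def vec_eq_iff)

lemma holo_on_pr: "holo_on UNIV s \<Longrightarrow> holo_on U (\<lambda>x. s (pr x))"
  by (rule holo_on_compose[of UNIV]) (auto simp: holo_on_nth)

text \<open>The congruences below are polynomial identities, so their coefficients may be demanded
  entire; they can then be evaluated along the whole circle in u and not just near one
  point.\<close>

definition in_Z_ideal :: "(complex ^ ('k::{finite,linorder} + 'k) option \<Rightarrow> complex) \<Rightarrow> bool" where
  "in_Z_ideal h \<longleftrightarrow> (\<exists>c. (\<forall>s\<in>Z_eqs. holo_on UNIV (c s)) \<and> (\<forall>x. h x = (\<Sum>s\<in>Z_eqs. c s x * s (pr x))))"


lemma in_Z_ideal_add:
  assumes "in_Z_ideal f" "in_Z_ideal g" shows "in_Z_ideal (\<lambda>x. f x + g x)"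
proof -
  obtain c where c: "\<forall>s\<in>Z_eqs. holo_on UNIV (c s)" "\<forall>x. f x = (\<Sum>s\<in>Z_eqs. c s x * s (pr x))"
    using assms(1) unfolding in_Z_ideal_def by blast
  obtain d where d: "\<forall>s\<in>Z_eqs. holo_on UNIV (d s)" "\<forall>x. g x = (\<Sum>s\<in>Z_eqs. d s x * s (pr x))"
    using assms(2) unfolding in_Z_ideal_def by blast
  show ?thesis unfolding in_Z_ideal_def
    by (rule exI[of _ "\<lambda>s x. c s x + d s x"]) (use c d in \<open>auto simp: sum.distrib ring_distribs intro: holo_on_add\<close>)
qed

lemma in_Z_ideal_mult:
  assumes "in_Z_ideal f" "holo_on UNIV g" shows "in_Z_ideal (\<lambda>x. g x * f x)"
proof -
  obtain c where c: "\<forall>s\<in>Z_eqs. holo_on UNIV (c s)" "\<forall>x. f x = (\<Sum>s\<in>Z_eqs. c s x * s (pr x))"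
    using assms(1) unfolding in_Z_ideal_def by blast
  show ?thesis unfolding in_Z_ideal_def
    by (rule exI[of _ "\<lambda>s x. g x * c s x"]) (use c assms(2) in \<open>auto simp: sum_distrib_left mult.assoc intro: holo_on_mult\<close>)
qed

lemma in_Z_ideal_zero: "in_Z_ideal (\<lambda>x. 0)"
  unfolding in_Z_ideal_def by (rule exI[of _ "\<lambda>_ _. 0"]) (simp add: holo_on_const)

lemma in_Z_ideal_sum: "(\<And>i. i \<in> I \<Longrightarrow> in_Z_ideal (f i)) \<Longrightarrow> in_Z_ideal (\<lambda>x. \<Sum>i\<in>I. f i x)"
  by (induction I rule: infinite_finite_induct) (auto intro: in_Z_ideal_zero in_Z_ideal_add)

lemma in_Z_ideal_gen:
  assumes "s \<in> Z_eqs" shows "in_Z_ideal (\<lambda>x. s (pr x))"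
  unfolding in_Z_ideal_def
proof (intro exI conjI ballI allI)
  show "holo_on UNIV (\<lambda>x. if t = s then 1 else 0)" for t :: "'a cotangent \<Rightarrow> complex"
    by (cases "t = s") (auto simp: holo_on_const)
  show "s (pr x) = (\<Sum>t\<in>Z_eqs. (if t = s then 1 else 0) * t (pr x))" for x
    using assms by (simp add: finite_Z_eqs if_distrib[of "\<lambda>u. u * _"] cong: if_cong)
qed

lemma holo_on_eta_pr [holo_intros]: "holo_on U (\<lambda>x. eta h (pr x))"
  by (rule holo_on_pr[OF holo_on_eta])

lemma holo_on_sig_pr [holo_intros]: "holo_on U (\<lambda>x. sig h (base_pt (pr x)))"
  by (rule holo_on_pr[OF holo_on_sig_base])

text \<open>Modulo the relations \<open>A_symb\<close> a product \<open>\<eta>\<^sub>i \<eta>\<^sub>j\<close> depends only on the exponent \<open>N = 2 k - i - j\<close>,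
  as on the curve \<open>\<eta>\<^sub>h = l x\<^bsup>k - h\<^esup>\<close>; the function \<open>quad N\<close> is a representative.\<close>

definition quad :: "nat \<Rightarrow> 'k::{finite,linorder} cotangent \<Rightarrow> complex" where
  "quad N w = (if N \<le> CARD('k) - 1 then eta CARD('k) w * eta (CARD('k) - N) w
     else eta 1 w * eta (2 * CARD('k) - 1 - N) w)"

lemma holo_on_quad_pr [holo_intros]: "holo_on U (\<lambda>x. quad N (pr x))"
  unfolding quad_def by (cases "N \<le> CARD('a) - 1") (auto intro!: holo_intros)

text \<open>The relation A_(i,j) moves i up and j down with i + j fixed; the motion ends at i = k or
  at j = 1, the two shapes in the definition of \<open>quad\<close>.\<close>

lemma eta_mult_quad:
  assumes "i \<in> {1..CARD('k)}" "j \<in> {1..CARD('k)}"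
  shows "in_Z_ideal (\<lambda>x. eta i (pr x) * eta j (pr x) - quad (2 * CARD('k) - i - j) (pr x :: 'k::{finite,linorder} cotangent))"
  using assms
proof (induction "CARD('k) - i" arbitrary: i j)
  case 0
  then have i: "i = CARD('k)" by simp
  have "2 * CARD('k) - i - j = CARD('k) - j" "CARD('k) - (CARD('k) - j) = j" "CARD('k) - j \<le> CARD('k) - 1"
    using 0 i by auto
  then show ?case unfolding i quad_def using in_Z_ideal_zero by simp
next
  case (Suc n)
  have iless: "i < CARD('k)" using Suc.hyps(2) by simp
  show ?case
  proof (cases "j = 1")
    case True
    have "\<not> 2 * CARD('k) - i - j \<le> CARD('k) - 1" "2 * CARD('k) - 1 - (2 * CARD('k) - i - j) = i"
      using iless True Suc.prems by auto
    then show ?thesis unfolding quad_def using in_Z_ideal_zero by (simp add: True mult.commute)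
  next
    case False
    have A: "in_Z_ideal (\<lambda>x. A_symb i j (pr x :: 'k cotangent))"
      by (rule in_Z_ideal_gen, rule A_symb_in) (use iless False Suc.prems in auto)
    have "in_Z_ideal (\<lambda>x. eta (i + 1) (pr x) * eta (j - 1) (pr x) - quad (2 * CARD('k) - (i + 1) - (j - 1)) (pr x :: 'k cotangent))"
      by (rule Suc.hyps(1)) (use Suc.hyps(2) False Suc.prems in auto)
    from in_Z_ideal_add[OF A this] show ?thesis
      using False Suc.prems iless by (simp add: A_symb_def)
  qed
qed

text \<open>For \<open>Y N = x\<^bsup>N\<^esup>\<close> both sides are \<open>(x\<^bsup>n\<^esup> - u\<^bsup>n\<^esup>) (x\<^bsup>d\<^esup> - u\<^bsup>d\<^esup>) / (x - u)\<close>.\<close>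

lemma divided_difference_symmetry:
  fixes u :: "'a::comm_ring_1" and Y :: "nat \<Rightarrow> 'a"
  shows "(\<Sum>b<n. u ^ (n - 1 - b) * (Y (d + b) - u ^ d * Y b)) = (\<Sum>a<d. u ^ (d - 1 - a) * (Y (n + a) - u ^ n * Y a))"
proof (induction n)
  case 0 show ?case by simp
next
  case (Suc n)
  have "(\<Sum>b<n. u ^ (n - b) * (Y (d + b) - u ^ d * Y b)) = u * (\<Sum>b<n. u ^ (n - 1 - b) * (Y (d + b) - u ^ d * Y b))"
    unfolding sum_distrib_left
  proof (intro sum.cong refl)
    fix b assume "b \<in> {..<n}"
    then have "n - b = Suc (n - 1 - b)" by auto
    then show "u ^ (n - b) * (Y (d + b) - u ^ d * Y b) = u * (u ^ (n - 1 - b) * (Y (d + b) - u ^ d * Y b))"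
      by (simp only: power_Suc mult.assoc)
  qed
  then have "(\<Sum>b<Suc n. u ^ (Suc n - 1 - b) * (Y (d + b) - u ^ d * Y b)) =
      u * (\<Sum>a<d. u ^ (d - 1 - a) * (Y (n + a) - u ^ n * Y a)) + (Y (d + n) - u ^ d * Y n)"
    unfolding Suc.IH[symmetric] by simp
  moreover have "(\<Sum>a<d. u ^ (d - 1 - a) * (Y (Suc n + a) - u ^ Suc n * Y a)) -
      u * (\<Sum>a<d. u ^ (d - 1 - a) * (Y (n + a) - u ^ n * Y a)) = Y (n + d) - u ^ d * Y n"
  proof -
    have "(\<Sum>a<d. u ^ (d - 1 - a) * (Y (Suc n + a) - u ^ Suc n * Y a)) -
      u * (\<Sum>a<d. u ^ (d - 1 - a) * (Y (n + a) - u ^ n * Y a)) =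
      (\<Sum>a<d. u ^ (d - Suc a) * Y (n + Suc a) - u ^ (d - a) * Y (n + a))"
      unfolding sum_distrib_left sum_subtractf[symmetric]
    proof (intro sum.cong refl)
      fix a assume "a \<in> {..<d}"
      define m where "m = d - 1 - a"
      then have e: "d - 1 - a = m" "d - Suc a = m" "d - a = Suc m" using \<open>a \<in> {..<d}\<close> by auto
      show "u ^ (d - 1 - a) * (Y (Suc n + a) - u ^ Suc n * Y a) - u * (u ^ (d - 1 - a) * (Y (n + a) - u ^ n * Y a)) =
         u ^ (d - Suc a) * Y (n + Suc a) - u ^ (d - a) * Y (n + a)"
        unfolding e by (simp add: algebra_simps)
    qed
    also have "\<dots> = Y (n + d) - u ^ d * Y n"
      using sum_lessThan_telescope[of "\<lambda>a. u ^ (d - a) * Y (n + a)" d] by simp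
    finally show ?thesis .
  qed
  ultimately show ?case by (simp add: algebra_simps)
qed

text \<open>The polynomial \<open>l (P(u) - P(x)) / (u - x)\<close> in \<open>u\<close>, with \<open>l x\<^bsup>b\<^esup>\<close> replaced by \<open>\<eta>\<^sub>k\<^sub>-\<^sub>b\<close>.\<close>

definition Snum :: "complex ^ ('k::{finite,linorder} + 'k) option \<Rightarrow> complex" where
  "Snum x = (\<Sum>h<CARD('k). \<Sum>b<CARD('k) - h. sig h (base_pt (pr x)) *
     (x $ None ^ (CARD('k) - h - 1 - b) * eta (CARD('k) - b) (pr x)))"

lemma holo_on_Snum [holo_intros]: "holo_on U Snum"
  unfolding Snum_def[abs_def] by (intro holo_intros)

text \<open>Sorted by fibre coordinates, the coefficients of S are exactly the polynomials of
  \<open>horner_circle_mean\<close>.\<close>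

lemma Snum_swap:
  "Snum (x :: complex ^ ('k::{finite,linorder} + 'k) option) = (\<Sum>b<CARD('k). eta (CARD('k) - b) (pr x) *
     (\<Sum>h<CARD('k) - b. sig h (base_pt (pr x)) * x $ None ^ (CARD('k) - 1 - b - h)))"
proof -
  let ?k = "CARD('k)"
  let ?t = "\<lambda>h b. if h + b < ?k then sig h (base_pt (pr x)) * x $ None ^ (?k - 1 - b - h) * eta (?k - b) (pr x) else 0"
  have "Snum x = (\<Sum>h<?k. \<Sum>b<?k. ?t h b)"
    unfolding Snum_def by (intro sum.cong refl sum.mono_neutral_cong_left) (auto simp: algebra_simps diff_right_commute)
  also have "\<dots> = (\<Sum>b<?k. \<Sum>h<?k. ?t h b)" by (rule sum.swap)
  also have "\<dots> = (\<Sum>b<?k. eta (?k - b) (pr x) * (\<Sum>h<?k - b. sig h (base_pt (pr x)) * x $ None ^ (?k - 1 - b - h)))"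
    unfolding sum_distrib_left by (intro sum.cong refl sum.mono_neutral_cong_right) (auto simp: algebra_simps)
  finally show ?thesis .
qed

lemma Snum_circle_mean:
  fixes w :: "'k::{finite,linorder} cotangent"
  assumes R: "R > 0" and nz: "\<And>u. norm u \<ge> R \<Longrightarrow> sigma_val u (base_pt w) \<noteq> 0" and i: "i < CARD('k)"
  defines "c \<equiv> \<lambda>s. complex_of_real R * cis (2 * pi * s)"
  shows "((\<lambda>s. c s ^ i * (c s * Snum (jn w (c s)) / sigma_val (c s) (base_pt w))) has_integral eta (CARD('k) - i) w) {0..1}"
proof -
  let ?k = "CARD('k)"
  have "((\<lambda>s. \<Sum>b<?k. eta (?k - b) w * (c s ^ Suc i * (\<Sum>h<?k - b. sig h (base_pt w) * c s ^ (?k - 1 - b - h)) /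
     sigma_val (c s) (base_pt w))) has_integral (\<Sum>b<?k. eta (?k - b) w * (if i = b then 1 else 0))) {0..1}"
    unfolding c_def
    by (intro has_integral_sum has_integral_mult_right horner_circle_mean[OF R nz i]) auto
  moreover have "(\<Sum>b<?k. eta (?k - b) w * (if i = b then 1 else 0)) = eta (?k - i) w"
    using i by (simp add: if_distrib[of "\<lambda>u. _ * u"] cong: if_cong)
  moreover have "(\<Sum>b<?k. eta (?k - b) w * (c s ^ Suc i * (\<Sum>h<?k - b. sig h (base_pt w) * c s ^ (?k - 1 - b - h)) /
     sigma_val (c s) (base_pt w))) = c s ^ i * (c s * Snum (jn w (c s)) / sigma_val (c s) (base_pt w))" for s
    unfolding Snum_swap by (simp add: sum_distrib_left sum_divide_distrib mult_ac)
  ultimately show ?thesis by simp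
qed

text \<open>This is T^(k-a), rewritten by \<open>quad\<close>; on the curve it reads l^2 x^a
  P_\<sigma>(x) = 0. The bound on \<open>a\<close> keeps the index k - a at least 2.\<close>

lemma quad_T:
  assumes a: "a + 2 \<le> CARD('k)"
  shows "in_Z_ideal (\<lambda>x. \<Sum>h\<le>CARD('k). sig h (base_pt (pr x)) * quad (CARD('k) - h + a) (pr x :: 'k::{finite,linorder} cotangent))"
proof -
  let ?k = "CARD('k)"
  let ?m = "?k - a"
  have T: "in_Z_ideal (\<lambda>x. T_symb ?m (pr x :: 'k cotangent))"
    by (rule in_Z_ideal_gen, rule T_symb_in) (use a in auto)
  have 1: "in_Z_ideal (\<lambda>x. eta 1 (pr x) * eta (?m - 1) (pr x) - quad (2 * ?k - 1 - (?m - 1)) (pr x :: 'k cotangent))"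
    by (rule eta_mult_quad) (use a in auto)
  have 2: "in_Z_ideal (\<lambda>x. eta ?m (pr x) * eta h (pr x) - quad (2 * ?k - ?m - h) (pr x :: 'k cotangent))"
    if "h \<in> {1..?k}" for h
    by (rule eta_mult_quad) (use a that in auto)
  have "in_Z_ideal (\<lambda>x. T_symb ?m (pr x :: 'k cotangent) +
      (- 1 * (eta 1 (pr x) * eta (?m - 1) (pr x) - quad (2 * ?k - 1 - (?m - 1)) (pr x)) +
       (\<Sum>h=1..?k. - sig h (base_pt (pr x)) * (eta ?m (pr x) * eta h (pr x) - quad (2 * ?k - ?m - h) (pr x)))))"
    by (intro in_Z_ideal_add in_Z_ideal_sum in_Z_ideal_mult T 1 2 holo_intros)
  moreover have "T_symb ?m w + (- 1 * (eta 1 w * eta (?m - 1) w - quad (2 * ?k - 1 - (?m - 1)) w) +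
       (\<Sum>h=1..?k. - sig h (base_pt w) * (eta ?m w * eta h w - quad (2 * ?k - ?m - h) w))) =
     (\<Sum>h\<le>?k. sig h (base_pt w) * quad (?k - h + a) w)" for w :: "'k cotangent"
  proof -
    have e: "2 * ?k - 1 - (?m - 1) = ?k + a" using a by auto
    have "{..?k} = insert 0 {1..?k}" by auto
    then have s: "(\<Sum>h\<le>?k. sig h (base_pt w) * quad (?k - h + a) w) =
        quad (?k + a) w + (\<Sum>h=1..?k. sig h (base_pt w) * quad (?k - h + a) w)" by simp
    have "(\<Sum>h=1..?k. - sig h (base_pt w) * (eta ?m w * eta h w - quad (2 * ?k - ?m - h) w)) =
        (\<Sum>h=1..?k. sig h (base_pt w) * quad (?k - h + a) w) - eta ?m w * (\<Sum>h=1..?k. sig h (base_pt w) * eta h w)"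
      unfolding sum_distrib_left sum_subtractf[symmetric]
    proof (intro sum.cong refl)
      fix h assume "h \<in> {1..?k}"
      then have e: "2 * ?k - ?m - h = ?k - h + a" using a by auto
      show "- sig h (base_pt w) * (eta ?m w * eta h w - quad (2 * ?k - ?m - h) w) =
         sig h (base_pt w) * quad (?k - h + a) w - eta ?m w * (sig h (base_pt w) * eta h w)"
        unfolding e by (simp add: algebra_simps)
    qed
    then show ?thesis unfolding s e T_symb_def by simp
  qed
  ultimately show ?thesis by simp
qed

text \<open>Put d = k - p. Replacing products \<eta>_i \<eta>_j by \<open>quad\<close> turns the
  first summand into a combination of Y(d+b) - u^d Y(b), and
  \<open>divided_difference_symmetry\<close> exchanges the roles of d and k - h. The terms Y(k-h+a),
  summed against \<sigma>_h, are in the ideal by \<open>quad_T\<close>; what is left is - P(u) times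
  a polynomial in u, cancelled by the second summand.\<close>

lemma Snum_relation:
  assumes p: "p \<in> {1..CARD('k)}"
  shows "in_Z_ideal (\<lambda>x :: complex ^ ('k::{finite,linorder} + 'k) option.
     (eta p (pr x) - eta CARD('k) (pr x) * x $ None ^ (CARD('k) - p)) * Snum x +
     sigma_val (x $ None) (base_pt (pr x)) * (\<Sum>a<CARD('k) - p. x $ None ^ (CARD('k) - p - 1 - a) * quad a (pr x)))"
    (is "in_Z_ideal ?E")
proof -
  let ?k = "CARD('k)"
  let ?d = "?k - p"
  let ?u = "\<lambda>x :: complex ^ ('k + 'k) option. x $ None"
  let ?D = "\<lambda>i j (x :: complex ^ ('k + 'k) option). eta i (pr x) * eta j (pr x) - quad (2 * ?k - i - j) (pr x)"
  have "in_Z_ideal (\<lambda>x. (\<Sum>h<?k. \<Sum>b<?k - h. (sig h (base_pt (pr x)) * ?u x ^ (?k - h - 1 - b)) * (?D p (?k - b) x +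
      (- (?u x ^ ?d)) * ?D ?k (?k - b) x)) +
      (\<Sum>a<?d. ?u x ^ (?d - 1 - a) * (\<Sum>h\<le>?k. sig h (base_pt (pr x)) * quad (?k - h + a) (pr x))))"
    by (intro in_Z_ideal_add in_Z_ideal_sum in_Z_ideal_mult eta_mult_quad quad_T holo_intros) (use p in auto)
  moreover have "(\<Sum>h<?k. \<Sum>b<?k - h. (sig h (base_pt (pr x)) * ?u x ^ (?k - h - 1 - b)) * (?D p (?k - b) x +
      (- (?u x ^ ?d)) * ?D ?k (?k - b) x)) +
      (\<Sum>a<?d. ?u x ^ (?d - 1 - a) * (\<Sum>h\<le>?k. sig h (base_pt (pr x)) * quad (?k - h + a) (pr x))) = ?E x" for x
  proof -
    define u where "u = ?u x"
    define Y where "Y N = quad N (pr x)" for N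
    define g where "g h = sig h (base_pt (pr x))" for h
    define e where "e i = eta i (pr x)" for i
    have "(\<Sum>h<?k. \<Sum>b<?k - h. (g h * u ^ (?k - h - 1 - b)) * ((e p * e (?k - b) - Y (2 * ?k - p - (?k - b))) +
      (- (u ^ ?d)) * (e ?k * e (?k - b) - Y (2 * ?k - ?k - (?k - b))))) =
      (\<Sum>h<?k. \<Sum>b<?k - h. (e p - e ?k * u ^ ?d) * (g h * (u ^ (?k - h - 1 - b) * e (?k - b)))) -
      (\<Sum>h<?k. g h * (\<Sum>b<?k - h. u ^ (?k - h - 1 - b) * (Y (?d + b) - u ^ ?d * Y b)))"
      unfolding sum_distrib_left sum_subtractf[symmetric]
    proof (intro sum.cong refl)
      fix h b assume "h \<in> {..<?k}" "b \<in> {..<?k - h}"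
      then have "2 * ?k - p - (?k - b) = ?d + b" "2 * ?k - ?k - (?k - b) = b" using p by auto
      then show "(g h * u ^ (?k - h - 1 - b)) * ((e p * e (?k - b) - Y (2 * ?k - p - (?k - b))) +
        (- (u ^ ?d)) * (e ?k * e (?k - b) - Y (2 * ?k - ?k - (?k - b)))) =
        (e p - e ?k * u ^ ?d) * (g h * (u ^ (?k - h - 1 - b) * e (?k - b))) -
        g h * (u ^ (?k - h - 1 - b) * (Y (?d + b) - u ^ ?d * Y b))"
        by (simp add: algebra_simps)
    qed
    also have "(\<Sum>h<?k. \<Sum>b<?k - h. (e p - e ?k * u ^ ?d) * (g h * (u ^ (?k - h - 1 - b) * e (?k - b)))) =
       (e p - e ?k * u ^ ?d) * Snum x"
      by (simp add: Snum_def g_def e_def u_def sum_distrib_left)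
    \<comment> \<open>The term h = k gained on the right is zero, since there u^(k-h) = 1.\<close>
    also have "(\<Sum>h<?k. g h * (\<Sum>b<?k - h. u ^ (?k - h - 1 - b) * (Y (?d + b) - u ^ ?d * Y b))) =
       (\<Sum>h\<le>?k. g h * (\<Sum>a<?d. u ^ (?d - 1 - a) * (Y (?k - h + a) - u ^ (?k - h) * Y a)))"
      unfolding divided_difference_symmetry lessThan_Suc_atMost[symmetric] by simp
    also have "\<dots> = (\<Sum>a<?d. u ^ (?d - 1 - a) * (\<Sum>h\<le>?k. g h * Y (?k - h + a))) -
       (\<Sum>h\<le>?k. g h * u ^ (?k - h)) * (\<Sum>a<?d. u ^ (?d - 1 - a) * Y a)"
    proof -
      have "(\<Sum>h\<le>?k. g h * (\<Sum>a<?d. u ^ (?d - 1 - a) * (Y (?k - h + a) - u ^ (?k - h) * Y a))) =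
        (\<Sum>h\<le>?k. \<Sum>a<?d. u ^ (?d - 1 - a) * (g h * Y (?k - h + a))) -
        (\<Sum>h\<le>?k. \<Sum>a<?d. (g h * u ^ (?k - h)) * (u ^ (?d - 1 - a) * Y a))"
        unfolding sum_distrib_left sum_subtractf[symmetric] by (intro sum.cong refl) (simp add: algebra_simps)
      also have "(\<Sum>h\<le>?k. \<Sum>a<?d. u ^ (?d - 1 - a) * (g h * Y (?k - h + a))) =
        (\<Sum>a<?d. u ^ (?d - 1 - a) * (\<Sum>h\<le>?k. g h * Y (?k - h + a)))"
        unfolding sum_distrib_left by (rule sum.swap)
      also have "(\<Sum>h\<le>?k. \<Sum>a<?d. (g h * u ^ (?k - h)) * (u ^ (?d - 1 - a) * Y a)) =
        (\<Sum>h\<le>?k. g h * u ^ (?k - h)) * (\<Sum>a<?d. u ^ (?d - 1 - a) * Y a)"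
        by (simp only: sum_product)
      finally show ?thesis .
    qed
    also have "(\<Sum>h\<le>?k. g h * u ^ (?k - h)) = sigma_val u (base_pt (pr x))"
      by (simp add: sigma_val_sum g_def)
    finally show ?thesis unfolding u_def Y_def g_def e_def by simp
  qed
  ultimately show ?thesis by simp
qed


subsection \<open>Reducedness along the zero section\<close>

lemma sum_UNIV_Plus: "(\<Sum>i\<in>(UNIV :: ('a::finite + 'b::finite) set). g i) = (\<Sum>i\<in>UNIV. g (Inl i)) + (\<Sum>i\<in>UNIV. g (Inr i))"
  by (subst UNIV_Plus_UNIV[symmetric], subst sum.Plus) auto

lemma norm_le_sum_components: "norm (x :: complex ^ 'n::finite) \<le> (\<Sum>i\<in>UNIV. norm (x $ i))"
  unfolding norm_vec_def by (rule L2_set_le_sum) auto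

lemma continuous_on_vec_components:
  fixes \<phi> :: "'a::topological_space \<Rightarrow> complex ^ 'n::finite"
  assumes "\<And>i. continuous_on S (\<lambda>x. \<phi> x $ i)" shows "continuous_on S \<phi>"
  using continuous_on_vec_lambda[of S "\<lambda>i x. \<phi> x $ i", OF assms] by simp

text \<open>A crude root bound that depends on the norm of \<sigma> alone, so that one circle
  encloses the roots for all nearby points.\<close>

lemma sigma_val_nonzero:
  fixes \<sigma> :: "'k::{finite,linorder} base"
  assumes "norm u > real CARD('k) * norm \<sigma>" "norm u \<ge> 1"
  shows "sigma_val u \<sigma> \<noteq> 0"
proof
  assume "sigma_val u \<sigma> = 0"
  then have "norm (u ^ CARD('k)) = norm (\<Sum>h=1..CARD('k). sig h \<sigma> * u ^ (CARD('k) - h))"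
    unfolding sigma_val_def by (metis add_eq_0_iff norm_minus_cancel)
  also have "\<dots> \<le> (\<Sum>h=1..CARD('k). norm \<sigma> * norm u ^ (CARD('k) - 1))"
  proof (rule order_trans[OF norm_sum sum_mono])
    fix h assume h: "h \<in> {1..CARD('k)}"
    have "norm (sig h \<sigma>) \<le> norm \<sigma>" using h by (simp add: sig_def Finite_Cartesian_Product.norm_nth_le)
    moreover have "norm u ^ (CARD('k) - h) \<le> norm u ^ (CARD('k) - 1)"
      by (rule power_increasing) (use h assms in auto)
    ultimately show "norm (sig h \<sigma> * u ^ (CARD('k) - h)) \<le> norm \<sigma> * norm u ^ (CARD('k) - 1)"
      unfolding norm_mult norm_power by (intro mult_mono) auto
  qed
  also have "\<dots> = real CARD('k) * norm \<sigma> * norm u ^ (CARD('k) - 1)" by simp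
  also have "\<dots> < norm u * norm u ^ (CARD('k) - 1)"
    by (intro mult_strict_right_mono assms(1) zero_less_power) (use assms(2) in linarith)
  also have "\<dots> = norm (u ^ CARD('k))"
    by (simp add: norm_power power_Suc[symmetric] del: power_Suc)
  finally show False by simp
qed

text \<open>A stand-in for the missing projection: it lies on the variety whenever u is a root of
  P_\<sigma>, and u is left free.\<close>

definition rho :: "complex ^ ('k::{finite,linorder} + 'k) option \<Rightarrow> 'k cotangent" where
  "rho x = cotpt (base_pt (pr x)) (\<lambda>i. eta CARD('k) (pr x) * sigma_dir (x $ None) i)"

lemma holo_on_sigma_dir_None [holo_intros]: "holo_on U (\<lambda>x. sigma_dir (x $ None) i)"
  unfolding sigma_dir_def by (intro holo_intros)

lemma holo_on_rho: "holo_on U (\<lambda>x. rho x $ i)"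
  by (cases i) (auto simp: rho_def base_pt_nth intro!: holo_intros)

lemma holo_on_sigma_val_pr [holo_intros]: "holo_on U (\<lambda>x. sigma_val (x $ None) (base_pt (pr x)))"
  unfolding sigma_val_def by (intro holo_intros)

text \<open>The entry of \<open>sigma_dir x\<close> at index k is 1, so \<eta>_k = 0 forces l =
  0.\<close>

lemma base_pt_zero_fibre:
  fixes z :: "'k::{finite,linorder} cotangent"
  assumes "CARD('k) \<ge> 2" "z \<in> zero_locus Z_eqs" "eta CARD('k) z = 0"
  shows "z = cotpt (base_pt z) (\<lambda>_. 0)"
proof -
  obtain \<sigma> x l where P: "sigma_val x \<sigma> = 0" "z = cotpt \<sigma> (\<lambda>i. l * sigma_dir x i)"
    using zero_locus_cotptE[OF assms(1,2)] .
  have "l = 0" using assms(1,3) by (simp add: P eta_nth sigma_dir_crd)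
  then show ?thesis by (simp add: P(2))
qed

lemma zero_section_in_Z:
  assumes "CARD('k) \<ge> 2" shows "cotpt \<sigma> (\<lambda>_. 0) \<in> zero_locus (Z_eqs :: ('k::{finite,linorder} cotangent \<Rightarrow> complex) set)"
proof -
  obtain x where "sigma_val x \<sigma> = 0" by (rule sigma_val_root)
  from cotpt_in_Z[OF assms this, of 0] show ?thesis by simp
qed

text \<open>Here \<open>\<Phi>\<close> vanishes on the smooth hypersurface \<open>sigma_val u \<sigma> = 0\<close>, hence is divisible by its
  equation; so the poles of \<open>\<Phi> / sigma_val\<close> are removable even at multiple roots.\<close>

lemma circle_mean_divisible:
  fixes \<Phi> :: "complex ^ ('k::{finite,linorder} + 'k) option \<Rightarrow> complex"
  assumes V: "open V" and \<Phi>: "holo_on V \<Phi>"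
    and zero: "\<And>x. x \<in> V \<Longrightarrow> sigma_val (x $ None) (base_pt (pr x)) = 0 \<Longrightarrow> \<Phi> x = 0"
    and R: "R > 0" "R < R'" and wV: "\<And>u. norm u < R' \<Longrightarrow> jn w u \<in> V"
    and nz: "\<And>u. norm u \<ge> R \<Longrightarrow> sigma_val u (base_pt w) \<noteq> 0"
    and h: "h holomorphic_on ball 0 R'"
  defines "c \<equiv> \<lambda>s. complex_of_real R * cis (2 * pi * s)"
  shows "((\<lambda>s. \<Phi> (jn w (c s)) / sigma_val (c s) (base_pt w) * (c s * h (c s))) has_integral 0) {0..1}"
proof -
  let ?k = "CARD('k)"
  define P where "P u = sigma_val u (base_pt w)" for u
  define \<phi> where "\<phi> u = \<Phi> (jn w u)" for u
  have jn_hol: "(\<lambda>u. jn w u $ i) holomorphic_on A" for i A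
    by (cases i) auto
  have \<phi>: "\<phi> holomorphic_on ball 0 R'"
    unfolding \<phi>_def[abs_def] by (rule holo_on_curve[OF \<Phi> jn_hol open_ball]) (auto intro: wV)
  have P: "P holomorphic_on A" for A
    unfolding P_def[abs_def] sigma_val_def by (intro holomorphic_intros)
  define K where "K = {u. P u = 0}"
  have K: "finite K" "K \<subseteq> ball 0 R'"
  proof -
    show "finite K" using poly_roots_finite[OF sigma_poly_nonzero[of "base_pt w"]]
      by (simp add: K_def P_def poly_sigma_poly)
    show "K \<subseteq> ball 0 R'"
    proof
      fix u assume "u \<in> K"
      then have "\<not> norm u \<ge> R" using nz[of u] by (auto simp: K_def P_def)
      then show "u \<in> ball 0 R'" using R by simp
    qed
  qed
  have "\<exists>B. eventually (\<lambda>u. norm (\<phi> u / P u) \<le> B) (at \<xi>)" if \<xi>: "\<xi> \<in> K" for \<xi>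
  proof -
    define x0 where "x0 = jn w \<xi>"
    have "norm \<xi> < R'" using K \<xi> by auto
    then have "x0 \<in> V" using wV by (simp add: x0_def)
    then obtain e where e: "e > 0" "ball x0 e \<subseteq> V" using V open_contains_ball by blast
    let ?i = "Some (Inl (crd ?k)) :: ('k + 'k) option"
    \<comment> \<open>Projection onto the hypersurface along \<sigma>_k. It changes one coordinate,
      by the value of the equation, so Hadamard's sum has a single term.\<close>
    define b where "b x = x + axis ?i (- sigma_val (x $ None) (base_pt (pr x)))" for x :: "complex ^ ('k + 'k) option"
    have b_holo: "holo_on A (\<lambda>x. b x $ i)" for i A
      by (cases "i = ?i") (auto simp: b_def axis_def intro!: holo_intros)
    have base_b: "base_pt (pr (b x)) = base_pt (pr x) + axis (crd ?k) (- sigma_val (x $ None) (base_pt (pr x)))" for x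
      by (auto simp: vec_eq_iff base_pt_nth b_def axis_def)
    have sv_b: "sigma_val (b x $ None) (base_pt (pr (b x))) = 0" for x
    proof -
      have "b x $ None = x $ None" by (simp add: b_def axis_def)
      then show ?thesis unfolding base_b by (simp add: sigma_val_add_axis)
    qed
    have cb: "continuous_on UNIV b" by (rule continuous_on_vec_components) (rule holo_on_continuous[OF b_holo])
    have b0: "b x0 = x0" using \<xi> by (simp add: b_def x0_def K_def P_def axis_zero)
    define V2 where "V2 = ball x0 e \<inter> b -` ball x0 e"
    have V2: "open V2" "x0 \<in> V2"
      using e b0 by (auto simp: V2_def intro!: open_Int open_vimage[OF open_ball cb])
    obtain G where G: "\<And>i. holo_on V2 (G i)" "\<And>x. x \<in> V2 \<Longrightarrow> \<Phi> x - \<Phi> (b x) = (\<Sum>i\<in>UNIV. (x $ i - b x $ i) * G i x)"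
      by (rule hadamard[OF holo_on_subset[OF \<Phi> e(2)] open_ball convex_ball V2(1), of "\<lambda>x. x" b])
        (auto simp: V2_def intro: holo_on_nth b_holo)
    have \<Phi>eq: "\<Phi> x = sigma_val (x $ None) (base_pt (pr x)) * G ?i x" if x: "x \<in> V2" for x
    proof -
      have "\<Phi> (b x) = 0" by (rule zero[OF _ sv_b]) (use x e in \<open>auto simp: V2_def\<close>)
      moreover have "(\<Sum>i\<in>UNIV. (x $ i - b x $ i) * G i x) =
          (\<Sum>i\<in>UNIV. if i = ?i then sigma_val (x $ None) (base_pt (pr x)) * G ?i x else 0)"
        by (intro sum.cong refl) (auto simp: b_def axis_def)
      ultimately show ?thesis using G(2)[OF x] by simp
    qed
    have "isCont (G ?i) x0" using holo_on_continuous[OF G(1)] V2 continuous_on_eq_continuous_at by blast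
    moreover have cj: "continuous_on UNIV (jn w)"
      by (rule continuous_on_vec_components) (rule holomorphic_on_imp_continuous_on[OF jn_hol])
    then have lim: "(jn w \<longlongrightarrow> x0) (at \<xi>)"
      unfolding x0_def by (simp add: continuous_on_eq_continuous_at isCont_def)
    ultimately have "((\<lambda>u. G ?i (jn w u)) \<longlongrightarrow> G ?i x0) (at \<xi>)" by (rule isCont_tendsto_compose)
    then have "eventually (\<lambda>u. dist (G ?i (jn w u)) (G ?i x0) < 1) (at \<xi>)" by (rule tendstoD) simp
    moreover have "eventually (\<lambda>u. jn w u \<in> V2) (at \<xi>)" by (rule topological_tendstoD[OF lim V2])
    ultimately have "eventually (\<lambda>u. norm (\<phi> u / P u) \<le> norm (G ?i x0) + 1) (at \<xi>)"
    proof eventually_elim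
      case (elim u)
      have "norm (G ?i (jn w u)) \<le> norm (G ?i x0) + 1"
        using elim(1) norm_triangle_ineq2[of "G ?i (jn w u)" "G ?i x0"] by (simp add: dist_norm)
      moreover have "\<phi> u = P u * G ?i (jn w u)" using \<Phi>eq[OF elim(2)] by (simp add: \<phi>_def P_def)
      ultimately show ?case by (cases "P u = 0") (auto simp: add_nonneg_nonneg)
    qed
    then show ?thesis by blast
  qed
  moreover have "(\<lambda>u. \<phi> u / P u) holomorphic_on (ball 0 R' - K)"
    by (intro holomorphic_intros holomorphic_on_subset[OF \<phi>] P) (auto simp: K_def)
  ultimately obtain g where g: "g holomorphic_on ball 0 R'" "\<forall>u\<in>ball 0 R' - K. g u = \<phi> u / P u"
    using holomorphic_extend_finite[OF K(1) open_ball K(2)] by blast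
  \<comment> \<open>The additional factor u makes the extended integrand vanish at the centre of the
    circle.\<close>
  have "((\<lambda>s. (\<lambda>u. g u * (u * h u)) (c s)) has_integral g 0 * (0 * h 0)) {0..1}"
    unfolding c_def
    by (rule circle_mean_value[OF R(1), of "\<lambda>u. g u * (u * h u)" "ball 0 R'"]) (use R in \<open>auto intro!: holomorphic_intros g h\<close>)
  moreover have "g (c s) = \<Phi> (jn w (c s)) / sigma_val (c s) (base_pt w)" for s
  proof -
    have "norm (c s) = R" using R by (simp add: c_def norm_mult)
    then have "c s \<in> ball 0 R' - K" using nz[of "c s"] R by (auto simp: K_def P_def)
    then show ?thesis using g(2) by (simp add: \<phi>_def P_def)
  qed
  ultimately show ?thesis by simp
qed


text \<open>Three circle means are combined: one equals f(w), one vanishes because f does so on the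
  variety, one vanishes as the mean of a holomorphic function with a factor u. Their integrands add
  up, at each point of the circle, to a combination of the generators, and integrating its
  coefficients gives those of f.\<close>

lemma germ_vanishing_zero_section:
  fixes z :: "'k::{finite,linorder} cotangent"
  assumes k: "CARD('k) \<ge> 2" and z: "z \<in> zero_locus Z_eqs" and zk: "eta CARD('k) z = 0"
    and f: "holo_on W f" "open W" "z \<in> W" and van: "\<And>w. w \<in> W \<Longrightarrow> w \<in> zero_locus Z_eqs \<Longrightarrow> f w = 0"
  shows "germ_in_ideal Z_eqs z f"
proof -
  let ?k = "CARD('k)"
  define \<sigma>0 where "\<sigma>0 = base_pt z"
  have z0: "z = cotpt \<sigma>0 (\<lambda>_. 0)" unfolding \<sigma>0_def by (rule base_pt_zero_fibre[OF k z zk])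
  obtain r where r: "r > 0" "ball z r \<subseteq> W" using f open_contains_ball by blast
  define B where "B = ball z r"
  have B: "open B" "convex B" by (simp_all add: B_def)
  have fB: "holo_on B f" using f(1) r by (auto simp: B_def intro: holo_on_subset)
  \<comment> \<open>Chosen by the root bound: for base points at distance less than 1 from
    \<open>\<sigma>0\<close> all roots lie inside the circle of radius R.\<close>
  define R where "R = 1 + real ?k * (norm \<sigma>0 + 1)"
  have "R \<ge> 1" by (simp add: R_def)
  then have R: "R \<ge> 1" "R > 0" "R < R + 1" by auto
  \<comment> \<open>For |u| < R + 1 the distance of \<open>rho x\<close> to \<open>z\<close> is at
    most \<delta> M: there are k base coordinates, and k fibre coordinates each enlarged by at most
    (R+1)^k.\<close>
  define M where "M = real ?k * (1 + (R + 1) ^ ?k)"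
  have M: "M \<ge> 1"
  proof -
    have "1 \<le> real ?k" using k by simp
    moreover have "1 \<le> 1 + (R + 1) ^ ?k" using R by simp
    ultimately have "1 * 1 \<le> M" unfolding M_def by (intro mult_mono) auto
    then show ?thesis by simp
  qed
  define \<delta> where "\<delta> = min 1 (r / (2 * M))"
  have \<delta>: "\<delta> > 0" "\<delta> \<le> 1" "\<delta> * M < r" "\<delta> < r"
  proof -
    show "\<delta> > 0" "\<delta> \<le> 1" using r M by (auto simp: \<delta>_def)
    have "\<delta> * M \<le> r / (2 * M) * M" unfolding \<delta>_def using M by (intro mult_right_mono) auto
    also have "\<dots> < r" using M r by simp
    finally show "\<delta> * M < r" .
    have "\<delta> * 1 \<le> \<delta> * M" using M \<open>\<delta> > 0\<close> by (intro mult_left_mono) auto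
    with \<open>\<delta> * M < r\<close> show "\<delta> < r" by simp
  qed
  have nz: "sigma_val u (base_pt w) \<noteq> 0" if "w \<in> ball z \<delta>" "norm u \<ge> R" for w u
  proof -
    have "norm (base_pt w - \<sigma>0) \<le> norm (w - z)"
    proof -
      have "(norm (base_pt w - \<sigma>0))\<^sup>2 \<le> (norm (w - z))\<^sup>2"
        unfolding norm_vec_def L2_set_def
        by (simp add: sum_nonneg sum_UNIV_Plus \<sigma>0_def base_pt_nth)
      then show ?thesis by (rule power2_le_imp_le) simp
    qed
    also have "norm (w - z) < 1" using that(1) \<delta> by (simp add: dist_norm norm_minus_commute)
    finally have "norm (base_pt w) < norm \<sigma>0 + 1"
      using norm_triangle_ineq2[of "base_pt w" \<sigma>0] by linarith
    then have "real ?k * norm (base_pt w) \<le> real ?k * (norm \<sigma>0 + 1)" by (intro mult_left_mono) auto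
    also have "\<dots> < R" by (simp add: R_def)
    finally show ?thesis using that(2) R by (intro sigma_val_nonzero) auto
  qed
  define V where "V = {x :: complex ^ ('k + 'k) option. pr x \<in> ball z \<delta> \<and> norm (x $ None) < R + 1}"
  have cpr: "continuous_on A (pr :: complex ^ ('k + 'k) option \<Rightarrow> 'k cotangent)" for A
    by (rule continuous_on_vec_components) (auto intro!: continuous_intros)
  have V: "open V"
  proof -
    have "open (pr -` ball z \<delta> :: (complex ^ ('k + 'k) option) set)" by (rule open_vimage[OF open_ball cpr])
    moreover have "open {x :: complex ^ ('k + 'k) option. norm (x $ None) < R + 1}"
      by (intro open_Collect_less continuous_intros)
    ultimately show ?thesis unfolding V_def by (simp add: vimage_def Collect_conj_eq open_Int)
  qed
  have jnV: "jn w u \<in> V" if "w \<in> ball z \<delta>" "norm u < R + 1" for w u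
    using that by (simp add: V_def)
  have prB: "pr x \<in> B" if "x \<in> V" for x using that \<delta> by (auto simp: V_def B_def)
  have rhoB: "rho x \<in> B" if x: "x \<in> V" for x
  proof -
    have c: "norm (pr x $ i - z $ i) < \<delta>" for i
      using x Finite_Cartesian_Product.norm_nth_le[of "pr x - z" i]
      by (simp add: V_def dist_norm norm_minus_commute)
    have "norm (rho x - z) \<le> (\<Sum>i\<in>UNIV. norm ((rho x - z) $ i))" by (rule norm_le_sum_components)
    also have "\<dots> = (\<Sum>i\<in>(UNIV :: 'k set). norm (pr x $ Inl i - z $ Inl i)) +
        (\<Sum>i\<in>(UNIV :: 'k set). norm (eta ?k (pr x)) * norm (x $ None) ^ (?k - the_inv_into {1..?k} crd i))"
      unfolding sum_UNIV_Plus
      by (intro arg_cong2[where f="(+)"] sum.cong refl)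
        (simp_all add: rho_def base_pt_nth sigma_dir_def norm_mult norm_power, simp add: z0 norm_mult norm_power)
    also have "\<dots> \<le> (\<Sum>i\<in>(UNIV :: 'k set). \<delta>) + (\<Sum>i\<in>(UNIV :: 'k set). \<delta> * (R + 1) ^ ?k)"
    proof (intro add_mono sum_mono)
      fix i :: 'k
      show "norm (pr x $ Inl i - z $ Inl i) \<le> \<delta>" using c[of "Inl i"] by simp
      have "norm (eta ?k (pr x)) \<le> \<delta>" using c[of "Inr (crd ?k)"] by (simp add: eta_nth z0)
      moreover have "norm (x $ None) ^ (?k - the_inv_into {1..?k} crd i) \<le> (R + 1) ^ ?k"
      proof -
        have "norm (x $ None) ^ (?k - the_inv_into {1..?k} crd i) \<le> (R + 1) ^ (?k - the_inv_into {1..?k} crd i)"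
          using x by (intro power_mono) (auto simp: V_def)
        also have "\<dots> \<le> (R + 1) ^ ?k" using R by (intro power_increasing) auto
        finally show ?thesis .
      qed
      ultimately show "norm (eta ?k (pr x)) * norm (x $ None) ^ (?k - the_inv_into {1..?k} crd i) \<le> \<delta> * (R + 1) ^ ?k"
        using \<delta> by (intro mult_mono) auto
    qed
    also have "\<dots> = \<delta> * M" by (simp add: M_def algebra_simps)
    also have "\<dots> < r" by (rule \<delta>)
    finally show ?thesis by (simp add: B_def dist_norm norm_minus_commute)
  qed
  have bB: "cotpt (base_pt w) (\<lambda>_. 0) \<in> B" if "w \<in> B" for w
  proof -
    have "(norm (cotpt (base_pt w) (\<lambda>_. 0) - z))\<^sup>2 \<le> (norm (w - z))\<^sup>2"
      unfolding norm_vec_def L2_set_def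
      by (simp add: sum_nonneg sum_UNIV_Plus base_pt_nth) (simp add: z0 sum_nonneg)
    then have "norm (cotpt (base_pt w) (\<lambda>_. 0) - z) \<le> norm (w - z)" by (rule power2_le_imp_le) simp
    then show ?thesis using that by (simp add: B_def dist_norm norm_minus_commute)
  qed
  obtain G1 where G1: "\<And>i. holo_on B (G1 i)"
    "\<And>w. w \<in> B \<Longrightarrow> f w - f (cotpt (base_pt w) (\<lambda>_. 0)) = (\<Sum>i\<in>UNIV. (w $ i - cotpt (base_pt w) (\<lambda>_. 0) $ i) * G1 i w)"
  proof (rule hadamard[OF fB B B(1), of "\<lambda>w. w" "\<lambda>w. cotpt (base_pt w) (\<lambda>_. 0)"])
    show "holo_on B (\<lambda>w. cotpt (base_pt w) (\<lambda>_. 0) $ i)" for i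
      by (cases i) (auto simp: base_pt_nth intro!: holo_intros)
  qed (auto intro: holo_on_nth bB)
  \<comment> \<open>The zero section lies in the variety, so f vanishes on it, and Hadamard's lemma
    along the fibres leaves only the fibre coordinates as factors.\<close>
  define F where "F i = G1 (Inr i)" for i
  have hF: "holo_on B (F i)" for i by (simp add: F_def G1)
  have fF: "f w = (\<Sum>i\<in>UNIV. w $ Inr i * F i w)" if w: "w \<in> B" for w
  proof -
    have "f (cotpt (base_pt w) (\<lambda>_. 0)) = 0"
      using van[OF _ zero_section_in_Z[OF k]] bB[OF w] r by (auto simp: B_def)
    then show ?thesis using G1(2)[OF w] by (simp add: sum_UNIV_Plus base_pt_nth F_def)
  qed
  \<comment> \<open>f at \<open>rho x\<close> is \<eta>_k \<Phi>; this is the factor of \<eta>_k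
    that must vanish at the roots.\<close>
  define \<Phi> where "\<Phi> x = (\<Sum>i\<in>UNIV. sigma_dir (x $ None) i * F i (rho x))" for x
  have h\<Phi>: "holo_on V \<Phi>"
    unfolding \<Phi>_def[abs_def] by (intro holo_intros holo_on_compose[OF hF holo_on_rho rhoB])
  have \<Phi>0: "\<Phi> x = 0" if x: "x \<in> V" and sv: "sigma_val (x $ None) (base_pt (pr x)) = 0" for x
  proof -
    have ne: "\<Phi> y = 0" if y: "y \<in> V" "sigma_val (y $ None) (base_pt (pr y)) = 0" "eta ?k (pr y) \<noteq> 0" for y
    proof -
      have "f (rho y) = 0"
        using van[OF _ cotpt_in_Z[OF k y(2)]] rhoB[OF y(1)] r by (auto simp: B_def rho_def)
      moreover have "f (rho y) = eta ?k (pr y) * \<Phi> y"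
        unfolding fF[OF rhoB[OF y(1)]] \<Phi>_def sum_distrib_left by (intro sum.cong refl) (simp add: rho_def mult_ac)
      ultimately show ?thesis using y(3) by simp
    qed
    show ?thesis
    proof (cases "eta ?k (pr x) = 0")
      case True
      \<comment> \<open>At \<eta>_k = 0 the factor cannot be cancelled; \<eta>_k is perturbed with
        \<sigma> and u fixed, and continuity gives the value.\<close>
      let ?y = "\<lambda>t. x + axis (Some (Inr (crd ?k))) t"
      have lim: "(?y \<longlongrightarrow> x) (at 0)"
      proof -
        have "(?y \<longlongrightarrow> x + axis (Some (Inr (crd ?k))) 0) (at 0)"
          by (intro tendsto_intros bounded_linear.tendsto[OF bounded_linear_axis])
        then show ?thesis by (simp add: axis_zero)
      qed
      have "eventually (\<lambda>t. ?y t \<in> V) (at 0)" by (rule topological_tendstoD[OF lim V x])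
      moreover have "eventually (\<lambda>t::complex. t \<noteq> 0) (at 0)" by (simp add: eventually_at_filter)
      ultimately have "eventually (\<lambda>t. \<Phi> (?y t) = 0) (at 0)"
      proof eventually_elim
        case (elim t)
        have b: "base_pt (pr (?y t)) = base_pt (pr x)" by (simp add: vec_eq_iff base_pt_nth axis_def)
        have e: "eta ?k (pr (?y t)) = t" using True by (simp add: eta_nth axis_def)
        have n: "?y t $ None = x $ None" by (simp add: axis_def)
        show ?case by (rule ne[OF elim(1)]) (use elim(2) sv in \<open>simp_all only: b e n not_False_eq_True\<close>)
      qed
      then have "((\<lambda>t. \<Phi> (?y t)) \<longlongrightarrow> 0) (at 0)" by (rule tendsto_eventually)
      moreover have "isCont \<Phi> x" using holo_on_continuous[OF h\<Phi>] V x continuous_on_eq_continuous_at by blast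
      from isCont_tendsto_compose[OF this lim] have "((\<lambda>t. \<Phi> (?y t)) \<longlongrightarrow> \<Phi> x) (at 0)" .
      ultimately show ?thesis using tendsto_unique[OF trivial_limit_at] by blast
    qed (use ne[OF x sv] in auto)
  qed
  \<comment> \<open>Hadamard again, now between the point and \<open>rho x\<close>. Their base
    coordinates agree, so the error consists of multiples of \<eta>_p - \<eta>_k u^(k-p), the factor
    in \<open>Snum_relation\<close>.\<close>
  have "\<exists>G. (\<forall>j. holo_on V (G j)) \<and> (\<forall>x\<in>V. F i (pr x) - F i (rho x) = (\<Sum>j\<in>UNIV. (pr x $ j - rho x $ j) * G j x))" for i
    by (rule hadamard[OF hF B V, of pr rho i]) (auto intro: holo_on_nth holo_on_rho prB rhoB)
  then obtain G2 where G2: "\<And>i j. holo_on V (G2 i j)"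
    "\<And>i x. x \<in> V \<Longrightarrow> F i (pr x) - F i (rho x) = (\<Sum>j\<in>UNIV. (pr x $ j - rho x $ j) * G2 i j x)"
    by metis
  let ?q = "\<lambda>p x. \<Sum>a<?k - p. x $ None ^ (?k - p - 1 - a) * quad a (pr x)"
  have "\<forall>p\<in>{1..?k}. \<exists>c. (\<forall>s\<in>Z_eqs. holo_on UNIV (c s)) \<and>
      (\<forall>x :: complex ^ ('k + 'k) option. (eta p (pr x) - eta ?k (pr x) * x $ None ^ (?k - p)) * Snum x +
        sigma_val (x $ None) (base_pt (pr x)) * ?q p x = (\<Sum>s\<in>Z_eqs. c s x * s (pr x)))"
    using Snum_relation unfolding in_Z_ideal_def by blast
  from bchoice[OF this] obtain c where c: "\<And>p s. p \<in> {1..?k} \<Longrightarrow> s \<in> Z_eqs \<Longrightarrow> holo_on UNIV (c p s)"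
    and crel: "\<And>p (x :: complex ^ ('k + 'k) option). p \<in> {1..?k} \<Longrightarrow>
        (eta p (pr x) - eta ?k (pr x) * x $ None ^ (?k - p)) * Snum x +
        sigma_val (x $ None) (base_pt (pr x)) * ?q p x = (\<Sum>s\<in>Z_eqs. c p s x * s (pr x))"
    by blast
  let ?sv = "\<lambda>x :: complex ^ ('k + 'k) option. sigma_val (x $ None) (base_pt (pr x))"
  \<comment> \<open>The coefficient of the generator \<open>s\<close> in the error after division by
    P(u); the zeros of P(u) are avoided by staying on the circle.\<close>
  define Q where "Q s x = (\<Sum>i\<in>UNIV. \<Sum>p=1..?k. G2 i (Inr (crd p)) x * sigma_dir (x $ None) i * x $ None * c p s x) / ?sv x"
    for s x
  define V' where "V' = V \<inter> {x. ?sv x \<noteq> 0}"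
  have hQ: "holo_on V' (Q s)" if "s \<in> Z_eqs" for s
    unfolding Q_def[abs_def] V'_def
    by (intro holo_intros holo_on_subset[OF G2(1)] holo_on_subset[OF c]) (use that in auto)
  define cc where "cc s = complex_of_real R * cis (2 * pi * s)" for s
  have ncc: "norm (cc s) = R" for s using R by (simp add: cc_def norm_mult)
  have jnV': "jn w (cc s) \<in> V'" if "w \<in> ball z \<delta>" for w s
    using jnV[OF that, of "cc s"] nz[OF that, of "cc s"] by (simp add: V'_def ncc)
  define g where "g s w = integral {0..1} (\<lambda>t. Q s (jn w (cc t)))" for s w
  have hol_jn: "holo_on A (\<lambda>w. jn w u $ i)" for A u and i :: "('k + 'k) option"
    by (cases i) (auto intro: holo_intros)
  have hg: "holo_on (ball z \<delta>) (g s)" if s: "s \<in> Z_eqs" for s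
    unfolding g_def[abs_def]
  proof (rule holo_on_param_integral[OF open_ball])
    show "holo_on (ball z \<delta>) (\<lambda>w. Q s (jn w (cc t)))" for t
      by (rule holo_on_compose[OF hQ[OF s] hol_jn jnV'])
    have "continuous_on (ball z \<delta> \<times> {0..1}) (\<lambda>p. jn (fst p) (cc (snd p)) $ i)" for i :: "('k + 'k) option"
      by (cases i) (auto simp: cc_def intro!: continuous_intros)
    then have "continuous_on (ball z \<delta> \<times> {0..1}) (\<lambda>p. jn (fst p) (cc (snd p)))"
      by (rule continuous_on_vec_components)
    then show "continuous_on (ball z \<delta> \<times> {0..1}) (\<lambda>(w, t). Q s (jn w (cc t)))"
      unfolding split_beta
      by (rule continuous_on_compose2[OF holo_on_continuous[OF hQ[OF s]]]) (use jnV' in auto)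
  qed
  show ?thesis
  proof (rule germ_in_idealI[OF finite_Z_eqs open_ball, of z z \<delta>])
    show "z \<in> ball z \<delta>" using \<delta> by simp
    show "holo_on (ball z \<delta>) (g s)" if "s \<in> Z_eqs" for s by (rule hg[OF that])
    fix w assume w: "w \<in> ball z \<delta>"
    have wB: "w \<in> B" using w \<delta> by (auto simp: B_def)
    let ?P = "\<lambda>t. sigma_val (cc t) (base_pt w)"
    let ?S = "\<lambda>t. Snum (jn w (cc t))"
    have jn_curve: "(\<lambda>u. jn w u $ i) holomorphic_on A" for A and i :: "('k + 'k) option"
      by (cases i) auto
    have hol_curve: "(\<lambda>u. h (jn w u)) holomorphic_on ball 0 (R + 1)" if "holo_on V h" for h
      by (rule holo_on_curve[OF that jn_curve open_ball]) (auto intro: jnV[OF w])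
    have Pnz: "?P t \<noteq> 0" for t using nz[OF w, of "cc t"] by (simp add: ncc)
    have I1: "((\<lambda>t. \<Sum>i\<in>UNIV. F i w * (sigma_dir (cc t) i * (cc t * ?S t / ?P t))) has_integral f w) {0..1}"
    proof -
      have "((\<lambda>t. sigma_dir (cc t) i * (cc t * ?S t / ?P t)) has_integral w $ Inr i) {0..1}" for i
      proof -
        obtain p where p: "p \<in> {1..?k}" "i = crd p" by (metis crd_surj)
        have "?k - p < ?k" "?k - (?k - p) = p" using p by auto
        then show ?thesis
          using Snum_circle_mean[OF R(2) nz[OF w], of "?k - p"] p by (simp add: sigma_dir_crd cc_def eta_nth)
      qed
      then have "((\<lambda>t. \<Sum>i\<in>UNIV. F i w * (sigma_dir (cc t) i * (cc t * ?S t / ?P t))) has_integral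
          (\<Sum>i\<in>UNIV. F i w * w $ Inr i)) {0..1}"
        by (intro has_integral_sum has_integral_mult_right) auto
      then show ?thesis using fF[OF wB] by (simp add: mult.commute)
    qed
    have I2: "((\<lambda>t. \<Phi> (jn w (cc t)) / ?P t * (cc t * ?S t)) has_integral 0) {0..1}"
      unfolding cc_def
      by (rule circle_mean_divisible[OF V h\<Phi> \<Phi>0 R(2,3) jnV[OF w] nz[OF w] hol_curve[OF holo_on_Snum]])
    \<comment> \<open>The part of the error that \<open>Snum_relation\<close> makes divisible by
      P(u), after the division: no pole is left, and the factor u gives mean zero.\<close>
    define X where "X x = (\<Sum>i\<in>UNIV. \<Sum>p=1..?k. G2 i (Inr (crd p)) x * sigma_dir (x $ None) i * x $ None * ?q p x)"
      for x :: "complex ^ ('k + 'k) option"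
    have I3: "((\<lambda>t. X (jn w (cc t))) has_integral 0) {0..1}"
    proof -
      have "holo_on V X" unfolding X_def[abs_def] by (intro holo_intros G2)
      then have "((\<lambda>t. X (jn w (cc t))) has_integral X (jn w 0)) {0..1}"
        unfolding cc_def by (intro circle_mean_value[OF R(2) hol_curve open_ball]) (use R in auto)
      moreover have "X (jn w 0) = 0" by (simp add: X_def)
      ultimately show ?thesis by simp
    qed
    have I4: "((\<lambda>t. \<Sum>s\<in>Z_eqs. s w * Q s (jn w (cc t))) has_integral (\<Sum>s\<in>Z_eqs. s w * g s w)) {0..1}"
    proof (intro has_integral_sum has_integral_mult_right finite_Z_eqs)
      fix s :: "'k cotangent \<Rightarrow> complex" assume s: "s \<in> Z_eqs"
      have "continuous_on {0..1} (\<lambda>t. jn w (cc t))"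
      proof (rule continuous_on_vec_components)
        show "continuous_on {0..1} (\<lambda>t. jn w (cc t) $ i)" for i :: "('k + 'k) option"
          by (cases i) (auto simp: cc_def intro!: continuous_intros)
      qed
      then have "continuous_on {0..1} (\<lambda>t. Q s (jn w (cc t)))"
        by (rule continuous_on_compose2[OF holo_on_continuous[OF hQ[OF s]]]) (use jnV'[OF w] in auto)
      then show "((\<lambda>t. Q s (jn w (cc t))) has_integral g s w) {0..1}"
        unfolding g_def by (intro integrable_integral integrable_continuous_real)
    qed
    \<comment> \<open>The first two terms combine to the differences F_i(w) - F_i(rho x); adding
      \<open>X\<close> completes each product with S to the left-hand side of
      \<open>Snum_relation\<close>.\<close>
    have pw: "(\<Sum>i\<in>UNIV. F i w * (sigma_dir (cc t) i * (cc t * ?S t / ?P t))) - \<Phi> (jn w (cc t)) / ?P t * (cc t * ?S t)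
        + X (jn w (cc t)) = (\<Sum>s\<in>Z_eqs. s w * Q s (jn w (cc t)))" for t
    proof -
      define x where "x = jn w (cc t)"
      define u where "u = cc t"
      have x: "x \<in> V" unfolding x_def by (rule jnV[OF w]) (simp add: ncc)
      have xs: "pr x = w" "x $ None = u" by (simp_all add: x_def u_def)
      have dF: "F i w - F i (rho x) = (\<Sum>p=1..?k. (eta p w - eta ?k w * u ^ (?k - p)) * G2 i (Inr (crd p)) x)" for i
      proof -
        have "F i w - F i (rho x) = (\<Sum>j\<in>UNIV. (w $ j - rho x $ j) * G2 i j x)"
          using G2(2)[OF x, of i] by (simp add: xs)
        also have "\<dots> = (\<Sum>j\<in>UNIV. (w $ Inr j - eta ?k w * sigma_dir u j) * G2 i (Inr j) x)"
          by (simp add: sum_UNIV_Plus rho_def xs base_pt_nth)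
        also have "\<dots> = (\<Sum>p=1..?k. (eta p w - eta ?k w * u ^ (?k - p)) * G2 i (Inr (crd p)) x)"
          unfolding sum_crd by (intro sum.cong refl) (simp add: sigma_dir_crd eta_nth)
        finally show ?thesis .
      qed
      define A where "A i p = G2 i (Inr (crd p)) x * sigma_dir u i * u" for i p
      have \<Phi>u: "\<Phi> x / ?P t * (u * Snum x) = (\<Sum>i\<in>UNIV. F i (rho x) * (sigma_dir u i * (u * Snum x / ?P t)))"
        unfolding \<Phi>_def xs sum_divide_distrib sum_distrib_right by (intro sum.cong refl) (simp add: mult_ac)
      have "(\<Sum>i\<in>UNIV. F i w * (sigma_dir u i * (u * Snum x / ?P t))) - \<Phi> x / ?P t * (u * Snum x) + X x =
         (\<Sum>i\<in>UNIV. (F i w - F i (rho x)) * (sigma_dir u i * (u * Snum x / ?P t))) + X x"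
        unfolding \<Phi>u left_diff_distrib sum_subtractf ..
      also have "(\<Sum>i\<in>UNIV. (F i w - F i (rho x)) * (sigma_dir u i * (u * Snum x / ?P t))) =
         (\<Sum>i\<in>UNIV. \<Sum>p=1..?k. A i p * ((eta p w - eta ?k w * u ^ (?k - p)) * Snum x) / ?P t)"
        unfolding dF sum_distrib_right A_def by (intro sum.cong refl) (simp add: mult_ac)
      also have "\<dots> + X x = (\<Sum>i\<in>UNIV. \<Sum>p=1..?k. A i p * ((eta p w - eta ?k w * u ^ (?k - p)) * Snum x + ?P t * ?q p x) / ?P t)"
        unfolding X_def xs A_def[symmetric] sum.distrib[symmetric]
        using Pnz[of t] by (intro sum.cong refl) (simp add: field_simps)
      also have "\<dots> = (\<Sum>i\<in>UNIV. \<Sum>p=1..?k. A i p * (\<Sum>s\<in>Z_eqs. c p s x * s w) / ?P t)"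
      proof (intro sum.cong refl)
        fix i p assume "p \<in> {1..?k}"
        from crel[OF this, of x] show "A i p * ((eta p w - eta ?k w * u ^ (?k - p)) * Snum x + ?P t * ?q p x) / ?P t =
            A i p * (\<Sum>s\<in>Z_eqs. c p s x * s w) / ?P t"
          by (simp add: xs u_def)
      qed
      also have "\<dots> = (\<Sum>i\<in>UNIV. \<Sum>p=1..?k. \<Sum>s\<in>Z_eqs. A i p * c p s x * s w / ?P t)"
        by (simp add: sum_distrib_left sum_divide_distrib mult.assoc)
      also have "\<dots> = (\<Sum>i\<in>UNIV. \<Sum>s\<in>Z_eqs. \<Sum>p=1..?k. A i p * c p s x * s w / ?P t)"
        by (rule sum.cong[OF refl]) (rule sum.swap)
      also have "\<dots> = (\<Sum>s\<in>Z_eqs. \<Sum>i\<in>UNIV. \<Sum>p=1..?k. A i p * c p s x * s w / ?P t)"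
        by (rule sum.swap)
      also have "\<dots> = (\<Sum>s\<in>Z_eqs. s w * Q s x)"
        by (intro sum.cong refl) (simp add: Q_def xs A_def u_def sum_distrib_left sum_distrib_right sum_divide_distrib mult_ac)
      finally show ?thesis by (simp add: x_def u_def)
    qed
    have "((\<lambda>t. \<Sum>s\<in>Z_eqs. s w * Q s (jn w (cc t))) has_integral (f w - 0 + 0)) {0..1}"
      using has_integral_add[OF has_integral_diff[OF I1 I2] I3] unfolding pw .
    then have "f w = (\<Sum>s\<in>Z_eqs. s w * g s w)" using has_integral_unique[OF _ I4] by simp
    then show "f w = (\<Sum>s\<in>Z_eqs. g s w * s w)" by (simp add: mult.commute)
  qed
qed

text \<open>If a power of f lies in the ideal, then f vanishes on the variety near z, and for such f
  membership has been shown in both cases of \<eta>_k. Only the trivial direction between ideals and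
  zero sets enters.\<close>

lemma reduced_Z:
  assumes k: "CARD('k) \<ge> 2"
  shows "reduced_subspace (Z_eqs :: ('k::{finite,linorder} cotangent \<Rightarrow> complex) set)"
  unfolding reduced_subspace_def
proof (intro ballI allI impI)
  fix z :: "'k cotangent" and W f n
  assume z: "z \<in> zero_locus Z_eqs" and "open W \<and> z \<in> W \<and> holo_on W f \<and> germ_in_ideal Z_eqs z (\<lambda>w. f w ^ n)"
  then have W: "open W" "z \<in> W" and f: "holo_on W f" and g: "germ_in_ideal Z_eqs z (\<lambda>w. f w ^ n)" by auto
  obtain W1 c where W1: "open W1" "z \<in> W1" "\<And>s. s \<in> Z_eqs \<Longrightarrow> holo_on W1 (c s)"
    "\<And>w. w \<in> W1 \<Longrightarrow> f w ^ n = (\<Sum>s\<in>Z_eqs. c s w * s w)"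
    using germ_in_ideal_full[OF finite_Z_eqs g] by blast
  have van: "f w = 0" if "w \<in> W \<inter> W1" "w \<in> zero_locus Z_eqs" for w
  proof -
    have "(\<Sum>s\<in>Z_eqs. c s w * s w) = 0"
      using that(2) by (intro sum.neutral) (simp add: zero_locus_def)
    then show ?thesis using W1(4)[of w] that(1) by simp
  qed
  have h: "holo_on (W \<inter> W1) f" "open (W \<inter> W1)" "z \<in> W \<inter> W1"
    using W W1 f by (auto intro: holo_on_subset)
  show "germ_in_ideal Z_eqs z f"
    by (cases "eta CARD('k) z = 0")
      (use germ_vanishing_zero_section[OF k z _ h van] germ_vanishing_off_zero_section[OF k z _ h van] in auto)
qed

theorem proposition2p2p3:
  fixes \<mu> :: complex
  assumes "CARD('k::{finite,linorder}) \<ge> 2" and "\<mu> \<noteq> 0"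
  shows
    "(char_variety (I_sheaf \<mu> :: ('k base) set \<Rightarrow> 'k diffop set) = zero_locus Z_eqs \<and>
      reduced_subspace (Z_eqs :: ('k cotangent \<Rightarrow> complex) set) \<and>
      irreducible_subset (zero_locus Z_eqs :: ('k cotangent) set)) \<and>
     (\<forall>h\<in>{1..CARD('k)}. \<forall>U :: ('k base) set. open U \<longrightarrow>
        (\<forall>P\<in>I_sheaf (\<mu> + 1) U. P \<circ> dd h \<in> I_sheaf \<mu> U)) \<and>
     (\<forall>U :: ('k base) set. open U \<longrightarrow>
        (\<forall>P\<in>I_sheaf \<mu> U.
           P \<circ> Um1_op \<in> I_sheaf \<mu> U \<and>
           P \<circ> U0_op \<in> I_sheaf \<mu> U \<and>
           P \<circ> (\<lambda>f x. U1_op f x + \<mu> * sig 1 x * f x) \<in> I_sheaf \<mu> U)) \<and>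
     (\<forall>U :: ('k base) set. open U \<longrightarrow>
        (\<forall>P\<in>I_sheaf (\<mu> + 1) U. P \<circ> (\<lambda>f x. E_op f x + \<mu> * f x) \<in> I_sheaf \<mu> U))"
proof -
  \<comment> \<open>Each of the claims on right multiplication is thereby reduced to the finitely
    many generators.\<close>
  have comp: "P \<circ> R \<in> I_sheaf \<mu> U"
    if "open U" "P \<in> I_sheaf \<mu>' U" "R \<in> D_sections UNIV" "\<And>G. G \<in> gens \<mu>' \<Longrightarrow> in_left_ideal (gens \<mu>) (G \<circ> R)"
    for U :: "('k base) set" and P R :: "'k diffop" and \<mu>'
    unfolding I_sheaf_gens
    by (rule left_ideal_comp[OF finite_gens D_sections_gens that(1,3,4) that(2)[unfolded I_sheaf_gens]])
  have V: "(\<lambda>f x. U1_op f x + \<mu> * sig 1 x * f x) = (Vop \<mu> :: 'k diffop)"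
    by (simp add: Vop_def fun_eq_iff)
  have E: "(\<lambda>f x. E_op f x + \<mu> * f x) = (Emu \<mu> :: 'k diffop)"
    by (simp add: Emu_def fun_eq_iff)
  show ?thesis
    unfolding V E
  proof (intro conjI ballI allI impI)
    show "char_variety (I_sheaf \<mu> :: ('k base) set \<Rightarrow> 'k diffop set) = zero_locus Z_eqs"
      by (rule equalityI[OF char_variety_subset char_variety_superset[OF assms]])
    show "reduced_subspace (Z_eqs :: ('k cotangent \<Rightarrow> complex) set)" by (rule reduced_Z[OF assms(1)])
    show "irreducible_subset (zero_locus Z_eqs :: ('k cotangent) set)"
      by (rule irreducible_zero_locus[OF assms(1)])
    fix U :: "('k base) set" and P :: "'k diffop" assume U: "open U"
    show "P \<circ> dd h \<in> I_sheaf \<mu> U" if "h \<in> {1..CARD('k)}" "P \<in> I_sheaf (\<mu> + 1) U" for h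
      by (rule comp[OF U that(2) D_sections_dd[OF _ D_sections_id] gens_dd[OF that(1)]]) auto
    show "P \<circ> Um1_op \<in> I_sheaf \<mu> U" if "P \<in> I_sheaf \<mu> U"
      by (rule comp[OF U that D_sections_Um1 gens_Um1]) auto
    show "P \<circ> U0_op \<in> I_sheaf \<mu> U" if "P \<in> I_sheaf \<mu> U"
      by (rule comp[OF U that D_sections_U0 gens_U0]) auto
    show "P \<circ> Vop \<mu> \<in> I_sheaf \<mu> U" if "P \<in> I_sheaf \<mu> U"
      by (rule comp[OF U that D_sections_V gens_V]) auto
    show "P \<circ> Emu \<mu> \<in> I_sheaf \<mu> U" if "P \<in> I_sheaf (\<mu> + 1) U"
      by (rule comp[OF U that D_sections_Emu gens_Emu]) auto
  qed
qed

end
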